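(* Let $n\ge 1$, let $\eta\in\mathbb{R}$, and let $\varphi:\mathbb{C}^n\to\mathbb{R}$ be a $\mathcal{C}^2$-function satisfying $$\lim_{|z|\to\infty}\bigl(\eta^2|\nabla\varphi(z)|^2+(1+\epsilon)\,\eta\,\triangle\varphi(z)\bigr)=+\infty$$ for some $\epsilon>0$. Then the canonical embedding $$\iota_{\varphi,\eta}:W^1_\eta(\mathbb{C}^n,e^{-\varphi})\hookrightarrow L^2(\mathbb{C}^n,e^{-\varphi})$$ is compact.
   Context: Write $z=(z_1,\dots,z_n)$ with $z_j=x_j+iy_j$, identifying $\mathbb{C}^n\cong\mathbb{R}^{2n}$; $\lambda$ is Lebesgue measure. Here $|\nabla\varphi(z)|^2=\sum_{k=1}^n\left(\left|\frac{\partial\varphi}{\partial x_k}\right|^2+\left|\frac{\partial\varphi}{\partial y_k}\right|^2\right)$ and $\triangle\varphi=\sum_{k=1}^n\left(\frac{\partial^2\varphi}{\partial x_k^2}+\frac{\partial^2\varphi}{\partial y_k^2}\right)$. $L^2(\mathbb{C}^n,e^{-\varphi})$ is the Hilbert space of measurable $g:\mathbb{C}^n\to\mathbb{C}$ with $\|g\|_\varphi^2=\int_{\mathbb{C}^n}|g|^2e^{-\varphi}\,d\lambda<\infty$. For $j=1,\dots,n$ put $X_j=\frac{\partial}{\partial x_j}-\frac{1+\eta}{2}\frac{\partial\varphi}{\partial x_j}$ and $Y_j=\frac{\partial}{\partial y_j}-\frac{1+\eta}{2}\frac{\partial\varphi}{\partial y_j}$ (derivatives of the function acted upon are in the sense of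 distributions). The weighted Sobolev space is $$W^1_\eta(\mathbb{C}^n,e^{-\varphi})=\{f\in L^2(\mathbb{C}^n,e^{-\varphi}):X_jf,\ Y_jf\in L^2(\mathbb{C}^n,e^{-\varphi}),\ j=1,\dots,n\},$$ with norm $\|f\|_{\varphi,\eta}^2=\|f\|_\varphi^2+\sum_{j=1}^n(\|X_jf\|_\varphi^2+\|Y_jf\|_\varphi^2)$. *)

theory Defs
  imports "HOL-Analysis.Analysis"
begin

section \<open>Classes of differentiability and differential expressions\<close>

definition dir_deriv :: "'a::real_normed_vector \<Rightarrow> ('a \<Rightarrow> 'b::real_normed_vector) \<Rightarrow> 'a \<Rightarrow> 'b"
  where "dir_deriv v f z = frechet_derivative f (at z) v"

primrec Ck :: "nat \<Rightarrow> ('a::euclidean_space \<Rightarrow> 'b::real_normed_vector) \<Rightarrow> bool" where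
  "Ck 0 f \<longleftrightarrow> continuous_on UNIV f"
| "Ck (Suc k) f \<longleftrightarrow> (\<forall>z. f differentiable (at z)) \<and> (\<forall>b\<in>Basis. Ck k (dir_deriv b f))"

text \<open>With \<open>z\<^sub>j = x\<^sub>j + i y\<^sub>j\<close>, the real coordinate direction of \<open>x\<^sub>j\<close> is \<^term>\<open>axis j 1\<close>
  and that of \<open>y\<^sub>j\<close> is \<^term>\<open>axis j \<i>\<close>; together these vectors are the \<^const>\<open>Basis\<close>
  of \<^typ>\<open>complex^'n\<close>, seen as a real Euclidean space.\<close>

abbreviation xdir :: "'n::finite \<Rightarrow> complex^'n" where "xdir j \<equiv> axis j 1"
abbreviation ydir :: "'n::finite \<Rightarrow> complex^'n" where "ydir j \<equiv> axis j \<i>"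

definition grad_sq :: "(complex^'n \<Rightarrow> real) \<Rightarrow> complex^'n \<Rightarrow> real" where
  "grad_sq \<phi> z = (\<Sum>j\<in>UNIV. \<bar>dir_deriv (xdir j) \<phi> z\<bar>\<^sup>2 + \<bar>dir_deriv (ydir j) \<phi> z\<bar>\<^sup>2)"

definition laplacian :: "(complex^'n \<Rightarrow> real) \<Rightarrow> complex^'n \<Rightarrow> real" where
  "laplacian \<phi> z =
    (\<Sum>j\<in>UNIV. dir_deriv (xdir j) (dir_deriv (xdir j) \<phi>) z + dir_deriv (ydir j) (dir_deriv (ydir j) \<phi>) z)"

section \<open>Weighted spaces\<close>

text \<open>The sets \<open>L2_fun\<close> and \<open>W1_fun\<close> consist of functions; the spaces \<open>L2_space\<close> and
  \<open>W1_space\<close> consist of their classes modulo equality almost everywhere.\<close>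

definition L2_fun :: "(complex^'n \<Rightarrow> real) \<Rightarrow> (complex^'n \<Rightarrow> complex) set" where
  "L2_fun \<phi> = {g \<in> borel_measurable lebesgue. integrable lebesgue (\<lambda>z. (cmod (g z))\<^sup>2 * exp (- \<phi> z))}"

definition L2_norm :: "(complex^'n \<Rightarrow> real) \<Rightarrow> (complex^'n \<Rightarrow> complex) \<Rightarrow> real" where
  "L2_norm \<phi> g = sqrt (LINT z|lebesgue. (cmod (g z))\<^sup>2 * exp (- \<phi> z))"

definition ae_rel :: "(complex^'n \<Rightarrow> real) \<Rightarrow> ((complex^'n \<Rightarrow> complex) \<times> (complex^'n \<Rightarrow> complex)) set" where
  "ae_rel \<phi> = {(f, g). f \<in> L2_fun \<phi> \<and> g \<in> L2_fun \<phi> \<and> (AE z in lebesgue. f z = g z)}"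

definition L2_space :: "(complex^'n \<Rightarrow> real) \<Rightarrow> (complex^'n \<Rightarrow> complex) set set" where
  "L2_space \<phi> = L2_fun \<phi> // ae_rel \<phi>"

text \<open>A seminorm on functions that is invariant under equality almost everywhere induces
  a norm on classes, and a distance of classes.\<close>

definition class_norm :: "(('a \<Rightarrow> 'b) \<Rightarrow> real) \<Rightarrow> ('a \<Rightarrow> 'b) set \<Rightarrow> real" where
  "class_norm N F = the_elem (N ` F)"

definition class_dist :: "(('a \<Rightarrow> 'b::minus) \<Rightarrow> real) \<Rightarrow> ('a \<Rightarrow> 'b) set \<Rightarrow> ('a \<Rightarrow> 'b) set \<Rightarrow> real" where
  "class_dist N F G = the_elem ((\<lambda>(f, g). N (\<lambda>z. f z - g z)) ` (F \<times> G))"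

text \<open>The value outside \<open>L2_space\<close> only serves to make the distance nonnegative everywhere, as
  the locale \<^locale>\<open>Metric_space\<close> requires.\<close>

definition L2_dist :: "(complex^'n \<Rightarrow> real) \<Rightarrow> (complex^'n \<Rightarrow> complex) set \<Rightarrow> (complex^'n \<Rightarrow> complex) set \<Rightarrow> real" where
  "L2_dist \<phi> F G =
     (if F \<in> L2_space \<phi> \<and> G \<in> L2_space \<phi> then class_dist (L2_norm \<phi>) F G else 0)"

definition test_fun :: "(complex^'n \<Rightarrow> complex) set" where
  "test_fun = {\<psi>. (\<forall>k. Ck k \<psi>) \<and> compact (closure (support_on UNIV \<psi>))}"

text \<open>For \<open>v = xdir j\<close> and \<open>v = ydir j\<close> these are the distributions \<open>X\<^sub>j f\<close> and \<open>Y\<^sub>j f\<close>, as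
  functionals on test functions. If \<open>\<phi>\<close> is of class \<open>C\<^sup>1\<close> and \<open>f \<in> L2_fun \<phi>\<close>, then \<open>f\<close> is locally
  integrable and both integrals converge.\<close>

definition X_distr ::
  "(complex^'n \<Rightarrow> real) \<Rightarrow> real \<Rightarrow> complex^'n \<Rightarrow> (complex^'n \<Rightarrow> complex) \<Rightarrow> (complex^'n \<Rightarrow> complex) \<Rightarrow> complex" where
  "X_distr \<phi> \<eta> v f \<psi> =
     - (LINT z|lebesgue. f z * dir_deriv v \<psi> z)
     - (LINT z|lebesgue. complex_of_real ((1 + \<eta>) / 2 * dir_deriv v \<phi> z) * f z * \<psi> z)"

definition is_X ::
  "(complex^'n \<Rightarrow> real) \<Rightarrow> real \<Rightarrow> complex^'n \<Rightarrow> (complex^'n \<Rightarrow> complex) \<Rightarrow> (complex^'n \<Rightarrow> complex) \<Rightarrow> bool" where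
  "is_X \<phi> \<eta> v f g \<longleftrightarrow>
     g \<in> L2_fun \<phi> \<and> (\<forall>\<psi>\<in>test_fun. (LINT z|lebesgue. g z * \<psi> z) = X_distr \<phi> \<eta> v f \<psi>)"

text \<open>The function representing the distribution is unique up to equality almost everywhere,
  so the choice does not matter below.\<close>

definition X_op ::
  "(complex^'n \<Rightarrow> real) \<Rightarrow> real \<Rightarrow> complex^'n \<Rightarrow> (complex^'n \<Rightarrow> complex) \<Rightarrow> (complex^'n \<Rightarrow> complex)" where
  "X_op \<phi> \<eta> v f = (SOME g. is_X \<phi> \<eta> v f g)"

definition W1_fun :: "(complex^'n \<Rightarrow> real) \<Rightarrow> real \<Rightarrow> (complex^'n \<Rightarrow> complex) set" where
  "W1_fun \<phi> \<eta> = {f \<in> L2_fun \<phi>. \<forall>j. (\<exists>g. is_X \<phi> \<eta> (xdir j) f g) \<and> (\<exists>g. is_X \<phi> \<eta> (ydir j) f g)}"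

definition W1_norm :: "(complex^'n \<Rightarrow> real) \<Rightarrow> real \<Rightarrow> (complex^'n \<Rightarrow> complex) \<Rightarrow> real" where
  "W1_norm \<phi> \<eta> f = sqrt ((L2_norm \<phi> f)\<^sup>2 +
     (\<Sum>j\<in>UNIV. (L2_norm \<phi> (X_op \<phi> \<eta> (xdir j) f))\<^sup>2 + (L2_norm \<phi> (X_op \<phi> \<eta> (ydir j) f))\<^sup>2))"

text \<open>Membership in \<open>W1_fun\<close> is invariant under equality almost everywhere, so the classes of
  its elements under \<open>ae_rel\<close> are subsets of \<open>W1_fun\<close>, and \<open>W1_space\<close> is a subset of \<open>L2_space\<close>.\<close>

definition W1_space :: "(complex^'n \<Rightarrow> real) \<Rightarrow> real \<Rightarrow> (complex^'n \<Rightarrow> complex) set set" where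
  "W1_space \<phi> \<eta> = W1_fun \<phi> \<eta> // ae_rel \<phi>"

section \<open>Compact operators\<close>

text \<open>\<open>T\<close> maps norm-bounded subsets of \<open>V\<close> to relatively compact subsets of the metric space
  \<open>(M, d)\<close>.\<close>

definition compact_operator ::
  "'a set \<Rightarrow> ('a \<Rightarrow> real) \<Rightarrow> 'b set \<Rightarrow> ('b \<Rightarrow> 'b \<Rightarrow> real) \<Rightarrow> ('a \<Rightarrow> 'b) \<Rightarrow> bool" where
  "compact_operator V N M d T \<longleftrightarrow>
     T \<in> V \<rightarrow> M \<and>
     (\<forall>B\<subseteq>V. (\<exists>C. \<forall>x\<in>B. N x \<le> C) \<longrightarrow>
        compactin (Metric_space.mtopology M d) ((Metric_space.mtopology M d) closure_of (T ` B)))"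

section \<open>Consistency of the definitions\<close>

lemma equiv_ae_rel: "equiv (L2_fun \<phi>) (ae_rel \<phi>)"
proof (rule equivI)
  show "ae_rel \<phi> \<subseteq> L2_fun \<phi> \<times> L2_fun \<phi>" "refl_on (L2_fun \<phi>) (ae_rel \<phi>)"
    by (auto simp: ae_rel_def refl_on_def)
  show "sym (ae_rel \<phi>)"
    by (auto simp: ae_rel_def sym_def elim: eventually_mono)
  show "trans (ae_rel \<phi>)"
    unfolding trans_def ae_rel_def by (auto elim: eventually_elim2)
qed

lemma lebesgue_measurable_cong_AE:
  assumes "AE z in lebesgue. f z = g z" "f \<in> borel_measurable lebesgue"
  shows "g \<in> borel_measurable lebesgue"
proof (rule measurableI)
  fix A :: "'b set" assume A: "A \<in> sets borel"
  have 1: "f -` A \<inter> space lebesgue \<in> sets lebesgue"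
    using assms(2) A by (rule measurable_sets)
  have 2: "AE z in lebesgue. z \<in> f -` A \<inter> space lebesgue \<longleftrightarrow> z \<in> g -` A \<inter> space lebesgue"
    using assms(1) by (auto elim: eventually_mono)
  show "g -` A \<inter> space lebesgue \<in> sets lebesgue"
    by (rule completion.in_sets_AE[OF 2 1]) auto
qed auto

lemma lebesgue_integral_cong_AE:
  assumes "AE z in lebesgue. f z = g z"
  shows "(LINT z|lebesgue. f z) = (LINT z|lebesgue. g z)"
proof (cases "f \<in> borel_measurable lebesgue")
  case True
  then show ?thesis
    using assms lebesgue_measurable_cong_AE[OF assms] by (intro integral_cong_AE)
next
  case False
  have "AE z in lebesgue. g z = f z"
    using assms by (auto elim: eventually_mono)
  with False have "g \<notin> borel_measurable lebesgue"
    using lebesgue_measurable_cong_AE by blast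
  with False have "\<not> integrable lebesgue f" "\<not> integrable lebesgue g"
    by (auto dest: borel_measurable_integrable)
  then show ?thesis
    by (simp add: not_integrable_integral_eq)
qed

lemma is_X_cong_AE:
  assumes "(f, g) \<in> ae_rel \<phi>"
  shows "is_X \<phi> \<eta> v f = is_X \<phi> \<eta> v g"
proof -
  have ae: "AE z in lebesgue. f z = g z"
    using assms by (auto simp: ae_rel_def)
  have "X_distr \<phi> \<eta> v f \<psi> = X_distr \<phi> \<eta> v g \<psi>" for \<psi>
    unfolding X_distr_def
    by (intro arg_cong2[of _ _ _ _ "(-)"] arg_cong[of _ _ uminus] lebesgue_integral_cong_AE)
       (use ae in \<open>auto elim: eventually_mono\<close>)
  then show ?thesis
    by (simp add: is_X_def fun_eq_iff)
qed

lemma W1_fun_subset: "W1_fun \<phi> \<eta> \<subseteq> L2_fun \<phi>"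
  by (auto simp: W1_fun_def)

lemma W1_space_subset: "W1_space \<phi> \<eta> \<subseteq> L2_space \<phi>"
  using W1_fun_subset by (auto simp: W1_space_def L2_space_def quotient_def)

lemma W1_fun_cong_AE: "(f, g) \<in> ae_rel \<phi> \<Longrightarrow> f \<in> W1_fun \<phi> \<eta> \<longleftrightarrow> g \<in> W1_fun \<phi> \<eta>"
  using is_X_cong_AE[of f g \<phi> \<eta>] by (auto simp: W1_fun_def ae_rel_def)

lemma L2_norm_cong_AE: "AE z in lebesgue. f z = g z \<Longrightarrow> L2_norm \<phi> f = L2_norm \<phi> g"
  unfolding L2_norm_def
  by (intro arg_cong[of _ _ sqrt] lebesgue_integral_cong_AE) (auto elim: eventually_mono)

lemma W1_norm_cong_AE: "(f, g) \<in> ae_rel \<phi> \<Longrightarrow> W1_norm \<phi> \<eta> f = W1_norm \<phi> \<eta> g"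
  using is_X_cong_AE[of f g \<phi> \<eta>] L2_norm_cong_AE[of f g \<phi>]
  by (auto simp: W1_norm_def X_op_def ae_rel_def)

lemma L2_dist_class:
  assumes "f \<in> L2_fun \<phi>" "g \<in> L2_fun \<phi>"
  shows "L2_dist \<phi> (ae_rel \<phi> `` {f}) (ae_rel \<phi> `` {g}) = L2_norm \<phi> (\<lambda>z. f z - g z)"
proof -
  let ?h = "\<lambda>(f, g). L2_norm \<phi> (\<lambda>z. f z - g z)"
  have "?h p = ?h (f, g)" if p: "p \<in> (ae_rel \<phi> `` {f}) \<times> (ae_rel \<phi> `` {g})" for p
  proof -
    obtain f' g' where *: "p = (f', g')" "(f, f') \<in> ae_rel \<phi>" "(g, g') \<in> ae_rel \<phi>"
      using p by blast
    then have "AE z in lebesgue. f z = f' z" "AE z in lebesgue. g z = g' z"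
      by (simp_all add: ae_rel_def)
    then have "AE z in lebesgue. f' z - g' z = f z - g z"
      by eventually_elim simp
    then show ?thesis
      unfolding * prod.case by (rule L2_norm_cong_AE)
  qed
  moreover have "(ae_rel \<phi> `` {f}) \<times> (ae_rel \<phi> `` {g}) \<noteq> {}"
    using assms by (auto simp: ae_rel_def)
  ultimately have "class_dist (L2_norm \<phi>) (ae_rel \<phi> `` {f}) (ae_rel \<phi> `` {g}) = ?h (f, g)"
    unfolding class_dist_def by (rule the_elem_image_unique[rotated])
  moreover have "ae_rel \<phi> `` {f} \<in> L2_space \<phi>" "ae_rel \<phi> `` {g} \<in> L2_space \<phi>"
    using assms by (auto simp: L2_space_def intro: quotientI)
  ultimately show ?thesis
    by (simp only: L2_dist_def prod.case simp_thms if_True)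
qed

lemma W1_norm_class:
  assumes "f \<in> W1_fun \<phi> \<eta>"
  shows "class_norm (W1_norm \<phi> \<eta>) (ae_rel \<phi> `` {f}) = W1_norm \<phi> \<eta> f"
  unfolding class_norm_def
proof (rule the_elem_image_unique)
  show "ae_rel \<phi> `` {f} \<noteq> {}"
    using assms by (auto simp: ae_rel_def W1_fun_def)
  show "W1_norm \<phi> \<eta> g = W1_norm \<phi> \<eta> f" if "g \<in> ae_rel \<phi> `` {f}" for g
    using that W1_norm_cong_AE[of f g] by simp
qed

lemma weighted_square_triangle:
  fixes f g :: "'a \<Rightarrow> complex"
  assumes "integrable M (\<lambda>z. (cmod (f z))\<^sup>2 * w z)" "integrable M (\<lambda>z. (cmod (g z))\<^sup>2 * w z)"
    and [measurable]: "f \<in> borel_measurable M" "g \<in> borel_measurable M" "w \<in> borel_measurable M"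
    and w: "\<And>z. 0 \<le> w z"
  shows "integrable M (\<lambda>z. (cmod (f z + g z))\<^sup>2 * w z)"
    and "sqrt (LINT z|M. (cmod (f z + g z))\<^sup>2 * w z)
      \<le> sqrt (LINT z|M. (cmod (f z))\<^sup>2 * w z) + sqrt (LINT z|M. (cmod (g z))\<^sup>2 * w z)"
proof -
  have pw: "(cmod (f z + g z))\<^sup>2 * w z
      \<le> (1 + t) * ((cmod (f z))\<^sup>2 * w z) + (1 + 1 / t) * ((cmod (g z))\<^sup>2 * w z)" if "t > 0" for t z
  proof -
    define a b where "a = cmod (f z)" and "b = cmod (g z)"
    have "(cmod (f z + g z))\<^sup>2 \<le> (a + b)\<^sup>2"
      unfolding a_def b_def by (intro power_mono norm_triangle_ineq) auto
    also have "\<dots> \<le> (1 + t) * a\<^sup>2 + (1 + 1 / t) * b\<^sup>2"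
    proof -
      have "0 \<le> (t * a - b)\<^sup>2 / t"
        using that by simp
      also have "\<dots> = t * a\<^sup>2 - 2 * a * b + b\<^sup>2 / t"
        using that by (simp add: field_simps power2_eq_square)
      finally show ?thesis
        by (simp add: power2_sum algebra_simps)
    qed
    finally have "(cmod (f z + g z))\<^sup>2 * w z \<le> ((1 + t) * a\<^sup>2 + (1 + 1 / t) * b\<^sup>2) * w z"
      using w by (intro mult_right_mono)
    then show ?thesis
      by (simp add: a_def b_def algebra_simps)
  qed
  have int_bound: "integrable M (\<lambda>z. (1 + t) * ((cmod (f z))\<^sup>2 * w z) + (1 + 1 / t) * ((cmod (g z))\<^sup>2 * w z))"
    for t :: real
    using assms(1,2) by (intro Bochner_Integration.integrable_add integrable_mult_right)
  show int: "integrable M (\<lambda>z. (cmod (f z + g z))\<^sup>2 * w z)"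
  proof (rule Bochner_Integration.integrable_bound[OF int_bound[of 1]])
    show "AE z in M. norm ((cmod (f z + g z))\<^sup>2 * w z)
        \<le> norm ((1 + 1) * ((cmod (f z))\<^sup>2 * w z) + (1 + 1 / 1) * ((cmod (g z))\<^sup>2 * w z))"
      using pw[of 1] w by (intro AE_I2) (simp add: abs_mult)
  qed measurable
  define A B C where "A = (LINT z|M. (cmod (f z))\<^sup>2 * w z)" and "B = (LINT z|M. (cmod (g z))\<^sup>2 * w z)"
    and "C = (LINT z|M. (cmod (f z + g z))\<^sup>2 * w z)"
  have nn: "0 \<le> A" "0 \<le> B"
    unfolding A_def B_def using w by (auto intro!: Bochner_Integration.integral_nonneg)
  have C: "C \<le> (1 + t) * A + (1 + 1 / t) * B" if "t > 0" for t
  proof -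
    have "C \<le> (LINT z|M. (1 + t) * ((cmod (f z))\<^sup>2 * w z) + (1 + 1 / t) * ((cmod (g z))\<^sup>2 * w z))"
      unfolding C_def using pw[OF that] by (intro integral_mono int int_bound)
    also have "\<dots> = (1 + t) * A + (1 + 1 / t) * B"
      unfolding A_def B_def using assms(1,2)
      by (subst Bochner_Integration.integral_add) (auto intro!: integrable_mult_right simp del: distrib_right_numeral)
    finally show ?thesis .
  qed
  have "sqrt C \<le> (sqrt A + sqrt B) + e" if "e > 0" for e
  proof -
    define a b where "a = sqrt A + e / 2" and "b = sqrt B + e / 2"
    have pos: "a > 0" "b > 0"
      using nn that by (auto simp: a_def b_def intro!: add_nonneg_pos)
    have "sqrt A \<le> a" "sqrt B \<le> b"
      using that by (auto simp: a_def b_def)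
    then have "(sqrt A)\<^sup>2 \<le> a\<^sup>2" "(sqrt B)\<^sup>2 \<le> b\<^sup>2"
      using nn by (intro power_mono; simp)+
    then have AB: "A \<le> a\<^sup>2" "B \<le> b\<^sup>2"
      using nn by simp_all
    have "C \<le> (1 + b / a) * A + (1 + 1 / (b / a)) * B"
      using pos by (intro C) simp
    also have "\<dots> \<le> (1 + b / a) * a\<^sup>2 + (1 + 1 / (b / a)) * b\<^sup>2"
      using AB pos by (intro add_mono mult_left_mono) auto
    also have "\<dots> = (a + b)\<^sup>2"
      using pos by (simp add: field_simps power2_eq_square)
    finally have "sqrt C \<le> a + b"
      using pos by (intro real_le_lsqrt) auto
    then show ?thesis
      by (simp add: a_def b_def)
  qed
  then have "sqrt C \<le> sqrt A + sqrt B"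
    by (rule field_le_epsilon)
  then show "sqrt (LINT z|M. (cmod (f z + g z))\<^sup>2 * w z)
      \<le> sqrt (LINT z|M. (cmod (f z))\<^sup>2 * w z) + sqrt (LINT z|M. (cmod (g z))\<^sup>2 * w z)"
    by (simp add: A_def B_def C_def)
qed

lemma exp_weight_measurable:
  fixes \<phi> :: "complex^'n \<Rightarrow> real"
  assumes "continuous_on UNIV \<phi>"
  shows "(\<lambda>z. exp (- \<phi> z)) \<in> borel_measurable lebesgue"
proof -
  have "continuous_on UNIV (\<lambda>z. exp (- \<phi> z))"
    using assms by (intro continuous_intros)
  then show ?thesis
    by (intro measurable_completion) (simp add: borel_measurable_continuous_onI)
qed

lemma L2_fun_uminus: "f \<in> L2_fun \<phi> \<Longrightarrow> (\<lambda>z. - f z) \<in> L2_fun \<phi>"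
  by (auto simp: L2_fun_def)

lemma L2_fun_add:
  assumes "continuous_on UNIV \<phi>" "f \<in> L2_fun \<phi>" "g \<in> L2_fun \<phi>"
  shows "(\<lambda>z. f z + g z) \<in> L2_fun \<phi>"
    and "L2_norm \<phi> (\<lambda>z. f z + g z) \<le> L2_norm \<phi> f + L2_norm \<phi> g"
  using weighted_square_triangle[of lebesgue f "\<lambda>z. exp (- \<phi> z)" g]
    exp_weight_measurable[OF assms(1)] assms(2,3)
  by (auto simp: L2_fun_def L2_norm_def)

lemma L2_fun_diff:
  assumes "continuous_on UNIV \<phi>" "f \<in> L2_fun \<phi>" "g \<in> L2_fun \<phi>"
  shows "(\<lambda>z. f z - g z) \<in> L2_fun \<phi>"
  using L2_fun_add(1)[OF assms(1,2) L2_fun_uminus[OF assms(3)]] by simp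

lemma Metric_space_L2:
  fixes \<phi> :: "complex^'n \<Rightarrow> real"
  assumes "continuous_on UNIV \<phi>"
  shows "Metric_space (L2_space \<phi>) (L2_dist \<phi>)"
proof -
  let ?M = "L2_space \<phi>" and ?d = "L2_dist \<phi>"
  have rep: "\<exists>f\<in>L2_fun \<phi>. F = ae_rel \<phi> `` {f}" if "F \<in> ?M" for F
    using that by (auto simp: L2_space_def elim: quotientE)
  have nn: "L2_norm \<phi> f \<ge> 0" for f
    by (simp add: L2_norm_def Bochner_Integration.integral_nonneg)
  have comm: "L2_norm \<phi> (\<lambda>z. f z - g z) = L2_norm \<phi> (\<lambda>z. g z - f z)" for f g
    by (simp add: L2_norm_def norm_minus_commute)
  have zero: "?d F G = 0 \<longleftrightarrow> F = G" if "F \<in> ?M" "G \<in> ?M" for F G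
  proof -
    obtain f g where fg: "f \<in> L2_fun \<phi>" "g \<in> L2_fun \<phi>" "F = ae_rel \<phi> `` {f}" "G = ae_rel \<phi> `` {g}"
      using rep[OF \<open>F \<in> ?M\<close>] rep[OF \<open>G \<in> ?M\<close>] by blast
    have "integrable lebesgue (\<lambda>z. (cmod (f z - g z))\<^sup>2 * exp (- \<phi> z))"
      using L2_fun_diff[OF assms fg(1,2)] by (simp add: L2_fun_def)
    then have "L2_norm \<phi> (\<lambda>z. f z - g z) = 0 \<longleftrightarrow>
        (AE z in lebesgue. (cmod (f z - g z))\<^sup>2 * exp (- \<phi> z) = 0)"
      unfolding L2_norm_def by (subst real_sqrt_eq_0_iff, subst integral_nonneg_eq_0_iff_AE) auto
    also have "\<dots> \<longleftrightarrow> (f, g) \<in> ae_rel \<phi>"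
      using fg by (simp add: ae_rel_def)
    also have "\<dots> \<longleftrightarrow> F = G"
      using eq_equiv_class_iff[OF equiv_ae_rel fg(1,2)] fg by simp
    finally show ?thesis
      using L2_dist_class[OF fg(1,2)] fg by simp
  qed
  show ?thesis
  proof
    show "0 \<le> ?d F G" for F G
    proof (cases "F \<in> ?M \<and> G \<in> ?M")
      case True
      then obtain f g where "f \<in> L2_fun \<phi>" "g \<in> L2_fun \<phi>" "F = ae_rel \<phi> `` {f}" "G = ae_rel \<phi> `` {g}"
        using rep by meson
      then show ?thesis
        using nn by (simp add: L2_dist_class)
    qed (auto simp: L2_dist_def)
    show "?d F G = ?d G F" for F G
    proof (cases "F \<in> ?M \<and> G \<in> ?M")
      case True
      then obtain f g where "f \<in> L2_fun \<phi>" "g \<in> L2_fun \<phi>" "F = ae_rel \<phi> `` {f}" "G = ae_rel \<phi> `` {g}"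
        using rep by meson
      then show ?thesis
        using comm[of f g] by (simp add: L2_dist_class)
    qed (auto simp: L2_dist_def)
    show "?d F G = 0 \<longleftrightarrow> F = G" if "F \<in> ?M" "G \<in> ?M" for F G
      using zero[OF that] .
    show "?d F H \<le> ?d F G + ?d G H" if FGH: "F \<in> ?M" "G \<in> ?M" "H \<in> ?M" for F G H
    proof -
      obtain f g h where *: "f \<in> L2_fun \<phi>" "g \<in> L2_fun \<phi>" "h \<in> L2_fun \<phi>"
          "F = ae_rel \<phi> `` {f}" "G = ae_rel \<phi> `` {g}" "H = ae_rel \<phi> `` {h}"
        using rep[OF FGH(1)] rep[OF FGH(2)] rep[OF FGH(3)] by blast
      have "L2_norm \<phi> (\<lambda>z. (f z - g z) + (g z - h z))
          \<le> L2_norm \<phi> (\<lambda>z. f z - g z) + L2_norm \<phi> (\<lambda>z. g z - h z)"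
        by (rule L2_fun_add(2)[OF assms L2_fun_diff[OF assms *(1,2)] L2_fun_diff[OF assms *(2,3)]])
      then show ?thesis
        using * by (simp add: L2_dist_class)
    qed
  qed
qed

end

theory Submission
  imports Defs "HOL-Complex_Analysis.Great_Picard" "HOL-Computational_Algebra.Polynomial"
begin

text \<open>
  Let \<open>f\<close> lie in the weighted Sobolev space and let \<open>g\<^sub>b\<close> represent the operator of the real
  coordinate direction \<open>b\<close> applied to \<open>f\<close>. As a distribution, \<open>f\<close> then has the derivative
  \<open>g\<^sub>b + (1 + \<eta>) / 2 \<phi>\<^sub>b f\<close> in direction \<open>b\<close>, which is locally square integrable. Compactness of the
  embedding rests on two properties of a norm-bounded set of such functions: its members have
  uniformly little mass far out (\<open>tail_estimate\<close>), and if a sequence of members is multiplied by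
  a fixed cutoff, two of the products are close to each other (\<open>rellich_close_pair\<close>).

  The mass far out is controlled by the hypothesis on \<open>\<phi>\<close>. If \<open>v\<close> has bounded support and weak
  derivative \<open>w\<close> in direction \<open>b\<close>, and \<open>A\<close> is of class \<open>C\<^sup>1\<close>, integration by parts gives
  \<open>\<integral> A\<^sub>b |v|\<^sup>2 = - 2 \<integral> A \<langle>v, w\<rangle>\<close> with the real inner product (\<open>weak_energy_identity\<close>). For
  \<open>v = \<theta> f\<close> with a cutoff \<open>\<theta>\<close> and for \<open>A = e\<^bsup>-\<phi>\<^esup> \<phi>\<^sub>b\<close>, the zeroth order term of \<open>w\<close> combines
  with the derivative of the weight, and after multiplication by \<open>\<eta>\<close> the identity becomes
  \<open>\<integral> (\<eta> \<phi>\<^sub>b\<^sub>b + \<eta>\<^sup>2 \<phi>\<^sub>b\<^sup>2) |v|\<^sup>2 e\<^bsup>-\<phi>\<^esup> = - 2 \<integral> \<eta> \<phi>\<^sub>b \<langle>v, q\<rangle> e\<^bsup>-\<phi>\<^esup>\<close>, where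
  \<open>q = \<theta> g\<^sub>b + \<theta>\<^sub>b f\<close> is bounded in the weighted space. Completing the square on the right costs an
  arbitrarily small part of \<open>\<eta>\<^sup>2 \<phi>\<^sub>b\<^sup>2 |v|\<^sup>2\<close>; if this part is the fraction \<open>\<epsilon> / (1 + \<epsilon>)\<close>, summation
  over \<open>b\<close> bounds \<open>\<integral> (\<eta>\<^sup>2 |\<nabla>\<phi>|\<^sup>2 + (1 + \<epsilon>) \<eta> \<triangle>\<phi>) |v|\<^sup>2 e\<^bsup>-\<phi>\<^esup>\<close> uniformly. As the bracket tends to
  infinity, little of the mass can sit outside a large ball.

  On a ball the weight is harmless, and the argument is that of Rellich. A weak derivative bounds
  the effect of a translation (\<open>sq_norm_translate_le\<close>), hence mollification at scale \<open>r\<close> changes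
  the functions by \<open>O(r)\<close> in \<open>L\<^sup>2\<close>; for fixed \<open>r\<close> the mollified functions are equibounded and
  equicontinuous, so the theorem of Arzela and Ascoli applies to them.

  Together these facts make every norm-bounded set totally bounded (\<open>W1_close_pair\<close>), and the
  weighted space is complete (\<open>mcomplete_L2\<close>), so the closure of such a set is compact.
\<close>

section \<open>Calculus of the classes \<open>Ck\<close>\<close>

lemma dir_deriv_eq: "(f has_derivative D) (at z) \<Longrightarrow> dir_deriv v f z = D v"
  unfolding dir_deriv_def using frechet_derivative_at by metis

lemma has_derivative_dir_deriv:
  "f differentiable (at z) \<Longrightarrow> (f has_derivative (\<lambda>v. dir_deriv v f z)) (at z)"
  unfolding dir_deriv_def by (simp add: frechet_derivative_works[symmetric])

lemma Ck_Suc_imp_Ck: "Ck (Suc k) f \<Longrightarrow> Ck k f"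
proof (induction k arbitrary: f)
  case 0
  then show ?case
    by (simp add: continuous_on_eq_continuous_at differentiable_imp_continuous_within)
next
  case (Suc k)
  then show ?case
    by (metis Ck.simps(2))
qed

lemma Ck_add: "Ck k f \<Longrightarrow> Ck k g \<Longrightarrow> Ck k (\<lambda>z. f z + g z)"
proof (induction k arbitrary: f g)
  case 0
  then show ?case by (auto intro: continuous_on_add)
next
  case (Suc k)
  have "dir_deriv b (\<lambda>z. f z + g z) = (\<lambda>z. dir_deriv b f z + dir_deriv b g z)" for b
  proof
    fix z
    show "dir_deriv b (\<lambda>z. f z + g z) z = dir_deriv b f z + dir_deriv b g z"
      using Suc.prems by (intro dir_deriv_eq has_derivative_add has_derivative_dir_deriv) auto
  qed
  then show ?case
    using Suc by auto
qed

lemma Ck_bounded_linear: "bounded_linear h \<Longrightarrow> Ck k f \<Longrightarrow> Ck k (\<lambda>z. h (f z))"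
proof (induction k arbitrary: f)
  case 0
  then show ?case by (auto intro: bounded_linear.continuous_on)
next
  case (Suc k)
  have *: "((\<lambda>z. h (f z)) has_derivative (\<lambda>v. h (dir_deriv v f z))) (at z)" for z
    using Suc.prems by (intro bounded_linear.has_derivative[OF Suc.prems(1)] has_derivative_dir_deriv) auto
  have "dir_deriv b (\<lambda>z. h (f z)) = (\<lambda>z. h (dir_deriv b f z))" for b
    using dir_deriv_eq[OF *] by auto
  moreover have "(\<lambda>z. h (f z)) differentiable (at z)" for z
    using * differentiableI by blast
  ultimately show ?case
    using Suc by auto
qed

lemma Ck_mult:
  fixes f g :: "'a::euclidean_space \<Rightarrow> 'b::real_normed_algebra"
  shows "Ck k f \<Longrightarrow> Ck k g \<Longrightarrow> Ck k (\<lambda>z. f z * g z)"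
proof (induction k arbitrary: f g)
  case 0
  then show ?case by (auto intro: continuous_on_mult)
next
  case (Suc k)
  have *: "((\<lambda>z. f z * g z) has_derivative (\<lambda>v. f z * dir_deriv v g z + dir_deriv v f z * g z)) (at z)" for z
    using Suc.prems by (intro has_derivative_mult has_derivative_dir_deriv) auto
  have "dir_deriv b (\<lambda>z. f z * g z) = (\<lambda>z. f z * dir_deriv b g z + dir_deriv b f z * g z)" for b
    using dir_deriv_eq[OF *] by auto
  moreover have "(\<lambda>z. f z * g z) differentiable (at z)" for z
    using * differentiableI by blast
  ultimately show ?case
    using Suc Ck_Suc_imp_Ck[OF Suc.prems(1)] Ck_Suc_imp_Ck[OF Suc.prems(2)]
    by (auto intro!: Ck_add)
qed

section \<open>Smooth bump functions\<close>

text \<open>Up to a polynomial in \<open>1 / s\<close> this is \<open>exp (- 1 / s)\<close>. Admitting all polynomials makes the family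
  closed under differentiation, so that each member is smooth, including at \<open>0\<close>.\<close>

definition flat :: "real poly \<Rightarrow> real \<Rightarrow> real" where
  "flat p s = (if s > 0 then poly p (1 / s) * exp (- (1 / s)) else 0)"

lemma poly_times_exp_tendsto_0: "((\<lambda>x. poly p x * exp (- x)) \<longlongrightarrow> (0::real)) at_top"
proof -
  have "((\<lambda>x. x ^ k * poly p x / exp x) \<longlongrightarrow> 0) at_top" for k
  proof (induction p arbitrary: k)
    case 0
    then show ?case by simp
  next
    case (pCons a p)
    have "((\<lambda>x. a * (x ^ k / exp x) + x ^ Suc k * poly p x / exp x) \<longlongrightarrow> a * 0 + 0) at_top"
      by (intro tendsto_intros pCons.IH tendsto_power_div_exp_0)
    then show ?case
      by (simp add: algebra_simps add_divide_distrib)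
  qed
  from this[of 0] show ?thesis
    by (simp add: exp_minus field_simps)
qed

lemma flat_tendsto_0: "(flat p \<longlongrightarrow> 0) (at 0)"
proof (rule filterlim_split_at)
  have "eventually (\<lambda>x. flat p x = 0) (at_left (0::real))"
    unfolding eventually_at_filter by (simp add: flat_def)
  then show "(flat p \<longlongrightarrow> 0) (at_left 0)"
    by (rule tendsto_eventually)
  have "((\<lambda>s. poly p (1 / s) * exp (- (1 / s))) \<longlongrightarrow> 0) (at_right 0)"
    using filterlim_compose[OF poly_times_exp_tendsto_0[of p] filterlim_inverse_at_top_right]
    by (simp add: inverse_eq_divide)
  moreover have "eventually (\<lambda>x. poly p (1 / x) * exp (- (1 / x)) = flat p x) (at_right (0::real))"
    unfolding eventually_at_filter by (simp add: flat_def)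
  ultimately show "(flat p \<longlongrightarrow> 0) (at_right 0)"
    by (rule Lim_transform_eventually)
qed

definition flat_deriv :: "real poly \<Rightarrow> real poly" where
  "flat_deriv p = pCons 0 (pCons 0 (p - pderiv p))"

text \<open>At \<open>0\<close> the difference quotient is itself a function of the family, with the polynomial
  multiplied by the variable, and such functions tend to \<open>0\<close>.\<close>

lemma flat_has_derivative: "(flat p has_real_derivative flat (flat_deriv p) s) (at s)"
proof (cases s "0::real" rule: linorder_cases)
  case less
  show ?thesis
  proof (rule has_field_derivative_transform_within_open[of "\<lambda>_. 0" _ _ "{..<0}"])
    show "((\<lambda>_. 0) has_real_derivative flat (flat_deriv p) s) (at s)"
      using less by (simp add: flat_def)
  qed (use less in \<open>auto simp: flat_def\<close>)
next
  case equal
  have "((\<lambda>h. (flat p (0 + h) - flat p 0) / h) \<longlongrightarrow> 0) (at 0)"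
  proof (rule Lim_transform_eventually[OF flat_tendsto_0[of "pCons 0 p"]])
    show "eventually (\<lambda>h. flat (pCons 0 p) h = (flat p (0 + h) - flat p 0) / h) (at 0)"
      unfolding eventually_at_filter by (auto simp: flat_def)
  qed
  moreover have "flat (flat_deriv p) 0 = 0"
    by (simp add: flat_def)
  ultimately show ?thesis
    using equal by (simp add: DERIV_def)
next
  case greater
  have d: "((\<lambda>x. 1 / x) has_real_derivative - (1 / s\<^sup>2)) (at s)"
    using greater by (auto intro!: derivative_eq_intros simp: power2_eq_square divide_simps)
  show ?thesis
  proof (rule has_field_derivative_transform_within_open[of "\<lambda>s. poly p (1 / s) * exp (- (1 / s))" _ _ "{0<..}"])
    have "((\<lambda>s. poly p (1 / s)) has_real_derivative poly (pderiv p) (1 / s) * - (1 / s\<^sup>2)) (at s)"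
      by (rule DERIV_chain2[OF poly_DERIV d])
    moreover have "((\<lambda>s. exp (- (1 / s))) has_real_derivative exp (- (1 / s)) * (1 / s\<^sup>2)) (at s)"
      by (rule DERIV_fun_exp[THEN DERIV_cong, OF DERIV_minus[OF d]]) simp
    ultimately have "((\<lambda>s. poly p (1 / s) * exp (- (1 / s))) has_real_derivative
      poly (pderiv p) (1 / s) * - (1 / s\<^sup>2) * exp (- (1 / s)) + exp (- (1 / s)) * (1 / s\<^sup>2) * poly p (1 / s)) (at s)"
      by (rule DERIV_mult)
    then show "((\<lambda>s. poly p (1 / s) * exp (- (1 / s))) has_real_derivative flat (flat_deriv p) s) (at s)"
      using greater by (auto elim!: DERIV_cong simp: flat_def flat_deriv_def field_simps power2_eq_square)
  qed (use greater in \<open>auto simp: flat_def\<close>)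
qed

lemma continuous_flat: "continuous_on A (flat p)"
  by (meson DERIV_isCont continuous_at_imp_continuous_on flat_has_derivative)

text \<open>Directional derivatives do not lead out of this set (\<open>bump_family_derivative\<close>); therefore its
  members are of class \<open>Ck k\<close> for all \<open>k\<close>, and no formula for higher derivatives is needed.\<close>

inductive_set bump_family :: "real \<Rightarrow> 'a::euclidean_space \<Rightarrow> ('a \<Rightarrow> real) set" for \<kappa> a where
  base: "(\<lambda>z. flat p (1 - \<kappa> * ((z - a) \<bullet> (z - a)))) \<in> bump_family \<kappa> a"
| coord: "f \<in> bump_family \<kappa> a \<Longrightarrow> (\<lambda>z. ((z - a) \<bullet> b) * f z) \<in> bump_family \<kappa> a"
| scale: "f \<in> bump_family \<kappa> a \<Longrightarrow> (\<lambda>z. c * f z) \<in> bump_family \<kappa> a"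
| add: "f \<in> bump_family \<kappa> a \<Longrightarrow> g \<in> bump_family \<kappa> a \<Longrightarrow> (\<lambda>z. f z + g z) \<in> bump_family \<kappa> a"

lemma flat_radial_has_derivative:
  "((\<lambda>z. flat p (1 - \<kappa> * ((z - a) \<bullet> (z - a)))) has_derivative
     (\<lambda>v. (- 2 * \<kappa>) * (((z - a) \<bullet> v) * flat (flat_deriv p) (1 - \<kappa> * ((z - a) \<bullet> (z - a)))))) (at z)"
proof -
  have "((\<lambda>z. 1 - \<kappa> * ((z - a) \<bullet> (z - a))) has_derivative (\<lambda>v. - 2 * \<kappa> * ((z - a) \<bullet> v))) (at z)"
    by (auto intro!: derivative_eq_intros simp: inner_commute algebra_simps)
  from has_derivative_compose[OF this flat_has_derivative[of p, unfolded has_field_derivative_def]]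
  show ?thesis
    by (simp add: algebra_simps)
qed

lemma bump_family_derivative:
  assumes "f \<in> bump_family \<kappa> a"
  shows "\<exists>D. (\<forall>z. (f has_derivative (\<lambda>v. D v z)) (at z)) \<and> (\<forall>v. D v \<in> bump_family \<kappa> a)"
  using assms
proof induction
  case (base p)
  then show ?case
    by (intro exI[of _ "\<lambda>v z. (- 2 * \<kappa>) * (((z - a) \<bullet> v) * flat (flat_deriv p) (1 - \<kappa> * ((z - a) \<bullet> (z - a))))"]
        conjI allI flat_radial_has_derivative bump_family.intros)
next
  case (coord f b)
  then obtain D where D: "\<And>z. (f has_derivative (\<lambda>v. D v z)) (at z)" "\<And>v. D v \<in> bump_family \<kappa> a"
    by blast
  have "((\<lambda>z. ((z - a) \<bullet> b) * f z) has_derivative (\<lambda>v. ((z - a) \<bullet> b) * D v z + (v \<bullet> b) * f z)) (at z)" for z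
    by (auto intro!: derivative_eq_intros D)
  then show ?case
    using coord D by (intro exI[of _ "\<lambda>v z. ((z - a) \<bullet> b) * D v z + (v \<bullet> b) * f z"]) (auto intro!: bump_family.intros)
next
  case (scale f c)
  then obtain D where D: "\<And>z. (f has_derivative (\<lambda>v. D v z)) (at z)" "\<And>v. D v \<in> bump_family \<kappa> a"
    by blast
  have "((\<lambda>z. c * f z) has_derivative (\<lambda>v. c * D v z)) (at z)" for z
    by (auto intro!: derivative_eq_intros D)
  then show ?case
    using D by (intro exI[of _ "\<lambda>v z. c * D v z"]) (auto intro!: bump_family.intros)
next
  case (add f g)
  then obtain D E where D: "\<And>z. (f has_derivative (\<lambda>v. D v z)) (at z)" "\<And>v. D v \<in> bump_family \<kappa> a"
    and E: "\<And>z. (g has_derivative (\<lambda>v. E v z)) (at z)" "\<And>v. E v \<in> bump_family \<kappa> a"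
    by blast
  have "((\<lambda>z. f z + g z) has_derivative (\<lambda>v. D v z + E v z)) (at z)" for z
    by (auto intro!: derivative_eq_intros D E)
  then show ?case
    using D E by (intro exI[of _ "\<lambda>v z. D v z + E v z"]) (auto intro!: bump_family.intros)
qed

lemma Ck_bump_family: "f \<in> bump_family \<kappa> a \<Longrightarrow> Ck k f"
proof (induction k arbitrary: f)
  case 0
  then obtain D where "\<And>z. (f has_derivative (\<lambda>v. D v z)) (at z)"
    using bump_family_derivative by blast
  then have "continuous_on UNIV f"
    by (meson continuous_at_imp_continuous_on has_derivative_continuous)
  then show ?case by simp
next
  case (Suc k)
  then obtain D where D: "\<And>z. (f has_derivative (\<lambda>v. D v z)) (at z)" "\<And>v. D v \<in> bump_family \<kappa> a"
    using bump_family_derivative by blast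
  have "dir_deriv v f = D v" for v
    using dir_deriv_eq[OF D(1)] by auto
  moreover have "f differentiable (at z)" for z
    using D(1) differentiableI by blast
  ultimately show ?case
    using D Suc.IH by simp
qed

text \<open>The parameter \<open>r\<close> is the radius of the support and \<open>a\<close> its centre. The same functions serve as
  mollifying kernels, for small \<open>r\<close>, and as cutoffs, for large \<open>r\<close>; because of the scaling
  their gradient is of order \<open>1 / r\<close>. In \<open>bump'\<close> the third argument is the direction of
  differentiation.\<close>

definition bump :: "real \<Rightarrow> 'a::euclidean_space \<Rightarrow> 'a \<Rightarrow> real" where
  "bump r a z = flat 1 (1 - 1 / r\<^sup>2 * ((z - a) \<bullet> (z - a)))"

definition bump' :: "real \<Rightarrow> 'a::euclidean_space \<Rightarrow> 'a \<Rightarrow> 'a \<Rightarrow> real" where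
  "bump' r a v z =
     (- 2 * (1 / r\<^sup>2)) * (((z - a) \<bullet> v) * flat (flat_deriv 1) (1 - 1 / r\<^sup>2 * ((z - a) \<bullet> (z - a))))"

lemma Ck_bump: "Ck k (bump r a)"
  using Ck_bump_family[OF bump_family.base] by (simp only: bump_def[abs_def])

lemma bump_has_derivative: "(bump r a has_derivative (\<lambda>v. bump' r a v z)) (at z)"
  unfolding bump_def[abs_def] bump'_def by (rule flat_radial_has_derivative)

lemma continuous_bump: "continuous_on UNIV (bump r a)"
  by (meson bump_has_derivative continuous_at_imp_continuous_on has_derivative_continuous)

lemma continuous_bump': "continuous_on UNIV (bump' r a v)"
  unfolding bump'_def[abs_def] by (intro continuous_intros continuous_on_compose2[OF continuous_flat]) auto

lemma bump_measurable [measurable]: "bump r a \<in> borel_measurable borel"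
  by (intro borel_measurable_continuous_onI continuous_bump)

lemma bump'_measurable [measurable]: "bump' r a v \<in> borel_measurable borel"
  by (intro borel_measurable_continuous_onI continuous_bump')

lemma bump_nonneg: "0 \<le> bump r a z" and bump_le_1: "bump r a z \<le> 1"
  by (auto simp: bump_def flat_def)

lemma bump_ge_on_half_ball:
  assumes "r > 0" "norm (z - a) \<le> r / 2"
  shows "exp (- (4 / 3)) \<le> bump r a z"
proof -
  have "(norm (z - a))\<^sup>2 \<le> (r / 2)\<^sup>2"
    using assms by (intro power_mono) auto
  then have s: "3 / 4 \<le> 1 - 1 / r\<^sup>2 * ((z - a) \<bullet> (z - a))"
    using assms(1) by (simp add: power2_norm_eq_inner field_simps)
  \<comment> \<open>the constant is the value of the profile at \<open>3 / 4 = 1 - (1 / 2)\<^sup>2\<close>\<close>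
  have "inverse (1 - 1 / r\<^sup>2 * ((z - a) \<bullet> (z - a))) \<le> inverse (3 / 4)"
    using s by (rule le_imp_inverse_le) simp
  then have "exp (- (4 / 3)) \<le> exp (- (1 / (1 - 1 / r\<^sup>2 * ((z - a) \<bullet> (z - a)))))"
    by (simp add: inverse_eq_divide)
  moreover have "0 < 1 - 1 / r\<^sup>2 * ((z - a) \<bullet> (z - a))"
    using s by linarith
  ultimately show ?thesis
    by (simp add: bump_def flat_def)
qed

lemma bump_outside:
  assumes "r > 0" "norm (z - a) \<ge> r"
  shows "bump r a z = 0" "bump' r a v z = 0"
proof -
  have "r\<^sup>2 \<le> (norm (z - a))\<^sup>2"
    using assms by (intro power_mono) auto
  then have "1 \<le> 1 / r\<^sup>2 * ((z - a) \<bullet> (z - a))"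
    using assms(1) by (simp add: power2_norm_eq_inner field_simps)
  then show "bump r a z = 0" "bump' r a v z = 0"
    by (auto simp: bump_def bump'_def flat_def)
qed

lemma bump'_bounded:
  fixes a :: "'a::euclidean_space"
  shows "\<exists>L\<ge>0. \<forall>R>0. \<forall>a z v. \<bar>bump' R (a::'a) v z\<bar> \<le> L / R * norm v"
proof -
  have "bounded (flat (flat_deriv 1) ` {0..1})"
    by (intro compact_imp_bounded compact_continuous_image continuous_flat) auto
  then obtain M where M: "\<And>s. s \<in> {0..1} \<Longrightarrow> \<bar>flat (flat_deriv 1) s\<bar> \<le> M"
    unfolding bounded_iff by (metis imageI real_norm_def)
  have M0: "M \<ge> 0"
    using M[of 0] by simp
  have "\<bar>bump' R a v z\<bar> \<le> 2 * M / R * norm v" if "R > 0" for R and a z v :: 'a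
  proof (cases "norm (z - a) \<ge> R")
    case True
    then show ?thesis
      using bump_outside(2)[OF that True] that M0 by simp
  next
    case False
    then have "(norm (z - a))\<^sup>2 \<le> R\<^sup>2"
      by (intro power_mono) auto
    then have *: "1 - 1 / R\<^sup>2 * ((z - a) \<bullet> (z - a)) \<in> {0..1}"
      using that by (simp add: power2_norm_eq_inner field_simps)
    have "\<bar>bump' R a v z\<bar> = 2 / R\<^sup>2 * (\<bar>(z - a) \<bullet> v\<bar> * \<bar>flat (flat_deriv 1) (1 - 1 / R\<^sup>2 * ((z - a) \<bullet> (z - a)))\<bar>)"
      by (simp add: bump'_def abs_mult)
    also have "\<dots> \<le> 2 / R\<^sup>2 * ((R * norm v) * M)"
    proof (intro mult_left_mono mult_mono M *)
      have "\<bar>(z - a) \<bullet> v\<bar> \<le> norm (z - a) * norm v"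
        by (rule Cauchy_Schwarz_ineq2)
      also have "\<dots> \<le> R * norm v"
        using False by (intro mult_right_mono) auto
      finally show "\<bar>(z - a) \<bullet> v\<bar> \<le> R * norm v" .
    qed (use that in auto)
    also have "\<dots> = 2 * M / R * norm v"
      using that by (simp add: power2_eq_square field_simps)
    finally show ?thesis .
  qed
  then show ?thesis
    using M0 by (intro exI[of _ "2 * M"]) auto
qed

lemma bump_lipschitz:
  assumes "\<And>z v. \<bar>bump' r a v z\<bar> \<le> L * norm v"
  shows "\<bar>bump r a y - bump r a x\<bar> \<le> L * norm (y - x)"
proof -
  have "norm (bump r a y - bump r a x) \<le> L * norm (y - x)"
  proof (rule differentiable_bound[of UNIV])
    show "(bump r a has_derivative (\<lambda>v. bump' r a v z)) (at z within UNIV)" for z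
      using bump_has_derivative[of r a z] by simp
    show "onorm (\<lambda>v. bump' r a v z) \<le> L" for z
      using assms by (intro onorm_bound) (auto simp: onorm_bound intro!: assms order_trans[OF abs_ge_zero, of "bump' r a (SOME b. b \<in> Basis) z"] order_trans[OF assms])
  qed auto
  then show ?thesis by simp
qed

section \<open>The square integral and its behaviour under translation\<close>

text \<open>The square root is omitted and the value may be infinite, so that no integrability has to be
  checked. Since only boundedness and smallness matter below, the inequality
  \<open>|a + b|\<^sup>2 \<le> 2 |a|\<^sup>2 + 2 |b|\<^sup>2\<close> replaces the triangle inequality.\<close>

definition sq_norm :: "'a measure \<Rightarrow> ('a \<Rightarrow> 'b::real_normed_vector) \<Rightarrow> ennreal" where
  "sq_norm M f = (\<integral>\<^sup>+x. ennreal ((norm (f x))\<^sup>2) \<partial>M)"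

lemma norm_add_sq_le:
  fixes a b :: "'b::real_normed_vector"
  shows "(norm (a + b))\<^sup>2 \<le> 2 * (norm a)\<^sup>2 + 2 * (norm b)\<^sup>2"
proof -
  have "(norm (a + b))\<^sup>2 \<le> (norm a + norm b)\<^sup>2"
    by (intro power_mono norm_triangle_ineq) auto
  also have "\<dots> \<le> 2 * (norm a)\<^sup>2 + 2 * (norm b)\<^sup>2"
    using sum_squares_bound[of "norm a" "norm b"] by (simp add: power2_sum)
  finally show ?thesis .
qed

lemma sq_norm_add:
  fixes f g :: "'a \<Rightarrow> 'b::{real_normed_vector, second_countable_topology}"
  assumes [measurable]: "f \<in> borel_measurable M" "g \<in> borel_measurable M"
  shows "sq_norm M (\<lambda>x. f x + g x) \<le> 2 * sq_norm M f + 2 * sq_norm M g"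
proof -
  have "sq_norm M (\<lambda>x. f x + g x) \<le> (\<integral>\<^sup>+x. 2 * ennreal ((norm (f x))\<^sup>2) + 2 * ennreal ((norm (g x))\<^sup>2) \<partial>M)"
    unfolding sq_norm_def
  proof (intro nn_integral_mono)
    fix x
    have "ennreal ((norm (f x + g x))\<^sup>2) \<le> ennreal (2 * (norm (f x))\<^sup>2 + 2 * (norm (g x))\<^sup>2)"
      using norm_add_sq_le by (intro ennreal_leI)
    then show "ennreal ((norm (f x + g x))\<^sup>2) \<le> 2 * ennreal ((norm (f x))\<^sup>2) + 2 * ennreal ((norm (g x))\<^sup>2)"
      by (simp add: ennreal_mult)
  qed
  also have "\<dots> = 2 * sq_norm M f + 2 * sq_norm M g"
    unfolding sq_norm_def by (simp add: nn_integral_add nn_integral_cmult)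
  finally show ?thesis .
qed

lemma sq_norm_diff_commute: "sq_norm M (\<lambda>x. f x - g x) = sq_norm M (\<lambda>x. g x - f x)"
  by (simp add: sq_norm_def norm_minus_commute)

lemma sq_norm_diff_triangle:
  fixes f g h :: "'a \<Rightarrow> 'b::{real_normed_vector, second_countable_topology}"
  assumes [measurable]: "f \<in> borel_measurable M" "g \<in> borel_measurable M" "h \<in> borel_measurable M"
  shows "sq_norm M (\<lambda>x. f x - h x) \<le> 2 * sq_norm M (\<lambda>x. f x - g x) + 2 * sq_norm M (\<lambda>x. g x - h x)"
  using sq_norm_add[of "\<lambda>x. f x - g x" M "\<lambda>x. g x - h x"] by simp

lemma nn_integral_lborel_translate:
  fixes t :: "'a::euclidean_space"
  assumes [measurable]: "f \<in> borel_measurable borel"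
  shows "(\<integral>\<^sup>+x. f (x + t) \<partial>lborel) = (\<integral>\<^sup>+x. f x \<partial>lborel)"
proof -
  have "(\<integral>\<^sup>+x. f x \<partial>lborel) = (\<integral>\<^sup>+x. f x \<partial>distr lborel borel ((+) t))"
    by (simp add: lborel_distr_plus)
  also have "\<dots> = (\<integral>\<^sup>+x. f (x + t) \<partial>lborel)"
    by (subst nn_integral_distr) (auto simp: add.commute)
  finally show ?thesis ..
qed

lemma sq_norm_translate:
  fixes t :: "'a::euclidean_space"
  assumes [measurable]: "f \<in> borel_measurable borel"
  shows "sq_norm lborel (\<lambda>x. f (x + t)) = sq_norm lborel f"
  unfolding sq_norm_def by (rule nn_integral_lborel_translate) measurable

lemma integral_lborel_translate:
  fixes t :: "'a::euclidean_space" and f :: "'a \<Rightarrow> 'b::{banach, second_countable_topology}"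
  assumes [measurable]: "f \<in> borel_measurable borel"
  shows "(LINT x|lborel. f (x + t)) = (LINT x|lborel. f x)"
proof -
  have "(LINT x|lborel. f x) = (LINT x|distr lborel borel ((+) t). f x)"
    by (simp add: lborel_distr_plus)
  also have "\<dots> = (LINT x|lborel. f (x + t))"
    by (subst integral_distr) (auto simp: add.commute)
  finally show ?thesis ..
qed

lemma integrable_lborel_translate:
  fixes t :: "'a::euclidean_space" and f :: "'a \<Rightarrow> 'b::{banach, second_countable_topology}"
  assumes f: "integrable lborel f"
  shows "integrable lborel (\<lambda>x. f (x + t))"
proof -
  have [measurable]: "f \<in> borel_measurable borel"
    using f by (auto dest: borel_measurable_integrable)
  have "integrable (distr lborel borel ((+) t)) f"
    using f by (simp add: lborel_distr_plus)
  then show ?thesis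
    by (subst (asm) integrable_distr_eq) (auto simp: add.commute)
qed

text \<open>By translation invariance the positive and the negative part of the difference have the same
  integral, and the part \<open>x \<in> U\<close>, \<open>x + t \<notin> U\<close> is dominated by \<open>U\<close> and disappears pointwise as
  \<open>t\<close> tends to \<open>0\<close> because \<open>U\<close> is open.\<close>

lemma L1_translation_open:
  fixes U :: "'a::euclidean_space set"
  assumes "open U" and fin: "emeasure lborel U < \<infinity>"
  shows "((\<lambda>t. \<integral>\<^sup>+x. ennreal \<bar>indicator U (x + t) - indicator U x\<bar> \<partial>lborel) \<longlongrightarrow> 0) (at 0)"
  unfolding tendsto_at_iff_sequentially comp_def
proof (intro allI impI)
  fix X :: "nat \<Rightarrow> 'a" assume X: "X \<longlonglongrightarrow> 0"
  have [measurable]: "U \<in> sets borel"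
    using assms by auto
  have eq: "(\<integral>\<^sup>+x. ennreal \<bar>indicator U (x + t) - indicator U x\<bar> \<partial>lborel)
      = 2 * (\<integral>\<^sup>+x. ennreal (indicator U x - indicator U (x + t)) \<partial>lborel)" for t
  proof -
    define p q where "p = (\<integral>\<^sup>+x. ennreal (indicator U x - indicator U (x + t)) \<partial>lborel)"
      and "q = (\<integral>\<^sup>+x. ennreal (indicator U (x + t) - indicator U x) \<partial>lborel)"
    have "emeasure lborel U + q = (\<integral>\<^sup>+x. indicator U x + ennreal (indicator U (x + t) - indicator U x) \<partial>lborel)"
      unfolding q_def by (subst nn_integral_add) auto
    also have "\<dots> = (\<integral>\<^sup>+x. indicator U (x + t) + ennreal (indicator U x - indicator U (x + t)) \<partial>lborel)"
      by (intro nn_integral_cong) (auto simp: indicator_def ennreal_neg)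
    also have "\<dots> = emeasure lborel U + p"
      unfolding p_def
      by (subst nn_integral_add) (auto simp: nn_integral_lborel_translate[of "indicator U"])
    finally have "q = p"
      using fin by (auto simp: ennreal_add_left_cancel)
    moreover have "(\<integral>\<^sup>+x. ennreal \<bar>indicator U (x + t) - indicator U x\<bar> \<partial>lborel) = p + q"
      unfolding p_def q_def
      by (subst nn_integral_add[symmetric]) (auto intro!: nn_integral_cong simp: indicator_def ennreal_neg)
    ultimately show ?thesis
      by (simp add: p_def mult_2)
  qed
  have "(\<lambda>n. \<integral>\<^sup>+x. ennreal (indicator U x - indicator U (x + X n)) \<partial>lborel) \<longlonglongrightarrow> (\<integral>\<^sup>+(x::'a). 0 \<partial>lborel)"
  proof (rule nn_integral_dominated_convergence[where w="indicator U"])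
    show "AE x in lborel. ennreal (indicator U x - indicator U (x + X j)) \<le> indicator U x" for j
      by (auto simp: indicator_def ennreal_neg)
    show "AE x in lborel. (\<lambda>i. ennreal (indicator U x - indicator U (x + X i))) \<longlonglongrightarrow> 0"
    proof (intro AE_I2 tendsto_eventually)
      fix x
      have "(\<lambda>n. x + X n) \<longlonglongrightarrow> x + 0"
        using X by (intro tendsto_intros)
      then have "\<forall>\<^sub>F n in sequentially. x + X n \<in> U" if "x \<in> U"
        using \<open>open U\<close> that by (intro topological_tendstoD) auto
      then have "\<forall>\<^sub>F n in sequentially. x \<in> U \<longrightarrow> x + X n \<in> U"
        by (cases "x \<in> U") simp_all
      then show "\<forall>\<^sub>F n in sequentially. ennreal (indicator U x - indicator U (x + X n)) = 0"
        by eventually_elim (auto simp: indicator_def ennreal_neg)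
    qed
  qed (use fin in auto)
  then show "(\<lambda>n. \<integral>\<^sup>+x. ennreal \<bar>indicator U (x + X n) - indicator U x\<bar> \<partial>lborel) \<longlonglongrightarrow> 0"
    unfolding eq using ennreal_tendsto_cmult[of 2 _ 0] by simp
qed

lemma ennreal_tendsto_0_iff:
  "(f \<longlongrightarrow> (0::ennreal)) F \<longleftrightarrow> (\<forall>e>0. \<forall>\<^sub>F x in F. f x \<le> ennreal e)"
proof safe
  fix e :: real assume "(f \<longlongrightarrow> 0) F" "e > 0"
  then have "\<forall>\<^sub>F x in F. f x < ennreal e"
    by (intro order_tendstoD) auto
  then show "\<forall>\<^sub>F x in F. f x \<le> ennreal e"
    by eventually_elim simp
next
  assume *: "\<forall>e>0. \<forall>\<^sub>F x in F. f x \<le> ennreal e"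
  show "(f \<longlongrightarrow> 0) F"
  proof (rule order_tendstoI)
    fix a :: ennreal assume "0 < a"
    then obtain b :: real where b: "b > 0" "ennreal b < a"
      by (metis dense ennreal_cases ennreal_less_zero_iff order_less_trans top.not_eq_extremum ennreal_less_top not_less_iff_gr_or_eq)
    then show "\<forall>\<^sub>F x in F. f x < a"
      using *[rule_format, OF b(1)] by (auto elim: eventually_mono)
  qed simp
qed

text \<open>By density it suffices to treat indicator functions of sets of finite measure, and by outer
  regularity those of open sets.\<close>

lemma L1_translation_continuous:
  fixes f :: "'a::euclidean_space \<Rightarrow> 'b::{banach, second_countable_topology}"
  assumes "integrable lborel f"
  shows "((\<lambda>t. \<integral>\<^sup>+x. ennreal (norm (f (x + t) - f x)) \<partial>lborel) \<longlongrightarrow> 0) (at 0)"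
  using assms
proof (induction rule: integrable_induct)
  case (base A c)
  then have [measurable]: "A \<in> sets borel" and A: "emeasure lborel A < \<infinity>"
    by auto
  have "((\<lambda>t. \<integral>\<^sup>+x. ennreal \<bar>indicator A (x + t) - indicator A x\<bar> \<partial>lborel) \<longlongrightarrow> 0) (at 0)"
    unfolding ennreal_tendsto_0_iff
  proof (intro allI impI)
    fix e :: real assume "e > 0"
    then obtain U where U: "open U" "A \<subseteq> U" "emeasure lborel (U - A) < ennreal (e / 3)"
      using outer_regular_lborel[of A "e / 3"] by auto
    then have [measurable]: "U \<in> sets borel"
      by auto
    have "emeasure lborel U \<le> emeasure lborel A + emeasure lborel (U - A)"
      using U by (subst plus_emeasure) (auto simp: Un_absorb1)
    also have "\<dots> < \<infinity>"
      using A U(3) by (simp add: order_less_trans less_top)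
    finally have "emeasure lborel U < \<infinity>" .
    then have "\<forall>\<^sub>F t in at 0. (\<integral>\<^sup>+x. ennreal \<bar>indicator U (x + t) - indicator U x\<bar> \<partial>lborel) \<le> ennreal (e / 3)"
      using L1_translation_open[OF U(1)] \<open>e > 0\<close> unfolding ennreal_tendsto_0_iff by auto
    then show "\<forall>\<^sub>F t in at 0. (\<integral>\<^sup>+x. ennreal \<bar>indicator A (x + t) - indicator A x\<bar> \<partial>lborel) \<le> ennreal e"
    proof eventually_elim
      case (elim t)
      have "(\<integral>\<^sup>+x. ennreal \<bar>indicator A (x + t) - indicator A x\<bar> \<partial>lborel)
          \<le> (\<integral>\<^sup>+x. ennreal \<bar>indicator U (x + t) - indicator U x\<bar> + (indicator (U - A) (x + t) + indicator (U - A) x) \<partial>lborel)"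
        using U(2) by (intro nn_integral_mono) (auto simp: indicator_def)
      also have "\<dots> = (\<integral>\<^sup>+x. ennreal \<bar>indicator U (x + t) - indicator U x\<bar> \<partial>lborel)
          + (emeasure lborel (U - A) + emeasure lborel (U - A))"
        by (subst nn_integral_add; simp?)+ (simp add: nn_integral_lborel_translate[of "indicator (U - A)"])
      also have "\<dots> \<le> ennreal (e / 3) + (ennreal (e / 3) + ennreal (e / 3))"
        using elim U(3) by (intro add_mono) auto
      also have "\<dots> = ennreal e"
        using \<open>e > 0\<close> by (simp flip: ennreal_plus)
      finally show ?case .
    qed
  qed
  from ennreal_tendsto_cmult[OF _ this, of "ennreal (norm c)"]
  have "((\<lambda>t. ennreal (norm c) * (\<integral>\<^sup>+x. ennreal \<bar>indicator A (x + t) - indicator A x\<bar> \<partial>lborel)) \<longlongrightarrow> 0) (at 0)"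
    by simp
  moreover have "ennreal (norm c) * (\<integral>\<^sup>+x. ennreal \<bar>indicator A (x + t) - indicator A x\<bar> \<partial>lborel)
      = (\<integral>\<^sup>+x. ennreal (norm (indicator A (x + t) *\<^sub>R c - indicator A x *\<^sub>R c)) \<partial>lborel)" for t
    by (subst nn_integral_cmult[symmetric])
       (auto intro!: nn_integral_cong simp: ennreal_mult'[symmetric] scaleR_diff_left[symmetric] mult.commute simp del: scaleR_left_diff_distrib)
  ultimately show ?case
    by simp
next
  case (add f g)
  have [measurable]: "f \<in> borel_measurable borel" "g \<in> borel_measurable borel"
    using add(1,2) by (auto dest: borel_measurable_integrable)
  have sum: "((\<lambda>t. (\<integral>\<^sup>+x. ennreal (norm (f (x + t) - f x)) \<partial>lborel) + (\<integral>\<^sup>+x. ennreal (norm (g (x + t) - g x)) \<partial>lborel)) \<longlongrightarrow> 0) (at 0)"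
    using tendsto_add[OF add(3,4)] by simp
  show ?case
  proof (rule tendsto_sandwich[OF _ _ tendsto_const sum])
    show "\<forall>\<^sub>F t in at 0. (\<integral>\<^sup>+x. ennreal (norm (f (x + t) + g (x + t) - (f x + g x))) \<partial>lborel)
       \<le> (\<integral>\<^sup>+x. ennreal (norm (f (x + t) - f x)) \<partial>lborel) + (\<integral>\<^sup>+x. ennreal (norm (g (x + t) - g x)) \<partial>lborel)"
    proof (intro always_eventually allI)
      fix t
      have "(\<integral>\<^sup>+x. ennreal (norm (f (x + t) + g (x + t) - (f x + g x))) \<partial>lborel)
        \<le> (\<integral>\<^sup>+x. ennreal (norm (f (x + t) - f x)) + ennreal (norm (g (x + t) - g x)) \<partial>lborel)"
        by (intro nn_integral_mono) (auto simp flip: ennreal_plus intro!: ennreal_leI norm_diff_triangle_ineq)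
      also have "\<dots> = (\<integral>\<^sup>+x. ennreal (norm (f (x + t) - f x)) \<partial>lborel) + (\<integral>\<^sup>+x. ennreal (norm (g (x + t) - g x)) \<partial>lborel)"
        by (rule nn_integral_add) auto
      finally show "(\<integral>\<^sup>+x. ennreal (norm (f (x + t) + g (x + t) - (f x + g x))) \<partial>lborel)
       \<le> (\<integral>\<^sup>+x. ennreal (norm (f (x + t) - f x)) \<partial>lborel) + (\<integral>\<^sup>+x. ennreal (norm (g (x + t) - g x)) \<partial>lborel)" .
    qed
  qed auto
next
  case (lim f s)
  have [measurable]: "f \<in> borel_measurable borel" "\<And>i. s i \<in> borel_measurable borel"
    using lim.hyps(1,4)[THEN borel_measurable_integrable] by simp_all
  have conv: "(\<lambda>i. \<integral>\<^sup>+x. ennreal (norm (f x - s i x)) \<partial>lborel) \<longlonglongrightarrow> 0"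
  proof (rule nn_integral_dominated_convergence_norm[where w="\<lambda>x. 2 * norm (f x)"])
    show "(\<integral>\<^sup>+x. ennreal (2 * norm (f x)) \<partial>lborel) < \<infinity>"
      using lim.hyps(4) by (simp add: integrable_iff_bounded ennreal_mult nn_integral_cmult ennreal_mult_less_top)
    show "AE x in lborel. norm (s i x) \<le> 2 * norm (f x)" for i
      using lim.hyps(3) by (intro AE_I2) simp
    show "AE x in lborel. (\<lambda>i. s i x) \<longlonglongrightarrow> f x"
      using lim.hyps(2) by (intro AE_I2) simp
  qed measurable
  show ?case
    unfolding ennreal_tendsto_0_iff
  proof (intro allI impI)
    fix e :: real assume "e > 0"
    then obtain i where i: "(\<integral>\<^sup>+x. ennreal (norm (f x - s i x)) \<partial>lborel) \<le> ennreal (e / 3)"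
      using conv unfolding ennreal_tendsto_0_iff eventually_sequentially by (meson divide_pos_pos order_refl zero_less_numeral)
    have "\<forall>\<^sub>F t in at 0. (\<integral>\<^sup>+x. ennreal (norm (s i (x + t) - s i x)) \<partial>lborel) \<le> ennreal (e / 3)"
      using lim.IH[of i, unfolded ennreal_tendsto_0_iff, rule_format, of "e / 3"] \<open>e > 0\<close> by simp
    then show "\<forall>\<^sub>F t in at 0. (\<integral>\<^sup>+x. ennreal (norm (f (x + t) - f x)) \<partial>lborel) \<le> ennreal e"
    proof eventually_elim
      case (elim t)
      have "(\<integral>\<^sup>+x. ennreal (norm (f (x + t) - f x)) \<partial>lborel)
        \<le> (\<integral>\<^sup>+x. ennreal (norm (s i (x + t) - s i x)) + (ennreal (norm (f (x + t) - s i (x + t))) + ennreal (norm (f x - s i x))) \<partial>lborel)"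
      proof (intro nn_integral_mono)
        fix x
        have "norm (f (x + t) - f x) \<le> norm (s i (x + t) - s i x) + (norm (f (x + t) - s i (x + t)) + norm (f x - s i x))"
          using norm_triangle_ineq[of "s i (x + t) - s i x" "(f (x + t) - s i (x + t)) - (f x - s i x)"]
            norm_triangle_ineq4[of "f (x + t) - s i (x + t)" "f x - s i x"]
          by (simp add: algebra_simps)
        then show "ennreal (norm (f (x + t) - f x)) \<le> ennreal (norm (s i (x + t) - s i x)) + (ennreal (norm (f (x + t) - s i (x + t))) + ennreal (norm (f x - s i x)))"
          by (simp flip: ennreal_plus add: ennreal_leI)
      qed
      also have "\<dots> = (\<integral>\<^sup>+x. ennreal (norm (s i (x + t) - s i x)) \<partial>lborel)
          + ((\<integral>\<^sup>+x. ennreal (norm (f x - s i x)) \<partial>lborel) + (\<integral>\<^sup>+x. ennreal (norm (f x - s i x)) \<partial>lborel))"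
        by (subst nn_integral_add; simp?)+ (simp add: nn_integral_lborel_translate[of "\<lambda>x. ennreal (norm (f x - s i x))"])
      also have "\<dots> \<le> ennreal (e / 3) + (ennreal (e / 3) + ennreal (e / 3))"
        using elim i by (intro add_mono) auto
      also have "\<dots> = ennreal e"
        using \<open>e > 0\<close> by (simp flip: ennreal_plus)
      finally show ?case .
    qed
  qed
qed

text \<open>The map \<open>a \<mapsto> |a| a\<close> is monotone in the strong sense that its increment from \<open>b\<close> to \<open>a\<close> has inner
  product at least \<open>|a - b|\<^sup>3 / 2\<close> with \<open>a - b\<close>. The inequality deduces continuity of translations
  in \<open>L\<^sup>2\<close> from that in \<open>L\<^sup>1\<close>, as \<open>|f| f\<close> is integrable when \<open>f\<close> is square integrable.\<close>

lemma norm_diff_sq_le_signed_square: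
  fixes a b :: "'b::real_inner"
  shows "(norm (a - b))\<^sup>2 \<le> 2 * norm (norm a *\<^sub>R a - norm b *\<^sub>R b)"
proof (cases "a = b")
  case False
  define p q where "p = norm a" and "q = norm b"
  have pq: "p \<ge> 0" "q \<ge> 0"
    by (auto simp: p_def q_def)
  have n2: "(norm (a - b))\<^sup>2 = p\<^sup>2 + q\<^sup>2 - 2 * (a \<bullet> b)"
    by (simp add: p_def q_def power2_norm_eq_inner inner_diff_left inner_diff_right inner_commute)
  have "(norm a *\<^sub>R a - norm b *\<^sub>R b) \<bullet> (a - b) = p * (p\<^sup>2 - a \<bullet> b) + q * (q\<^sup>2 - a \<bullet> b)"
    by (simp add: p_def q_def power2_norm_eq_inner inner_diff_left inner_diff_right inner_commute algebra_simps)
  also have "\<dots> = (p + q) / 2 * (norm (a - b))\<^sup>2 + (p - q)\<^sup>2 * (p + q) / 2"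
    unfolding n2 by (simp add: field_simps power2_eq_square)
  also have "\<dots> \<ge> norm (a - b) / 2 * (norm (a - b))\<^sup>2"
  proof -
    have "norm (a - b) \<le> p + q"
      unfolding p_def q_def by (rule norm_triangle_ineq4)
    then have "norm (a - b) / 2 * (norm (a - b))\<^sup>2 \<le> (p + q) / 2 * (norm (a - b))\<^sup>2"
      by (intro mult_right_mono) auto
    moreover have "0 \<le> (p - q)\<^sup>2 * (p + q) / 2"
      using pq by auto
    ultimately show ?thesis by linarith
  qed
  finally have "norm (a - b) / 2 * (norm (a - b))\<^sup>2 \<le> (norm a *\<^sub>R a - norm b *\<^sub>R b) \<bullet> (a - b)" .
  also have "\<dots> \<le> norm (norm a *\<^sub>R a - norm b *\<^sub>R b) * norm (a - b)"
    by (rule norm_cauchy_schwarz)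
  finally have "(norm (a - b))\<^sup>2 / 2 * norm (a - b) \<le> norm (norm a *\<^sub>R a - norm b *\<^sub>R b) * norm (a - b)"
    by (simp add: algebra_simps)
  then have "(norm (a - b))\<^sup>2 / 2 \<le> norm (norm a *\<^sub>R a - norm b *\<^sub>R b)"
    using False by (subst (asm) mult_le_cancel_right) auto
  then show ?thesis by simp
qed simp

lemma L2_translation_continuous:
  fixes f :: "'a::euclidean_space \<Rightarrow> 'b::euclidean_space"
  assumes [measurable]: "f \<in> borel_measurable borel" and fin: "sq_norm lborel f < \<infinity>"
  shows "((\<lambda>t. sq_norm lborel (\<lambda>x. f (x + t) - f x)) \<longlongrightarrow> 0) (at 0)"
proof -
  define s where "s x = norm (f x) *\<^sub>R f x" for x
  have [measurable]: "s \<in> borel_measurable borel"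
    unfolding s_def[abs_def] by measurable
  have "integrable lborel s"
    using fin by (auto simp: integrable_iff_bounded sq_norm_def s_def power2_eq_square)
  from ennreal_tendsto_cmult[OF _ L1_translation_continuous[OF this], of 2]
  have *: "((\<lambda>t. 2 * (\<integral>\<^sup>+x. ennreal (norm (s (x + t) - s x)) \<partial>lborel)) \<longlongrightarrow> 0) (at 0)"
    by simp
  show ?thesis
  proof (rule tendsto_sandwich[OF _ _ tendsto_const *])
    show "\<forall>\<^sub>F t in at 0. sq_norm lborel (\<lambda>x. f (x + t) - f x) \<le> 2 * (\<integral>\<^sup>+x. ennreal (norm (s (x + t) - s x)) \<partial>lborel)"
    proof (intro always_eventually allI)
      fix t
      have "sq_norm lborel (\<lambda>x. f (x + t) - f x) \<le> (\<integral>\<^sup>+x. 2 * ennreal (norm (s (x + t) - s x)) \<partial>lborel)"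
        unfolding sq_norm_def
      proof (intro nn_integral_mono)
        fix x
        have "ennreal ((norm (f (x + t) - f x))\<^sup>2) \<le> ennreal (2 * norm (s (x + t) - s x))"
          unfolding s_def by (intro ennreal_leI norm_diff_sq_le_signed_square)
        then show "ennreal ((norm (f (x + t) - f x))\<^sup>2) \<le> 2 * ennreal (norm (s (x + t) - s x))"
          by (simp add: ennreal_mult)
      qed
      also have "\<dots> = 2 * (\<integral>\<^sup>+x. ennreal (norm (s (x + t) - s x)) \<partial>lborel)"
        by (rule nn_integral_cmult) measurable
      finally show "sq_norm lborel (\<lambda>x. f (x + t) - f x) \<le> 2 * (\<integral>\<^sup>+x. ennreal (norm (s (x + t) - s x)) \<partial>lborel)" .
    qed
  qed auto
qed

section \<open>Mollification\<close>

text \<open>The mass depends on the space, which the type argument determines.\<close>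

definition bump_mass :: "'a::euclidean_space itself \<Rightarrow> real \<Rightarrow> real" where
  "bump_mass _ r = (LINT t|lborel. bump r (0::'a) t)"

definition kern :: "real \<Rightarrow> 'a::euclidean_space \<Rightarrow> real" where
  "kern r t = bump r 0 t / bump_mass TYPE('a) r"

text \<open>The kernel is even, so this is the convolution of \<open>v\<close> with \<open>kern r\<close>.\<close>

definition moll :: "real \<Rightarrow> ('a::euclidean_space \<Rightarrow> 'b::euclidean_space) \<Rightarrow> 'a \<Rightarrow> 'b" where
  "moll r v x = (LINT t|lborel. kern r t *\<^sub>R v (x + t))"

lemma continuous_bounded_on_cball:
  fixes f :: "'a::euclidean_space \<Rightarrow> real"
  assumes "continuous_on UNIV f"
  obtains K where "K > 0" "\<And>x. norm x \<le> r \<Longrightarrow> \<bar>f x\<bar> \<le> K"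
proof -
  have "continuous_on (cball 0 r) f"
    using assms by (rule continuous_on_subset) simp
  then have "bounded (f ` cball 0 r)"
    by (intro compact_imp_bounded compact_continuous_image compact_cball)
  then obtain K where "K > 0" "\<forall>y\<in>f ` cball 0 r. norm y \<le> K"
    unfolding bounded_pos by blast
  then show thesis
    by (intro that[of K]) auto
qed

lemma integrable_compact_support:
  fixes f :: "'a::euclidean_space \<Rightarrow> 'b::euclidean_space"
  assumes "continuous_on UNIV f" "\<And>z. norm z \<ge> r \<Longrightarrow> f z = 0"
  shows "integrable lborel f"
proof -
  have "integrable lborel (\<lambda>z. indicator (cball 0 r) z *\<^sub>R f z)"
    using assms(1) by (intro borel_integrable_compact) (auto intro: continuous_on_subset)
  moreover have "(\<lambda>z. indicator (cball 0 r) z *\<^sub>R f z) = f"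
    using assms(2) by (auto simp: indicator_def fun_eq_iff)
  ultimately show ?thesis
    by simp
qed

lemma integrable_bump: "r > 0 \<Longrightarrow> integrable lborel (bump r (0::'a::euclidean_space))"
  by (rule integrable_compact_support[OF continuous_bump, of r]) (auto simp: bump_outside(1))

lemma bump_mass_pos:
  assumes "r > 0"
  shows "bump_mass TYPE('a::euclidean_space) r > 0"
proof -
  have "bump_mass TYPE('a) r \<noteq> 0"
  proof
    assume "bump_mass TYPE('a) r = 0"
    then have "AE t in lborel. bump r (0::'a) t = 0"
      unfolding bump_mass_def
      using integral_nonneg_eq_0_iff_AE[OF integrable_bump[OF assms]] bump_nonneg by blast
    then have "AE t in lborel. (t::'a) \<notin> ball 0 (r / 2)"
    proof eventually_elim
      case (elim t)
      show ?case
        using bump_ge_on_half_ball[OF assms, of t 0] elim exp_gt_zero[of "- (4 / 3)"] by auto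
    qed
    then have "ball (0::'a) (r / 2) \<in> null_sets lborel"
      by (subst AE_iff_null_sets) auto
    then have "negligible (ball (0::'a) (r / 2))"
      by (metis completion.complete2 null_sets_completionI negligible_iff_null_sets)
    then show False
      using assms open_not_negligible[of "ball (0::'a) (r / 2)"] by auto
  qed
  moreover have "bump_mass TYPE('a) r \<ge> 0"
    unfolding bump_mass_def by (intro Bochner_Integration.integral_nonneg bump_nonneg)
  ultimately show ?thesis
    by linarith
qed

lemma kern_measurable [measurable]: "kern r \<in> borel_measurable borel"
  unfolding kern_def[abs_def] by measurable

context
  fixes r :: real
  assumes r: "r > 0"
begin

lemma kern_nonneg: "0 \<le> kern r t"
  using bump_mass_pos[OF r] bump_nonneg by (auto simp: kern_def intro!: divide_nonneg_pos)

lemma kern_le: "kern r (t::'a::euclidean_space) \<le> 1 / bump_mass TYPE('a) r"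
  using bump_mass_pos[OF r, where 'a='a] by (simp add: kern_def divide_right_mono bump_le_1 less_imp_le)

lemma kern_zero_outside: "norm t \<ge> r \<Longrightarrow> kern r t = 0"
  using bump_outside(1)[OF r, of t 0] by (simp add: kern_def)

lemma integrable_kern: "integrable lborel (kern r)"
  unfolding kern_def[abs_def] by (intro integrable_divide integrable_bump r)

lemma integral_kern: "(LINT t|lborel. kern r (t::'a::euclidean_space)) = 1"
  using bump_mass_pos[OF r, where 'a='a] by (simp add: kern_def bump_mass_def)

lemma nn_integral_kern: "(\<integral>\<^sup>+t. ennreal (kern r t) \<partial>lborel) = 1"
  by (subst nn_integral_eq_integral[OF integrable_kern]) (auto simp: kern_nonneg integral_kern)

lemma integrable_kern_mult:
  fixes v :: "'a::euclidean_space \<Rightarrow> 'b::euclidean_space"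
  assumes "integrable lborel v"
  shows "integrable lborel (\<lambda>t. kern r t *\<^sub>R v (x + t))"
proof (rule Bochner_Integration.integrable_bound)
  have [measurable]: "v \<in> borel_measurable borel"
    using assms by (auto dest: borel_measurable_integrable)
  show "(\<lambda>t. kern r t *\<^sub>R v (x + t)) \<in> borel_measurable lborel"
    by measurable
  show "integrable lborel (\<lambda>t. 1 / bump_mass TYPE('a) r * norm (v (x + t)))"
    using integrable_lborel_translate[OF assms, of x] by (simp add: add.commute)
  show "AE t in lborel. norm (kern r t *\<^sub>R v (x + t)) \<le> norm (1 / bump_mass TYPE('a) r * norm (v (x + t)))"
  proof (intro AE_I2)
    fix t
    have "norm (kern r t *\<^sub>R v (x + t)) \<le> 1 / bump_mass TYPE('a) r * norm (v (x + t))"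
      unfolding norm_scaleR by (intro mult_right_mono) (auto simp: kern_le kern_nonneg)
    then show "norm (kern r t *\<^sub>R v (x + t)) \<le> norm (1 / bump_mass TYPE('a) r * norm (v (x + t)))"
      using bump_mass_pos[OF r, where 'a='a] by (simp add: abs_mult)
  qed
qed

end

text \<open>Cauchy--Schwarz for a density of total mass at most one.\<close>

lemma norm_integral_sq_le:
  fixes h :: "'a \<Rightarrow> 'b::euclidean_space"
  assumes [measurable]: "k \<in> borel_measurable M" "h \<in> borel_measurable M"
    and k: "\<And>t. 0 \<le> k t" "(\<integral>\<^sup>+t. ennreal (k t) \<partial>M) \<le> 1"
  shows "ennreal ((norm (LINT t|M. k t *\<^sub>R h t))\<^sup>2) \<le> (\<integral>\<^sup>+t. ennreal (k t) * ennreal ((norm (h t))\<^sup>2) \<partial>M)"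
proof -
  have "ennreal (norm (LINT t|M. k t *\<^sub>R h t)) \<le> (\<integral>\<^sup>+t. ennreal (norm (k t *\<^sub>R h t)) \<partial>M)"
  proof (cases "integrable M (\<lambda>t. k t *\<^sub>R h t)")
    case True
    then show ?thesis
      by (rule integral_norm_bound_ennreal)
  qed (simp add: not_integrable_integral_eq)
  then have "ennreal ((norm (LINT t|M. k t *\<^sub>R h t))\<^sup>2) \<le> (\<integral>\<^sup>+t. ennreal (norm (k t *\<^sub>R h t)) \<partial>M)\<^sup>2"
    by (simp add: ennreal_power[symmetric] power_mono)
  also have "(\<integral>\<^sup>+t. ennreal (norm (k t *\<^sub>R h t)) \<partial>M) = (\<integral>\<^sup>+t. ennreal (sqrt (k t)) * ennreal (sqrt (k t) * norm (h t)) \<partial>M)"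
  proof (intro nn_integral_cong)
    fix t
    have "norm (k t *\<^sub>R h t) = sqrt (k t) * (sqrt (k t) * norm (h t))"
      using k(1)[of t] by (simp flip: mult.assoc)
    then show "ennreal (norm (k t *\<^sub>R h t)) = ennreal (sqrt (k t)) * ennreal (sqrt (k t) * norm (h t))"
      using k(1)[of t] by (simp only:) (intro ennreal_mult, auto)
  qed
  also have "\<dots>\<^sup>2 \<le> (\<integral>\<^sup>+t. ennreal (sqrt (k t)) ^ 2 \<partial>M) * (\<integral>\<^sup>+t. ennreal (sqrt (k t) * norm (h t)) ^ 2 \<partial>M)"
    by (rule Cauchy_Schwarz_nn_integral) measurable
  also have "\<dots> = (\<integral>\<^sup>+t. ennreal (k t) \<partial>M) * (\<integral>\<^sup>+t. ennreal (k t) * ennreal ((norm (h t))\<^sup>2) \<partial>M)"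
    using k(1) by (simp add: ennreal_power power_mult_distrib ennreal_mult)
  also have "\<dots> \<le> 1 * (\<integral>\<^sup>+t. ennreal (k t) * ennreal ((norm (h t))\<^sup>2) \<partial>M)"
    by (intro mult_right_mono k) auto
  finally show ?thesis by simp
qed

lemma moll_measurable [measurable]:
  assumes [measurable]: "v \<in> borel_measurable borel"
  shows "moll r v \<in> borel_measurable borel"
  unfolding moll_def[abs_def] by measurable

text \<open>An average of functions does not exceed a common bound of their square integrals, by
  Cauchy--Schwarz and Tonelli. The average is over translations for a mollification, and over
  the points of a segment for an increment of a differentiable function.\<close>

lemma sq_norm_average_le:
  fixes h :: "'c \<Rightarrow> 'a::euclidean_space \<Rightarrow> 'b::euclidean_space"
  assumes "sigma_finite_measure M"
    and [measurable]: "k \<in> borel_measurable M" "(\<lambda>(t, x). h t x) \<in> borel_measurable (M \<Otimes>\<^sub>M lborel)"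
    and k: "\<And>t. 0 \<le> k t" "(\<integral>\<^sup>+t. ennreal (k t) \<partial>M) \<le> 1"
    and B: "\<And>t. k t \<noteq> 0 \<Longrightarrow> sq_norm lborel (h t) \<le> B"
  shows "sq_norm lborel (\<lambda>x. LINT t|M. k t *\<^sub>R h t x) \<le> B"
proof -
  interpret M: sigma_finite_measure M by fact
  interpret pair_sigma_finite lborel M ..
  have [measurable]: "(\<lambda>(x, t). h t x) \<in> borel_measurable (lborel \<Otimes>\<^sub>M M)"
    using measurable_compose[OF measurable_pair_swap' assms(3)] by (simp add: split_beta')
  have "sq_norm lborel (\<lambda>x. LINT t|M. k t *\<^sub>R h t x) \<le> (\<integral>\<^sup>+x. (\<integral>\<^sup>+t. ennreal (k t) * ennreal ((norm (h t x))\<^sup>2) \<partial>M) \<partial>lborel)"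
    unfolding sq_norm_def by (intro nn_integral_mono norm_integral_sq_le k) measurable
  also have "\<dots> = (\<integral>\<^sup>+t. (\<integral>\<^sup>+x. ennreal (k t) * ennreal ((norm (h t x))\<^sup>2) \<partial>lborel) \<partial>M)"
    by (rule Fubini'[symmetric]) measurable
  also have "\<dots> \<le> (\<integral>\<^sup>+t. ennreal (k t) * B \<partial>M)"
  proof (intro nn_integral_mono)
    fix t assume "t \<in> space M"
    then have [measurable]: "h t \<in> borel_measurable lborel"
      using measurable_Pair2[OF assms(3)] by simp
    have "(\<integral>\<^sup>+x. ennreal (k t) * ennreal ((norm (h t x))\<^sup>2) \<partial>lborel) = ennreal (k t) * sq_norm lborel (h t)"
      unfolding sq_norm_def by (rule nn_integral_cmult) measurable
    also have "\<dots> \<le> ennreal (k t) * B"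
      using B[of t] by (cases "k t = 0") (auto intro: mult_left_mono)
    finally show "(\<integral>\<^sup>+x. ennreal (k t) * ennreal ((norm (h t x))\<^sup>2) \<partial>lborel) \<le> ennreal (k t) * B" .
  qed
  also have "\<dots> = (\<integral>\<^sup>+t. ennreal (k t) \<partial>M) * B"
    by (rule nn_integral_multc) measurable
  also have "\<dots> \<le> 1 * B"
    by (intro mult_right_mono k) auto
  finally show ?thesis by simp
qed

lemma moll_minus_self:
  fixes v :: "'a::euclidean_space \<Rightarrow> 'b::euclidean_space"
  assumes "r > 0" "integrable lborel v"
  shows "moll r v x - v x = (LINT t|lborel. kern r t *\<^sub>R (v (x + t) - v x))"
proof -
  have "(LINT t|lborel. kern r t *\<^sub>R (v (x + t) - v x)) = (LINT t|lborel. kern r t *\<^sub>R v (x + t) - kern r t *\<^sub>R v x)"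
    by (simp add: scaleR_diff_right)
  also have "\<dots> = moll r v x - (LINT t|lborel. kern r (t::'a) *\<^sub>R v x)"
    unfolding moll_def using integrable_kern_mult[OF assms] integrable_kern[OF assms(1)]
    by (intro Bochner_Integration.integral_diff) auto
  also have "(LINT t|lborel. kern r (t::'a) *\<^sub>R v x) = v x"
    using integrable_kern[OF assms(1)] by (subst integral_scaleR_left) (auto simp: integral_kern[OF assms(1)])
  finally show ?thesis ..
qed

lemma sq_norm_moll_diff_le:
  fixes v :: "'a::euclidean_space \<Rightarrow> 'b::euclidean_space"
  assumes r: "r > 0" and v: "integrable lborel v"
    and B: "\<And>t. norm t < r \<Longrightarrow> sq_norm lborel (\<lambda>x. v (x + t) - v x) \<le> B"
  shows "sq_norm lborel (\<lambda>x. moll r v x - v x) \<le> B"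
proof -
  have [measurable]: "v \<in> borel_measurable borel"
    using v by (auto dest: borel_measurable_integrable)
  show ?thesis
    unfolding moll_minus_self[OF r v]
  proof (rule sq_norm_average_le)
    show "sq_norm lborel (\<lambda>x. v (x + t) - v x) \<le> B" if "kern r t \<noteq> 0" for t
      using B kern_zero_outside[OF r, of t] that by force
  qed (auto simp: kern_nonneg[OF r] nn_integral_kern[OF r] intro: lborel.sigma_finite_measure_axioms)
qed

lemma sq_norm_moll_le:
  fixes v :: "'a::euclidean_space \<Rightarrow> 'b::euclidean_space"
  assumes r: "r > 0" and [measurable]: "v \<in> borel_measurable borel"
  shows "sq_norm lborel (moll r v) \<le> sq_norm lborel v"
  unfolding moll_def[abs_def]
  by (rule sq_norm_average_le)
     (auto simp: kern_nonneg[OF r] nn_integral_kern[OF r] sq_norm_translate intro: lborel.sigma_finite_measure_axioms)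

lemma moll_tendsto:
  fixes v :: "'a::euclidean_space \<Rightarrow> 'b::euclidean_space"
  assumes v: "integrable lborel v" and fin: "sq_norm lborel v < \<infinity>"
  shows "((\<lambda>r. sq_norm lborel (\<lambda>x. moll r v x - v x)) \<longlongrightarrow> 0) (at_right 0)"
  unfolding ennreal_tendsto_0_iff
proof (intro allI impI)
  fix e :: real assume "e > 0"
  have "v \<in> borel_measurable borel"
    using v by (auto dest: borel_measurable_integrable)
  from L2_translation_continuous[OF this fin] \<open>e > 0\<close>
  have "\<forall>\<^sub>F t in at 0. sq_norm lborel (\<lambda>x. v (x + t) - v x) \<le> ennreal e"
    by (auto simp: ennreal_tendsto_0_iff)
  then obtain d where d: "d > 0" "\<And>t. t \<noteq> 0 \<Longrightarrow> norm t < d \<Longrightarrow> sq_norm lborel (\<lambda>x. v (x + t) - v x) \<le> ennreal e"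
    by (auto simp: eventually_at)
  have z: "sq_norm lborel (\<lambda>x. v (x + 0) - v x) \<le> ennreal e"
    by (simp add: sq_norm_def)
  have "sq_norm lborel (\<lambda>x. moll r v x - v x) \<le> ennreal e" if "0 < r" "r < d" for r
  proof (rule sq_norm_moll_diff_le[OF that(1) v])
    show "sq_norm lborel (\<lambda>x. v (x + t) - v x) \<le> ennreal e" if "norm t < r" for t
      using d(2)[of t] z that \<open>r < d\<close> by (cases "t = 0") auto
  qed
  then show "\<forall>\<^sub>F r in at_right 0. sq_norm lborel (\<lambda>x. moll r v x - v x) \<le> ennreal e"
    unfolding eventually_at_right_field using d(1) by blast
qed

section \<open>Weak directional derivatives\<close>

text \<open>Bumps suffice as test functions, because only mollifications of \<open>v\<close> and \<open>w\<close> are ever compared.\<close>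

definition weak_dderiv :: "'a::euclidean_space \<Rightarrow> ('a \<Rightarrow> 'b::euclidean_space) \<Rightarrow> ('a \<Rightarrow> 'b) \<Rightarrow> bool" where
  "weak_dderiv b v w \<longleftrightarrow> (\<forall>r>0. \<forall>x. (LINT y|lborel. bump r x y *\<^sub>R w y) =
     - (LINT y|lborel. bump' r x b y *\<^sub>R v y))"

lemma bump_translate: "bump r 0 (y - x) = bump r x y"
  by (simp add: bump_def)

lemma bump_commute: "bump r x y = bump r y x"
  by (simp add: bump_def inner_diff_left inner_diff_right algebra_simps inner_commute)

lemma bump'_swap: "bump' r x b y = - bump' r y b x"
proof -
  have "(y - x) \<bullet> (y - x) = (x - y) \<bullet> (x - y)" "(y - x) \<bullet> b = - ((x - y) \<bullet> b)"
    by (simp_all add: inner_diff_left inner_diff_right algebra_simps inner_commute)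
  then show ?thesis
    by (simp add: bump'_def)
qed

lemma moll_eq_bump:
  fixes v :: "'a::euclidean_space \<Rightarrow> 'b::euclidean_space"
  assumes [measurable]: "v \<in> borel_measurable borel"
  shows "moll r v x = (1 / bump_mass TYPE('a) r) *\<^sub>R (LINT y|lborel. bump r x y *\<^sub>R v y)"
proof -
  have "(1 / bump_mass TYPE('a) r) *\<^sub>R (LINT y|lborel. bump r x y *\<^sub>R v y)
      = (LINT y|lborel. kern r (y - x) *\<^sub>R v y)"
    unfolding integral_scaleR_right[symmetric] by (simp add: kern_def bump_translate)
  also have "\<dots> = moll r v x"
    unfolding moll_def using integral_lborel_translate[of "\<lambda>y. kern r (y - x) *\<^sub>R v y" x]
    by (simp add: add.commute)
  finally show ?thesis ..
qed

lemma integrable_bump_mult: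
  fixes v :: "'a::euclidean_space \<Rightarrow> 'b::euclidean_space"
  assumes "integrable lborel v"
  shows "integrable lborel (\<lambda>y. bump r x y *\<^sub>R v y)"
proof (rule Bochner_Integration.integrable_bound[OF assms])
  have [measurable]: "v \<in> borel_measurable borel"
    using assms by (auto dest: borel_measurable_integrable)
  show "(\<lambda>y. bump r x y *\<^sub>R v y) \<in> borel_measurable lborel"
    by measurable
  show "AE y in lborel. norm (bump r x y *\<^sub>R v y) \<le> norm (v y)"
    by (intro AE_I2) (simp add: bump_nonneg bump_le_1 mult_left_le_one_le)
qed

text \<open>The constant depends on \<open>v\<close> only through its \<open>L\<^sup>1\<close> norm; this yields the equicontinuity that the
  theorem of Arzela and Ascoli asks for.\<close>

lemma moll_lipschitz:
  "\<exists>L\<ge>0. \<forall>r>0. \<forall>v x x'. integrable lborel v \<longrightarrow>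
     norm (moll r v (x::'a::euclidean_space) - moll r v x' :: 'b::euclidean_space)
       \<le> L / r / bump_mass TYPE('a) r * norm (x - x') * (LINT y|lborel. norm (v y))"
proof -
  obtain L where L: "L \<ge> 0" "\<And>r a z v. r > 0 \<Longrightarrow> \<bar>bump' r (a::'a) v z\<bar> \<le> L / r * norm v"
    using bump'_bounded[where 'a='a] by blast
  have "norm (moll r v x - moll r v x') \<le> L / r / bump_mass TYPE('a) r * norm (x - x') * (LINT y|lborel. norm (v y))"
    if "r > 0" "integrable lborel v" for r and v :: "'a \<Rightarrow> 'b" and x x'
  proof -
    note m = bump_mass_pos[OF that(1), where 'a='a]
    have [measurable]: "v \<in> borel_measurable borel"
      using that by (auto dest: borel_measurable_integrable)
    have "moll r v x - moll r v x' = (1 / bump_mass TYPE('a) r) *\<^sub>R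
        (LINT y|lborel. bump r x y *\<^sub>R v y - bump r x' y *\<^sub>R v y)"
      using that by (simp add: moll_eq_bump integrable_bump_mult scaleR_diff_right)
    also have "norm \<dots> \<le> 1 / bump_mass TYPE('a) r * (LINT y|lborel. norm (bump r x y *\<^sub>R v y - bump r x' y *\<^sub>R v y))"
      using m by (simp add: divide_right_mono)
    also have "(LINT y|lborel. norm (bump r x y *\<^sub>R v y - bump r x' y *\<^sub>R v y))
        \<le> (LINT y|lborel. L / r * norm (x - x') * norm (v y))"
    proof (rule integral_mono)
      show "integrable lborel (\<lambda>y. norm (bump r x y *\<^sub>R v y - bump r x' y *\<^sub>R v y))"
        using that by (intro integrable_norm Bochner_Integration.integrable_diff integrable_bump_mult)
      show "norm (bump r x y *\<^sub>R v y - bump r x' y *\<^sub>R v y) \<le> L / r * norm (x - x') * norm (v y)" for y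
      proof -
        have "\<bar>bump r x y - bump r x' y\<bar> \<le> L / r * norm (x - x')"
          using bump_lipschitz[of r y "L / r" x x'] L(2)[OF that(1)]
          by (simp add: bump_commute[of _ x] bump_commute[of _ x'])
        from mult_right_mono[OF this norm_ge_zero[of "v y"]] show ?thesis
          by (simp add: scaleR_diff_left[symmetric] del: scaleR_left_diff_distrib)
      qed
    qed (use that in auto)
    finally show ?thesis
      using m by (simp add: field_simps)
  qed
  then show ?thesis
    using L(1) by blast
qed

lemma has_vector_derivative_at_0I:
  fixes f :: "real \<Rightarrow> 'b::real_normed_vector"
  assumes "((\<lambda>h. (1 / h) *\<^sub>R (f h - f 0)) \<longlongrightarrow> D) (at 0)"
  shows "(f has_vector_derivative D) (at 0)"
proof -
  have "((\<lambda>h. norm ((1 / h) *\<^sub>R (f h - f 0) - D)) \<longlongrightarrow> 0) (at 0)"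
    using assms by (simp add: LIM_zero tendsto_norm_zero)
  moreover have "\<forall>\<^sub>F h in at 0. norm ((1 / h) *\<^sub>R (f h - f 0) - D) = norm (f h - f 0 - h *\<^sub>R D) / norm h"
    unfolding eventually_at_filter
  proof (intro always_eventually allI impI)
    fix h :: real assume "h \<noteq> 0"
    then have "(1 / h) *\<^sub>R (f h - f 0) - D = (1 / h) *\<^sub>R (f h - f 0 - h *\<^sub>R D)"
      by (simp add: scaleR_diff_right)
    then show "norm ((1 / h) *\<^sub>R (f h - f 0) - D) = norm (f h - f 0 - h *\<^sub>R D) / norm h"
      by simp
  qed
  ultimately have "((\<lambda>h. norm (f h - f 0 - h *\<^sub>R D) / norm h) \<longlongrightarrow> 0) (at 0)"
    by (rule Lim_transform_eventually)
  then show ?thesis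
    unfolding has_vector_derivative_def has_derivative_at by (simp add: bounded_linear_scaleR_left)
qed

text \<open>The difference quotient falls on the kernel, where it is bounded by the Lipschitz constant and
  converges to a derivative of a bump; the weak derivative moves it over to \<open>w\<close>.\<close>

lemma moll_has_vector_derivative_0:
  fixes v w :: "'a::euclidean_space \<Rightarrow> 'b::euclidean_space"
  assumes r: "r > 0" and v: "integrable lborel v" and w: "w \<in> borel_measurable borel"
    and weak: "weak_dderiv b v w"
  shows "((\<lambda>s. moll r v (x + s *\<^sub>R b)) has_vector_derivative moll r w x) (at 0)"
proof (rule has_vector_derivative_at_0I)
  have [measurable]: "v \<in> borel_measurable borel"
    using v by (auto dest: borel_measurable_integrable)
  let ?m = "bump_mass TYPE('a) r"
  obtain L where L: "L \<ge> 0" "\<And>a z v. \<bar>bump' r (a::'a) v z\<bar> \<le> L / r * norm v"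
    using bump'_bounded[where 'a='a] r by blast
  have "((\<lambda>h. LINT y|lborel. ((bump r (x + h *\<^sub>R b) y - bump r x y) / h) *\<^sub>R v y) \<longlongrightarrow>
      (LINT y|lborel. bump' r y b x *\<^sub>R v y)) (at 0)"
    unfolding tendsto_at_iff_sequentially comp_def
  proof (intro allI impI)
    fix X :: "nat \<Rightarrow> real" assume X: "\<forall>i. X i \<in> UNIV - {0}" "X \<longlonglongrightarrow> 0"
    show "(\<lambda>n. LINT y|lborel. ((bump r (x + X n *\<^sub>R b) y - bump r x y) / X n) *\<^sub>R v y) \<longlonglongrightarrow>
      (LINT y|lborel. bump' r y b x *\<^sub>R v y)"
    proof (rule integral_dominated_convergence[where w="\<lambda>y. L / r * norm b * norm (v y)"])
      show "(\<lambda>y. bump' r y b x *\<^sub>R v y) \<in> borel_measurable lborel"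
        unfolding bump'_swap[of _ _ b x] by measurable
      show "AE y in lborel. (\<lambda>n. ((bump r (x + X n *\<^sub>R b) y - bump r x y) / X n) *\<^sub>R v y) \<longlonglongrightarrow> bump' r y b x *\<^sub>R v y"
      proof (rule AE_I2)
        fix y
        have "((\<lambda>h. x + h *\<^sub>R b) has_derivative (\<lambda>h. h *\<^sub>R b)) (at 0)"
          by (auto intro!: derivative_eq_intros)
        from has_derivative_compose[OF this, of "bump r y"] bump_has_derivative[of r y x]
        have "((\<lambda>h. bump r y (x + h *\<^sub>R b)) has_derivative (\<lambda>h. bump' r y (h *\<^sub>R b) x)) (at 0)"
          by simp
        moreover have "(\<lambda>h. bump' r y (h *\<^sub>R b) x) = (*) (bump' r y b x)"
          by (auto simp: bump'_def)
        ultimately have "((\<lambda>h. bump r y (x + h *\<^sub>R b)) has_real_derivative bump' r y b x) (at 0)"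
          by (simp add: has_field_derivative_def)
        then have "(\<lambda>h. (bump r y (x + h *\<^sub>R b) - bump r y x) / h) \<midarrow>0\<rightarrow> bump' r y b x"
          by (simp add: DERIV_def)
        then have "(\<lambda>n. (bump r (x + X n *\<^sub>R b) y - bump r x y) / X n) \<longlonglongrightarrow> bump' r y b x"
          using X unfolding tendsto_at_iff_sequentially comp_def bump_commute[of _ y] by blast
        then show "(\<lambda>n. ((bump r (x + X n *\<^sub>R b) y - bump r x y) / X n) *\<^sub>R v y) \<longlonglongrightarrow> bump' r y b x *\<^sub>R v y"
          by (rule tendsto_scaleR[OF _ tendsto_const])
      qed
      show "AE y in lborel. norm (((bump r (x + X n *\<^sub>R b) y - bump r x y) / X n) *\<^sub>R v y) \<le> L / r * norm b * norm (v y)" for n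
      proof (intro AE_I2)
        fix y
        have "\<bar>bump r (x + X n *\<^sub>R b) y - bump r x y\<bar> \<le> L / r * norm (X n *\<^sub>R b)"
          using bump_lipschitz[of r y "L / r" "x + X n *\<^sub>R b" x] L(2) by (simp only: bump_commute[of _ y] add_diff_cancel_left')
        then have "\<bar>(bump r (x + X n *\<^sub>R b) y - bump r x y) / X n\<bar> \<le> L / r * norm b"
          using X(1) by (simp only: abs_divide) (subst pos_divide_le_eq, simp_all add: ac_simps)
        then show "norm (((bump r (x + X n *\<^sub>R b) y - bump r x y) / X n) *\<^sub>R v y) \<le> L / r * norm b * norm (v y)"
          unfolding norm_scaleR by (intro mult_right_mono) auto
      qed
    qed (use v in auto)
  qed
  from tendsto_scaleR[OF tendsto_const[of "1 / ?m"] this]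
  have "((\<lambda>h. (1 / ?m) *\<^sub>R (LINT y|lborel. ((bump r (x + h *\<^sub>R b) y - bump r x y) / h) *\<^sub>R v y)) \<longlongrightarrow>
      (1 / ?m) *\<^sub>R (LINT y|lborel. bump' r y b x *\<^sub>R v y)) (at 0)" .
  moreover have "(LINT y|lborel. bump' r y b x *\<^sub>R v y) = (LINT y|lborel. bump r x y *\<^sub>R w y)"
    using weak r unfolding weak_dderiv_def bump'_swap[of _ _ b x] by simp
  moreover have "(1 / ?m) *\<^sub>R (LINT y|lborel. ((bump r (x + h *\<^sub>R b) y - bump r x y) / h) *\<^sub>R v y)
      = (1 / h) *\<^sub>R (moll r v (x + h *\<^sub>R b) - moll r v (x + 0 *\<^sub>R b))" for h
  proof -
    have "moll r v (x + h *\<^sub>R b) - moll r v x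
        = (1 / ?m) *\<^sub>R (LINT y|lborel. bump r (x + h *\<^sub>R b) y *\<^sub>R v y - bump r x y *\<^sub>R v y)"
      using v by (simp add: moll_eq_bump integrable_bump_mult scaleR_diff_right)
    then have "(1 / h) *\<^sub>R (moll r v (x + h *\<^sub>R b) - moll r v x)
        = (1 / ?m) *\<^sub>R (LINT y|lborel. (1 / h) *\<^sub>R (bump r (x + h *\<^sub>R b) y *\<^sub>R v y - bump r x y *\<^sub>R v y))"
      by simp
    then show ?thesis
      by (simp add: scaleR_diff_left[symmetric] diff_divide_distrib scaleR_diff_right)
  qed
  ultimately show "((\<lambda>h. (1 / h) *\<^sub>R (moll r v (x + h *\<^sub>R b) - moll r v (x + 0 *\<^sub>R b))) \<longlongrightarrow> moll r w x) (at 0)"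
    using w by (simp add: moll_eq_bump)
qed

lemma moll_has_vector_derivative:
  fixes v w :: "'a::euclidean_space \<Rightarrow> 'b::euclidean_space"
  assumes "r > 0" "integrable lborel v" "w \<in> borel_measurable borel" "weak_dderiv b v w"
  shows "((\<lambda>s. moll r v (x + s *\<^sub>R b)) has_vector_derivative moll r w (x + s *\<^sub>R b)) (at s)"
proof -
  have "((\<lambda>h. moll r v ((x + s *\<^sub>R b) + h *\<^sub>R b)) has_vector_derivative moll r w (x + s *\<^sub>R b)) (at (s - s))"
    using moll_has_vector_derivative_0[OF assms] by simp
  moreover have "((\<lambda>u. u - s) has_vector_derivative 1) (at s)"
    by (auto intro!: derivative_eq_intros)
  ultimately show ?thesis
    using vector_diff_chain_at[of "\<lambda>u. u - s" 1 s "\<lambda>h. moll r v ((x + s *\<^sub>R b) + h *\<^sub>R b)"]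
    by (simp add: comp_def algebra_simps)
qed

lemma continuous_moll:
  fixes v :: "'a::euclidean_space \<Rightarrow> 'b::euclidean_space"
  assumes "r > 0" "integrable lborel v"
  shows "continuous_on UNIV (moll r v)"
proof -
  obtain L0 where L0: "norm (moll r v x - moll r v x')
      \<le> L0 / r / bump_mass TYPE('a) r * norm (x - x') * (LINT y|lborel. norm (v y))" for x x'
    using moll_lipschitz[where 'a='a and 'b='b] assms by blast
  define L where "L = L0 / r / bump_mass TYPE('a) r * (LINT y|lborel. norm (v y))"
  have L: "norm (moll r v x - moll r v x') \<le> L * norm (x - x')" for x x'
    using L0[of x x'] by (simp add: L_def ac_simps)
  have "(max L 0)-lipschitz_on UNIV (moll r v)"
    by (rule lipschitz_onI) (auto simp: dist_norm intro!: order_trans[OF L] mult_right_mono)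
  then show ?thesis
    by (rule lipschitz_on_continuous_on)
qed

text \<open>The increment of the mollified function is the average of its derivative over the segment.\<close>

lemma sq_norm_moll_translate_le:
  fixes v w :: "'a::euclidean_space \<Rightarrow> 'b::euclidean_space"
  assumes r: "r > 0" and v: "integrable lborel v" and w: "integrable lborel w" and weak: "weak_dderiv b v w"
  shows "sq_norm lborel (\<lambda>x. moll r v (x + b) - moll r v x) \<le> sq_norm lborel w"
proof -
  have [measurable]: "v \<in> borel_measurable borel" "w \<in> borel_measurable borel"
    using v w by (auto dest: borel_measurable_integrable)
  have "moll r v (x + b) - moll r v x = (LINT s|lborel. indicator {0..1::real} s *\<^sub>R moll r w (x + s *\<^sub>R b))" for x
  proof -
    have "(LINT s|lborel. indicator {0..1::real} s *\<^sub>R moll r w (x + s *\<^sub>R b)) = moll r v (x + 1 *\<^sub>R b) - moll r v (x + 0 *\<^sub>R b)"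
    proof (rule integral_FTC_atLeastAtMost)
      show "((\<lambda>s. moll r v (x + s *\<^sub>R b)) has_vector_derivative moll r w (x + s *\<^sub>R b)) (at s within {0..1})" for s
        using moll_has_vector_derivative[OF r v _ weak, of x s] by (simp add: has_vector_derivative_at_within)
      show "continuous_on {0..1} (\<lambda>s. moll r w (x + s *\<^sub>R b))"
        by (intro continuous_on_compose2[OF continuous_moll[OF r w]] continuous_intros) auto
    qed simp
    then show ?thesis by simp
  qed
  moreover have "(\<integral>\<^sup>+s. ennreal (indicator {0..1::real} s) \<partial>lborel) = 1"
    by (simp add: ennreal_indicator)
  ultimately show ?thesis
    by (simp only:)
      (rule sq_norm_average_le, auto intro: lborel.sigma_finite_measure_axioms simp: sq_norm_translate sq_norm_moll_le[OF r])
qed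

text \<open>Letting the mollification parameter tend to \<open>0\<close>. The constant \<open>4\<close> is not sharp; it comes from
  two applications of the weakened triangle inequality.\<close>

lemma sq_norm_translate_le:
  fixes v w :: "'a::euclidean_space \<Rightarrow> 'b::euclidean_space"
  assumes v: "integrable lborel v" "sq_norm lborel v < \<infinity>" and w: "integrable lborel w" and weak: "weak_dderiv b v w"
  shows "sq_norm lborel (\<lambda>x. v (x + b) - v x) \<le> 4 * sq_norm lborel w"
proof -
  have [measurable]: "v \<in> borel_measurable borel" "w \<in> borel_measurable borel"
    using v w by (auto dest: borel_measurable_integrable)
  have "((\<lambda>r. 6 * sq_norm lborel (\<lambda>x. moll r v x - v x) + 4 * sq_norm lborel w) \<longlongrightarrow> 6 * 0 + 4 * sq_norm lborel w) (at_right 0)"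
    by (intro tendsto_add tendsto_const ennreal_tendsto_cmult moll_tendsto v) auto
  moreover have "\<forall>\<^sub>F r in at_right (0::real). sq_norm lborel (\<lambda>x. v (x + b) - v x) \<le>
      6 * sq_norm lborel (\<lambda>x. moll r v x - v x) + 4 * sq_norm lborel w"
    unfolding eventually_at_filter
  proof (intro always_eventually allI impI)
    fix r :: real assume "r \<in> {0<..}"
    then have r: "r > 0" by simp
    let ?A = "sq_norm lborel (\<lambda>x. moll r v x - v x)"
    have "sq_norm lborel (\<lambda>x. v (x + b) - v x)
      \<le> 2 * sq_norm lborel (\<lambda>x. v (x + b) - moll r v (x + b)) + 2 * sq_norm lborel (\<lambda>x. moll r v (x + b) - v x)"
      by (rule sq_norm_diff_triangle) measurable
    also have "sq_norm lborel (\<lambda>x. v (x + b) - moll r v (x + b)) = ?A"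
      using sq_norm_translate[of "\<lambda>x. v x - moll r v x" b] by (simp add: sq_norm_diff_commute[of _ v])
    also have "2 * ?A + 2 * sq_norm lborel (\<lambda>x. moll r v (x + b) - v x) \<le>
        2 * ?A + 2 * (2 * sq_norm lborel (\<lambda>x. moll r v (x + b) - moll r v x) + 2 * ?A)"
      by (intro add_left_mono mult_left_mono sq_norm_diff_triangle) auto
    also have "\<dots> \<le> 2 * ?A + 2 * (2 * sq_norm lborel w + 2 * ?A)"
      by (intro add_left_mono mult_left_mono add_right_mono sq_norm_moll_translate_le r v w weak) auto
    also have "\<dots> = 6 * ?A + 4 * sq_norm lborel w"
      by (simp add: algebra_simps flip: distrib_right)
    finally show "sq_norm lborel (\<lambda>x. v (x + b) - v x) \<le> 6 * ?A + 4 * sq_norm lborel w" .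
  qed
  ultimately have "sq_norm lborel (\<lambda>x. v (x + b) - v x) \<le> 6 * 0 + 4 * sq_norm lborel w"
    by (rule tendsto_lowerbound) simp
  then show ?thesis
    by simp
qed

lemma integrable_bump'_mult:
  fixes v :: "'a::euclidean_space \<Rightarrow> 'b::euclidean_space"
  assumes "r > 0" "integrable lborel v"
  shows "integrable lborel (\<lambda>y. bump' r x b y *\<^sub>R v y)"
proof -
  obtain L where L: "L \<ge> 0" "\<And>a z v. \<bar>bump' r (a::'a) v z\<bar> \<le> L / r * norm v"
    using bump'_bounded[where 'a='a] assms(1) by blast
  show ?thesis
  proof (rule Bochner_Integration.integrable_bound)
    have [measurable]: "v \<in> borel_measurable borel"
      using assms by (auto dest: borel_measurable_integrable)
    show "(\<lambda>y. bump' r x b y *\<^sub>R v y) \<in> borel_measurable lborel"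
      by measurable
    show "integrable lborel (\<lambda>y. L / r * norm b * norm (v y))"
      using assms by simp
    show "AE y in lborel. norm (bump' r x b y *\<^sub>R v y) \<le> norm (L / r * norm b * norm (v y))"
    proof (rule AE_I2)
      fix y
      show "norm (bump' r x b y *\<^sub>R v y) \<le> norm (L / r * norm b * norm (v y))"
        using mult_right_mono[OF L(2)[of x b y] norm_ge_zero[of "v y"]] L(1) assms(1) by (simp add: abs_mult)
    qed
  qed
qed

lemma bump'_Basis: "bump' r x t y = (\<Sum>b\<in>Basis. (t \<bullet> b) * bump' r x b y)"
  unfolding bump'_def euclidean_inner[of "y - x" t] sum_distrib_left sum_distrib_right
  by (intro sum.cong) (auto simp: ac_simps)

text \<open>Derivatives in the coordinate directions give one in every direction \<open>t\<close>, so that the effect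
  of translation by \<open>t\<close> is estimated in one step.\<close>

lemma weak_dderiv_Basis:
  fixes v :: "'a::euclidean_space \<Rightarrow> 'b::euclidean_space"
  assumes v: "integrable lborel v" and w: "\<And>b. b \<in> Basis \<Longrightarrow> integrable lborel (w b)"
    and weak: "\<And>b. b \<in> Basis \<Longrightarrow> weak_dderiv b v (w b)"
  shows "weak_dderiv t v (\<lambda>x. \<Sum>b\<in>Basis. (t \<bullet> b) *\<^sub>R w b x)"
  unfolding weak_dderiv_def
proof (intro allI impI)
  fix r :: real and x :: 'a assume r: "r > 0"
  have "(LINT y|lborel. bump r x y *\<^sub>R (\<Sum>b\<in>Basis. (t \<bullet> b) *\<^sub>R w b y))
    = (LINT y|lborel. (\<Sum>b\<in>Basis. (t \<bullet> b) *\<^sub>R (bump r x y *\<^sub>R w b y)))"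
    by (simp add: scaleR_sum_right ac_simps)
  also have "\<dots> = (\<Sum>b\<in>Basis. (t \<bullet> b) *\<^sub>R (LINT y|lborel. bump r x y *\<^sub>R w b y))"
    using w by (subst Bochner_Integration.integral_sum)
      (auto intro!: integrable_scaleR_right integrable_bump_mult simp del: scaleR_scaleR)
  also have "\<dots> = (\<Sum>b\<in>Basis. (t \<bullet> b) *\<^sub>R - (LINT y|lborel. bump' r x b y *\<^sub>R v y))"
    using weak r by (intro sum.cong refl) (simp add: weak_dderiv_def)
  also have "\<dots> = - (LINT y|lborel. (\<Sum>b\<in>Basis. (t \<bullet> b) *\<^sub>R (bump' r x b y *\<^sub>R v y)))"
    using v r by (subst Bochner_Integration.integral_sum)
      (auto intro!: integrable_scaleR_right integrable_bump'_mult simp: sum_negf simp del: scaleR_scaleR)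
  also have "(LINT y|lborel. (\<Sum>b\<in>Basis. (t \<bullet> b) *\<^sub>R (bump' r x b y *\<^sub>R v y)))
      = (LINT y|lborel. bump' r x t y *\<^sub>R v y)"
    by (simp add: bump'_Basis[of _ x t] scaleR_sum_left)
  finally show "(LINT y|lborel. bump r x y *\<^sub>R (\<Sum>b\<in>Basis. (t \<bullet> b) *\<^sub>R w b y))
    = - (LINT y|lborel. bump' r x t y *\<^sub>R v y)" .
qed

lemma sq_norm_Basis_le:
  fixes w :: "'a::euclidean_space \<Rightarrow> 'a \<Rightarrow> 'b::euclidean_space"
  assumes [measurable]: "\<And>b. b \<in> Basis \<Longrightarrow> w b \<in> borel_measurable M"
  shows "sq_norm M (\<lambda>x. \<Sum>b\<in>Basis. (t \<bullet> b) *\<^sub>R w b x) \<le> ennreal ((norm t)\<^sup>2) * (\<Sum>b\<in>Basis. sq_norm M (w b))"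
proof -
  have "sq_norm M (\<lambda>x. \<Sum>b\<in>Basis. (t \<bullet> b) *\<^sub>R w b x) \<le>
      (\<integral>\<^sup>+x. ennreal ((norm t)\<^sup>2) * (\<Sum>b\<in>Basis. ennreal ((norm (w b x))\<^sup>2)) \<partial>M)"
    unfolding sq_norm_def
  proof (intro nn_integral_mono)
    fix x
    have "(norm (\<Sum>b\<in>Basis. (t \<bullet> b) *\<^sub>R w b x))\<^sup>2 \<le> (\<Sum>b\<in>Basis. \<bar>t \<bullet> b\<bar> * norm (w b x))\<^sup>2"
      by (intro power_mono order_trans[OF norm_sum]) auto
    also have "\<dots> \<le> (\<Sum>b\<in>Basis. \<bar>t \<bullet> b\<bar>\<^sup>2) * (\<Sum>b\<in>Basis. (norm (w b x))\<^sup>2)"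
      by (rule Cauchy_Schwarz_ineq_sum)
    also have "(\<Sum>b\<in>Basis. \<bar>t \<bullet> b\<bar>\<^sup>2) = (norm t)\<^sup>2"
      unfolding power2_norm_eq_inner euclidean_inner[of t t] by (simp add: power2_eq_square)
    finally have "ennreal ((norm (\<Sum>b\<in>Basis. (t \<bullet> b) *\<^sub>R w b x))\<^sup>2) \<le> ennreal ((norm t)\<^sup>2 * (\<Sum>b\<in>Basis. (norm (w b x))\<^sup>2))"
      by (rule ennreal_leI)
    then show "ennreal ((norm (\<Sum>b\<in>Basis. (t \<bullet> b) *\<^sub>R w b x))\<^sup>2) \<le> ennreal ((norm t)\<^sup>2) * (\<Sum>b\<in>Basis. ennreal ((norm (w b x))\<^sup>2))"
      by (simp add: ennreal_mult sum_nonneg)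
  qed
  also have "\<dots> = ennreal ((norm t)\<^sup>2) * (\<integral>\<^sup>+x. (\<Sum>b\<in>Basis. ennreal ((norm (w b x))\<^sup>2)) \<partial>M)"
    by (rule nn_integral_cmult) measurable
  also have "(\<integral>\<^sup>+x. (\<Sum>b\<in>Basis. ennreal ((norm (w b x))\<^sup>2)) \<partial>M) = (\<Sum>b\<in>Basis. sq_norm M (w b))"
    unfolding sq_norm_def by (rule nn_integral_sum) measurable
  finally show ?thesis .
qed

lemma sq_norm_moll_rate:
  fixes v :: "'a::euclidean_space \<Rightarrow> 'b::euclidean_space"
  assumes r: "r > 0" and v: "integrable lborel v" "sq_norm lborel v < \<infinity>"
    and w: "\<And>b. b \<in> Basis \<Longrightarrow> integrable lborel (w b)"
    and weak: "\<And>b. b \<in> Basis \<Longrightarrow> weak_dderiv b v (w b)"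
  shows "sq_norm lborel (\<lambda>x. moll r v x - v x) \<le> ennreal (4 * r\<^sup>2) * (\<Sum>b\<in>Basis. sq_norm lborel (w b))"
proof (rule sq_norm_moll_diff_le[OF r v(1)])
  fix t :: 'a assume t: "norm t < r"
  have "sq_norm lborel (\<lambda>x. v (x + t) - v x) \<le> 4 * sq_norm lborel (\<lambda>x. \<Sum>b\<in>Basis. (t \<bullet> b) *\<^sub>R w b x)"
    using w by (intro sq_norm_translate_le v weak_dderiv_Basis weak) auto
  also have "\<dots> \<le> 4 * (ennreal ((norm t)\<^sup>2) * (\<Sum>b\<in>Basis. sq_norm lborel (w b)))"
    using w by (intro mult_left_mono sq_norm_Basis_le) (auto dest: borel_measurable_integrable)
  also have "\<dots> \<le> 4 * (ennreal (r\<^sup>2) * (\<Sum>b\<in>Basis. sq_norm lborel (w b)))"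
    using t by (intro mult_left_mono mult_right_mono ennreal_leI power_mono) auto
  also have "\<dots> = ennreal (4 * r\<^sup>2) * (\<Sum>b\<in>Basis. sq_norm lborel (w b))"
    by (simp add: ennreal_mult mult.assoc)
  finally show "sq_norm lborel (\<lambda>x. v (x + t) - v x) \<le> ennreal (4 * r\<^sup>2) * (\<Sum>b\<in>Basis. sq_norm lborel (w b))" .
qed

section \<open>Compactness for functions with a common bounded support\<close>

lemma integrable_of_sq_norm:
  fixes v :: "'a::euclidean_space \<Rightarrow> 'b::euclidean_space"
  assumes [measurable]: "v \<in> borel_measurable borel" and supp: "\<And>x. norm x \<ge> R \<Longrightarrow> v x = 0"
    and C: "sq_norm lborel v \<le> ennreal C" "C \<ge> 0"
  shows "integrable lborel v" and "(LINT x|lborel. norm (v x)) \<le> measure lborel (ball (0::'a) R) + C"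
proof -
  have fin: "emeasure lborel (ball (0::'a) R) = ennreal (measure lborel (ball (0::'a) R))"
    using emeasure_lborel_ball_finite[of "0::'a" R] by (intro emeasure_eq_ennreal_measure) simp
  have "(\<integral>\<^sup>+x. ennreal (norm (v x)) \<partial>lborel) \<le> (\<integral>\<^sup>+x. indicator (ball 0 R) x + ennreal ((norm (v x))\<^sup>2) \<partial>lborel)"
  proof (intro nn_integral_mono)
    fix x
    show "ennreal (norm (v x)) \<le> indicator (ball 0 R) x + ennreal ((norm (v x))\<^sup>2)"
    proof (cases "norm x \<ge> R")
      case False
      have "norm (v x) \<le> 1 + (norm (v x))\<^sup>2"
        using sum_squares_bound[of 1 "norm (v x)"] norm_ge_zero[of "v x"] by (simp add: power2_eq_square del: norm_ge_zero)
      then have "ennreal (norm (v x)) \<le> ennreal (1 + (norm (v x))\<^sup>2)"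
        by (rule ennreal_leI)
      then show ?thesis
        using False by (simp add: ennreal_plus)
    qed (simp add: supp)
  qed
  also have "\<dots> = emeasure lborel (ball (0::'a) R) + sq_norm lborel v"
    unfolding sq_norm_def by (subst nn_integral_add) (auto intro!: borel_measurable_indicator)
  also have "\<dots> \<le> ennreal (measure lborel (ball (0::'a) R)) + ennreal C"
    unfolding fin by (intro add_left_mono C)
  also have "\<dots> = ennreal (measure lborel (ball (0::'a) R) + C)"
    using C by simp
  finally have le: "(\<integral>\<^sup>+x. ennreal (norm (v x)) \<partial>lborel) \<le> ennreal (measure lborel (ball (0::'a) R) + C)" .
  then show int: "integrable lborel v"
    unfolding integrable_iff_bounded by (auto simp: order_le_less_trans[OF le])
  show "(LINT x|lborel. norm (v x)) \<le> measure lborel (ball (0::'a) R) + C"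
    using le C by (subst (asm) nn_integral_eq_integral) (auto simp: int simp del: ennreal_plus)
qed

lemma moll_zero_outside:
  assumes "r > 0" "\<And>x. norm x \<ge> R \<Longrightarrow> v x = 0" "norm x \<ge> R + r"
  shows "moll r v x = 0"
proof -
  have "kern r t *\<^sub>R v (x + t) = 0" for t
  proof (cases "norm t \<ge> r")
    case False
    then have "norm (x + t) \<ge> R"
      using assms(3) norm_triangle_ineq4[of "x + t" t] by simp
    then show ?thesis
      by (simp add: assms)
  qed (simp add: kern_zero_outside[OF assms(1)])
  then show ?thesis
    unfolding moll_def by (simp only: Bochner_Integration.integral_zero)
qed

lemma norm_moll_le:
  fixes v :: "'a::euclidean_space \<Rightarrow> 'b::euclidean_space"
  assumes "r > 0" "integrable lborel v"
  shows "norm (moll r v x) \<le> 1 / bump_mass TYPE('a) r * (LINT y|lborel. norm (v y))"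
proof -
  note m = bump_mass_pos[OF assms(1), where 'a='a]
  have [measurable]: "v \<in> borel_measurable borel"
    using assms by (auto dest: borel_measurable_integrable)
  have "norm (moll r v x) \<le> 1 / bump_mass TYPE('a) r * (LINT y|lborel. norm (bump r x y *\<^sub>R v y))"
    unfolding moll_eq_bump[OF \<open>v \<in> borel_measurable borel\<close>] norm_scaleR
    using m by (intro order_trans[OF mult_left_mono[OF integral_norm_bound]]) auto
  also have "(LINT y|lborel. norm (bump r x y *\<^sub>R v y)) \<le> (LINT y|lborel. norm (v y))"
    using assms(2) by (intro integral_mono integrable_norm integrable_bump_mult)
      (auto simp: bump_nonneg bump_le_1 mult_left_le_one_le)
  finally show ?thesis
    using m by (simp add: divide_right_mono)
qed

text \<open>Mollification at a small scale \<open>r\<close> moves all functions by little. For this fixed \<open>r\<close> the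
  mollified functions are equibounded and equicontinuous on a ball that contains their supports,
  so two of them are uniformly close by the theorem of Arzela and Ascoli.\<close>

lemma rellich_close_pair:
  fixes v :: "nat \<Rightarrow> 'a::euclidean_space \<Rightarrow> 'b::euclidean_space"
  assumes meas: "\<And>n. v n \<in> borel_measurable borel"
    and supp: "\<And>n x. norm x \<ge> R \<Longrightarrow> v n x = 0"
    and w: "\<And>n b. b \<in> Basis \<Longrightarrow> integrable lborel (w n b)"
    and weak: "\<And>n b. b \<in> Basis \<Longrightarrow> weak_dderiv b (v n) (w n b)"
    and vC: "\<And>n. sq_norm lborel (v n) \<le> ennreal C"
    and wC: "\<And>n b. b \<in> Basis \<Longrightarrow> sq_norm lborel (w n b) \<le> ennreal C"
    and C: "C \<ge> 0" and e: "e > 0"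
  shows "\<exists>i j. i < j \<and> sq_norm lborel (\<lambda>x. v i x - v j x) \<le> ennreal e"
proof -
  note [measurable] = meas
  define I where "I = measure lborel (ball (0::'a) R) + C"
  have int: "integrable lborel (v n)" and I: "(LINT x|lborel. norm (v n x)) \<le> I" for n
    using integrable_of_sq_norm[OF meas supp vC C] by (auto simp: I_def)
  have I0: "I \<ge> 0"
    using C by (simp add: I_def)
  have fin: "sq_norm lborel (v n) < \<infinity>" for n
    using vC[of n] by (simp add: order_le_less_trans)
  \<comment> \<open>so small that mollification contributes at most \<open>e / 16\<close>; the summand \<open>1\<close> avoids division by \<open>0\<close>\<close>
  define r where "r = min 1 (sqrt (e / (64 * (DIM('a) * C + 1))))"
  have r: "r > 0"
    using e C by (auto simp: r_def intro!: divide_pos_pos add_nonneg_pos)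
  have "r\<^sup>2 \<le> (sqrt (e / (64 * (DIM('a) * C + 1))))\<^sup>2"
    using r by (intro power_mono) (auto simp: r_def)
  also have "\<dots> = e / (64 * (DIM('a) * C + 1))"
    using e C by simp
  finally have "r\<^sup>2 * (64 * (DIM('a) * C + 1)) \<le> e"
    using C by (subst (asm) pos_le_divide_eq) (auto intro!: add_nonneg_pos)
  then have "4 * r\<^sup>2 * (DIM('a) * C + 1) \<le> e / 16"
    by (simp add: algebra_simps)
  then have r2: "4 * r\<^sup>2 * (DIM('a) * C) \<le> e / 16"
    using mult_left_mono[of "DIM('a) * C" "DIM('a) * C + 1" "4 * r\<^sup>2"] by simp
  have rate: "sq_norm lborel (\<lambda>x. moll r (v n) x - v n x) \<le> ennreal (e / 16)" for n
  proof -
    have "sq_norm lborel (\<lambda>x. moll r (v n) x - v n x) \<le> ennreal (4 * r\<^sup>2) * (\<Sum>b\<in>Basis. sq_norm lborel (w n b))"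
      by (rule sq_norm_moll_rate[OF r int fin w weak])
    also have "\<dots> \<le> ennreal (4 * r\<^sup>2) * (\<Sum>b\<in>(Basis::'a set). ennreal C)"
      by (intro mult_left_mono sum_mono wC) auto
    also have "\<dots> = ennreal (4 * r\<^sup>2 * (DIM('a) * C))"
      using C by (simp add: sum_ennreal ennreal_mult del: sum_constant) (simp add: ennreal_mult)
    also have "\<dots> \<le> ennreal (e / 16)"
      by (intro ennreal_leI r2)
    finally show ?thesis .
  qed
  define S where "S = cball (0::'a) (R + r)"
  define V where "V = measure lborel S"
  have V: "emeasure lborel S = ennreal V"
    unfolding V_def S_def using emeasure_lborel_cball_finite[of "0::'a" "R + r"] by (intro emeasure_eq_ennreal_measure) simp
  \<comment> \<open>uniform distance \<open>2 * \<eta>\<close> on \<open>S\<close> contributes at most \<open>e / 16\<close>\<close>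
  define \<eta> where "\<eta> = sqrt (e / (64 * (V + 1)))"
  have V0: "V \<ge> 0"
    by (simp add: V_def)
  have \<eta>: "\<eta> > 0"
    using e V0 by (auto simp: \<eta>_def intro!: divide_pos_pos)
  have "\<eta>\<^sup>2 = e / (64 * (V + 1))"
    using e V0 by (simp add: \<eta>_def)
  then have "4 * \<eta>\<^sup>2 * (V + 1) \<le> e / 16"
    using V0 by (simp add: field_simps)
  then have \<eta>2: "4 * \<eta>\<^sup>2 * V \<le> e / 16"
    using mult_left_mono[of V "V + 1" "4 * \<eta>\<^sup>2"] by simp
  define m where "m = bump_mass TYPE('a) r"
  have m: "m > 0"
    unfolding m_def using r by (rule bump_mass_pos)
  obtain L where L0: "L \<ge> 0" "\<forall>r>0. \<forall>v x x'. integrable lborel v \<longrightarrow>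
      norm (moll r v (x::'a) - moll r v x' :: 'b) \<le> L / r / bump_mass TYPE('a) r * norm (x - x') * (LINT y|lborel. norm (v y))"
    using moll_lipschitz[where 'a='a and 'b='b] by (elim exE conjE)
  have L: "L \<ge> 0" "\<And>n x x'. norm (moll r (v n) x - moll r (v n) x')
      \<le> L / r / m * norm (x - x') * (LINT y|lborel. norm (v n y))"
    using L0(1) L0(2)[rule_format, OF r int] by (simp_all add: m_def)
  obtain g k where k: "strict_mono (k :: nat \<Rightarrow> nat)"
    and g: "\<And>e. 0 < e \<Longrightarrow> \<exists>N. \<forall>n x. n \<ge> N \<and> x \<in> S \<longrightarrow> norm (moll r (v (k n)) x - g x) < e"
  proof (rule Arzela_Ascoli[of S "\<lambda>n. moll r (v n)" "1 / m * I"])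
    show "compact S"
      by (simp add: S_def)
    show "norm (moll r (v n) x) \<le> 1 / m * I" for n x
      using m I[of n] by (intro order_trans[OF norm_moll_le[OF r int[of n], of x, folded m_def]] mult_left_mono) auto
    show "\<exists>d>0. \<forall>n y. y \<in> S \<and> norm (x - y) < d \<longrightarrow> norm (moll r (v n) x - moll r (v n) y) < e"
      if "0 < e" for x e
    proof (intro exI[of _ "e / (L / r / m * I + 1)"] conjI allI impI)
      have K0: "0 \<le> L / r / m * I"
        using L(1) r m I0 by auto
      then show "0 < e / (L / r / m * I + 1)"
        using that by (intro divide_pos_pos) auto
      fix n y assume "y \<in> S \<and> norm (x - y) < e / (L / r / m * I + 1)"
      then have "norm (x - y) * (L / r / m * I + 1) < e"
        using K0 by (simp add: pos_less_divide_eq)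
      moreover have "norm (moll r (v n) x - moll r (v n) y) \<le> L / r / m * norm (x - y) * I"
        using L(1) r m I[of n] by (intro order_trans[OF L(2)] mult_left_mono) auto
      moreover have "L / r / m * norm (x - y) * I \<le> norm (x - y) * (L / r / m * I + 1)"
        by (simp add: algebra_simps)
      ultimately show "norm (moll r (v n) x - moll r (v n) y) < e"
        by linarith
    qed
  qed auto
  obtain N where N: "\<And>n x. n \<ge> N \<Longrightarrow> x \<in> S \<Longrightarrow> norm (moll r (v (k n)) x - g x) < \<eta>"
    using g[OF \<eta>] by blast
  define i j where "i = k N" and "j = k (Suc N)"
  have "sq_norm lborel (\<lambda>x. moll r (v i) x - moll r (v j) x) \<le> (\<integral>\<^sup>+x. ennreal (4 * \<eta>\<^sup>2) * indicator S x \<partial>lborel)"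
    unfolding sq_norm_def
  proof (intro nn_integral_mono)
    fix x
    show "ennreal ((norm (moll r (v i) x - moll r (v j) x))\<^sup>2) \<le> ennreal (4 * \<eta>\<^sup>2) * indicator S x"
    proof (cases "x \<in> S")
      case True
      have "norm (moll r (v i) x - moll r (v j) x) \<le> 2 * \<eta>"
        using N[of N x] N[of "Suc N" x] True norm_triangle_ineq4[of "moll r (v i) x - g x" "moll r (v j) x - g x"]
        by (simp add: i_def j_def)
      then have "(norm (moll r (v i) x - moll r (v j) x))\<^sup>2 \<le> (2 * \<eta>)\<^sup>2"
        by (intro power_mono) auto
      then show ?thesis
        using True by (simp add: power_mult_distrib ennreal_leI)
    next
      case False
      then have "moll r (v n) x = 0" for n
        by (intro moll_zero_outside[OF r supp]) (auto simp: S_def)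
      then show ?thesis
        by simp
    qed
  qed
  also have "\<dots> = ennreal (4 * \<eta>\<^sup>2 * V)"
    by (subst nn_integral_cmult_indicator) (auto simp: S_def[symmetric] V V0 ennreal_mult, simp add: S_def)
  also have "\<dots> \<le> ennreal (e / 16)"
    by (intro ennreal_leI \<eta>2)
  finally have close: "sq_norm lborel (\<lambda>x. moll r (v i) x - moll r (v j) x) \<le> ennreal (e / 16)" .
  have "sq_norm lborel (\<lambda>x. v i x - v j x)
      \<le> 2 * sq_norm lborel (\<lambda>x. v i x - moll r (v i) x) + 2 * sq_norm lborel (\<lambda>x. moll r (v i) x - v j x)"
    by (rule sq_norm_diff_triangle) measurable
  also have "\<dots> \<le> 2 * sq_norm lborel (\<lambda>x. v i x - moll r (v i) x) +
      2 * (2 * sq_norm lborel (\<lambda>x. moll r (v i) x - moll r (v j) x) + 2 * sq_norm lborel (\<lambda>x. moll r (v j) x - v j x))"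
    by (intro add_left_mono mult_left_mono sq_norm_diff_triangle) auto
  also have "\<dots> \<le> 2 * ennreal (e / 16) + 2 * (2 * ennreal (e / 16) + 2 * ennreal (e / 16))"
    by (intro add_mono mult_left_mono close rate) (auto simp: sq_norm_diff_commute[of _ "v i"] rate)
  also have "\<dots> = ennreal (2 * (e / 16) + 2 * (2 * (e / 16) + 2 * (e / 16)))"
    using e by (simp add: ennreal_mult ennreal_plus del: times_divide_eq_right flip: distrib_right)
  also have "\<dots> \<le> ennreal e"
    using e by (intro ennreal_leI) simp
  finally have "sq_norm lborel (\<lambda>x. v i x - v j x) \<le> ennreal e" .
  moreover have "i < j"
    using k by (simp add: i_def j_def strict_mono_def)
  ultimately show ?thesis
    by blast
qed

section \<open>The energy identity\<close>

text \<open>Translation invariance makes the integrals of the difference quotients vanish, and these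
  quotients converge boundedly with bounded support. Applied to a product of functions, this is
  integration by parts.\<close>

lemma integral_directional_derivative_eq_0:
  fixes h h' :: "'a::euclidean_space \<Rightarrow> real"
  assumes deriv: "\<And>x s. ((\<lambda>s. h (x + s *\<^sub>R b)) has_real_derivative h' (x + s *\<^sub>R b)) (at s)"
    and cont: "continuous_on UNIV h" "continuous_on UNIV h'"
    and supp: "\<And>x. norm x \<ge> \<rho> \<Longrightarrow> h x = 0" "\<And>x. norm x \<ge> \<rho> \<Longrightarrow> h' x = 0"
  shows "(LINT x|lborel. h' x) = 0"
proof -
  have [measurable]: "h \<in> borel_measurable borel" "h' \<in> borel_measurable borel"
    using cont by (auto intro: borel_measurable_continuous_onI)
  have int: "integrable lborel h"
    using cont(1) supp(1) by (rule integrable_compact_support)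
  obtain M where M: "M > 0" "\<And>x. norm x \<le> \<rho> \<Longrightarrow> \<bar>h' x\<bar> \<le> M"
    using continuous_bounded_on_cball[OF cont(2)] by blast
  have M': "\<bar>h' x\<bar> \<le> M" for x
    using M(1) M(2)[of x] supp(2)[of x] by (cases "norm x \<le> \<rho>") auto
  define K where "K = cball (0::'a) (\<rho> + norm b)"
  define X where "X n = 1 / real (Suc n)" for n
  have X: "X n \<noteq> 0" "\<bar>X n\<bar> \<le> 1" for n
    by (auto simp: X_def)
  have X0: "X \<longlonglongrightarrow> 0"
    using LIMSEQ_inverse_real_of_nat by (simp add: X_def[abs_def] inverse_eq_divide)
  have lip: "\<bar>h (x + s *\<^sub>R b) - h x\<bar> \<le> M * \<bar>s\<bar>" for x s
    using field_differentiable_bound[of UNIV "\<lambda>s. h (x + s *\<^sub>R b)" "\<lambda>s. h' (x + s *\<^sub>R b)" "M" s 0]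
      deriv M' by simp
  have "(\<lambda>n. LINT x|lborel. (h (x + X n *\<^sub>R b) - h x) / X n) \<longlonglongrightarrow> (LINT x|lborel. h' x)"
  proof (rule integral_dominated_convergence[where w="\<lambda>x. indicator K x *\<^sub>R M"])
    show "integrable lborel (\<lambda>x. indicator K x *\<^sub>R M)"
      unfolding K_def using emeasure_lborel_cball_finite by (intro integrable_indicator) auto
    show "AE x in lborel. (\<lambda>n. (h (x + X n *\<^sub>R b) - h x) / X n) \<longlonglongrightarrow> h' x"
    proof (rule AE_I2)
      fix x
      have "(\<lambda>s. (h (x + s *\<^sub>R b) - h x) / s) \<midarrow>0\<rightarrow> h' x"
        using deriv[of x 0] by (simp add: DERIV_def)
      then show "(\<lambda>n. (h (x + X n *\<^sub>R b) - h x) / X n) \<longlonglongrightarrow> h' x"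
        using X X0 by (auto simp: tendsto_at_iff_sequentially comp_def)
    qed
    show "AE x in lborel. norm ((h (x + X n *\<^sub>R b) - h x) / X n) \<le> indicator K x *\<^sub>R M" for n
    proof (rule AE_I2)
      fix x
      show "norm ((h (x + X n *\<^sub>R b) - h x) / X n) \<le> indicator K x *\<^sub>R M"
      proof (cases "x \<in> K")
        case True
        then show ?thesis
          using lip[of x "X n"] X[of n] by (simp add: abs_divide pos_divide_le_eq)
      next
        case False
        have "norm (X n *\<^sub>R b) \<le> 1 * norm b"
          unfolding norm_scaleR by (intro mult_right_mono X) auto
        then have "norm (x + X n *\<^sub>R b) \<ge> \<rho>" "norm x \<ge> \<rho>"
          using False norm_triangle_ineq4[of "x + X n *\<^sub>R b" "X n *\<^sub>R b"] norm_ge_zero[of b]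
          by (auto simp: K_def simp del: norm_ge_zero)
        then show ?thesis
          using supp(1) M(1) by (simp add: indicator_def)
      qed
    qed
  qed measurable
  moreover have "(LINT x|lborel. (h (x + X n *\<^sub>R b) - h x) / X n) = 0" for n
    using int integrable_lborel_translate[OF int, of "X n *\<^sub>R b"] integral_lborel_translate[of h "X n *\<^sub>R b"]
    by simp
  ultimately have "(\<lambda>n::nat. 0) \<longlonglongrightarrow> (LINT x|lborel. h' x)"
    by (simp only:)
  then show ?thesis
    by (simp add: LIMSEQ_const_iff)
qed

lemma ennreal_tendsto_0_of_square:
  assumes "((\<lambda>x. (f x)\<^sup>2) \<longlongrightarrow> (0::ennreal)) F"
  shows "(f \<longlongrightarrow> 0) F"
  unfolding ennreal_tendsto_0_iff
proof (intro allI impI)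
  fix e :: real assume "e > 0"
  then have "\<forall>\<^sub>F x in F. (f x)\<^sup>2 \<le> ennreal (e\<^sup>2)"
    using assms by (simp add: ennreal_tendsto_0_iff)
  then show "\<forall>\<^sub>F x in F. f x \<le> ennreal e"
  proof eventually_elim
    case (elim x)
    show ?case
    proof (cases "f x")
      case (real a)
      then have "a\<^sup>2 \<le> e\<^sup>2"
        using elim by (simp add: ennreal_power)
      then have "a \<le> e"
        by (rule power2_le_imp_le) (use \<open>e > 0\<close> in simp)
      then show ?thesis
        unfolding real(2) by (rule ennreal_leI)
    next
      case top
      then have "(f x)\<^sup>2 = top"
        by (simp add: power2_eq_square)
      then show ?thesis
        using elim by (simp add: top_unique)
    qed
  qed
qed

lemma nn_integral_norm_mult_le:
  fixes f g :: "'a \<Rightarrow> 'b::euclidean_space"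
  assumes [measurable]: "f \<in> borel_measurable M" "g \<in> borel_measurable M"
  shows "(\<integral>\<^sup>+x. ennreal (norm (f x) * norm (g x)) \<partial>M)\<^sup>2 \<le> sq_norm M f * sq_norm M g"
proof -
  have "(\<integral>\<^sup>+x. ennreal (norm (f x) * norm (g x)) \<partial>M)\<^sup>2 = (\<integral>\<^sup>+x. ennreal (norm (f x)) * ennreal (norm (g x)) \<partial>M)\<^sup>2"
    by (simp add: ennreal_mult)
  also have "\<dots> \<le> (\<integral>\<^sup>+x. (ennreal (norm (f x)))\<^sup>2 \<partial>M) * (\<integral>\<^sup>+x. (ennreal (norm (g x)))\<^sup>2 \<partial>M)"
    by (rule Cauchy_Schwarz_nn_integral) measurable
  also have "\<dots> = sq_norm M f * sq_norm M g"
    by (simp add: sq_norm_def ennreal_power)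
  finally show ?thesis .
qed

lemma integrable_weighted_inner:
  fixes f g :: "'a \<Rightarrow> 'b::euclidean_space"
  assumes [measurable]: "f \<in> borel_measurable M" "g \<in> borel_measurable M" "B \<in> borel_measurable M"
    and fin: "sq_norm M f < \<infinity>" "sq_norm M g < \<infinity>" and K: "\<And>x. \<bar>B x\<bar> \<le> K"
  shows "integrable M (\<lambda>x. B x * (f x \<bullet> g x))"
proof (rule Bochner_Integration.integrable_bound)
  have "(\<integral>\<^sup>+x. ennreal (norm (f x) * norm (g x)) \<partial>M)\<^sup>2 < \<infinity>"
    using nn_integral_norm_mult_le[OF assms(1,2)] fin by (auto simp: ennreal_mult_less_top order_le_less_trans)
  then have "(\<integral>\<^sup>+x. ennreal (norm (f x) * norm (g x)) \<partial>M) < \<infinity>"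
    by (auto simp: power_less_top_ennreal)
  then show "integrable M (\<lambda>x. K * (norm (f x) * norm (g x)))"
    by (intro integrable_mult_right) (simp add: integrable_iff_bounded abs_mult)
  show "(\<lambda>x. B x * (f x \<bullet> g x)) \<in> borel_measurable M"
    by measurable
  show "AE x in M. norm (B x * (f x \<bullet> g x)) \<le> norm (K * (norm (f x) * norm (g x)))"
  proof (rule AE_I2)
    fix x
    have "\<bar>B x\<bar> * \<bar>f x \<bullet> g x\<bar> \<le> K * (norm (f x) * norm (g x))"
      by (intro mult_mono K Cauchy_Schwarz_ineq2) (use K[of x] in auto)
    then show "norm (B x * (f x \<bullet> g x)) \<le> norm (K * (norm (f x) * norm (g x)))"
      using K[of x] by (simp add: abs_mult)
  qed
qed

text \<open>The difference of the inner products is the sum of three inner products that contain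
  \<open>f' - f\<close> or \<open>g' - g\<close>, each of which Cauchy--Schwarz controls.\<close>

lemma tendsto_integral_weighted_inner:
  fixes f g :: "'a \<Rightarrow> 'b::euclidean_space"
  assumes meas [measurable]: "f \<in> borel_measurable M" "g \<in> borel_measurable M" "B \<in> borel_measurable M"
      "\<And>r. f' r \<in> borel_measurable M" "\<And>r. g' r \<in> borel_measurable M"
    and fin: "sq_norm M f < \<infinity>" "sq_norm M g < \<infinity>" and K: "\<And>x. \<bar>B x\<bar> \<le> K"
    and f': "((\<lambda>r. sq_norm M (\<lambda>x. f' r x - f x)) \<longlongrightarrow> 0) F"
    and g': "((\<lambda>r. sq_norm M (\<lambda>x. g' r x - g x)) \<longlongrightarrow> 0) F"
  shows "((\<lambda>r. LINT x|M. B x * (f' r x \<bullet> g' r x)) \<longlongrightarrow> (LINT x|M. B x * (f x \<bullet> g x))) F"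
proof -
  define P where "P u v = (\<integral>\<^sup>+x. ennreal (norm (u x) * norm (v x)) \<partial>M)" for u v :: "'a \<Rightarrow> 'b"
  define df dg where "df r = (\<lambda>x. f' r x - f x)" and "dg r = (\<lambda>x. g' r x - g x)" for r
  have [measurable]: "df r \<in> borel_measurable M" "dg r \<in> borel_measurable M" for r
    unfolding df_def dg_def by measurable
  have K0: "K \<ge> 0"
    using K[of undefined] by linarith
  have P: "((\<lambda>r. P (df r) (dg r)) \<longlongrightarrow> 0) F" "((\<lambda>r. P (df r) g) \<longlongrightarrow> 0) F" "((\<lambda>r. P f (dg r)) \<longlongrightarrow> 0) F"
  proof -
    have lim: "((\<lambda>r. P (u r) (v r)) \<longlongrightarrow> 0) F"
      if [measurable]: "\<And>r. u r \<in> borel_measurable M" "\<And>r. v r \<in> borel_measurable M"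
        and "((\<lambda>r. sq_norm M (u r) * sq_norm M (v r)) \<longlongrightarrow> 0) F" for u v
    proof (rule ennreal_tendsto_0_of_square, rule tendsto_sandwich[OF _ _ tendsto_const that(3)])
      show "\<forall>\<^sub>F r in F. (P (u r) (v r))\<^sup>2 \<le> sq_norm M (u r) * sq_norm M (v r)"
        unfolding P_def by (intro always_eventually allI nn_integral_norm_mult_le) measurable
    qed auto
    note f'' = f'[folded df_def] and g'' = g'[folded dg_def]
    have fg: "((\<lambda>r. sq_norm M f * sq_norm M (dg r)) \<longlongrightarrow> 0) F" "((\<lambda>r. sq_norm M g * sq_norm M (df r)) \<longlongrightarrow> 0) F"
      using ennreal_tendsto_cmult[OF _ g'', of "sq_norm M f"] ennreal_tendsto_cmult[OF _ f'', of "sq_norm M g"] fin by auto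
    show "((\<lambda>r. P f (dg r)) \<longlongrightarrow> 0) F" "((\<lambda>r. P (df r) g) \<longlongrightarrow> 0) F"
      using fg by (auto intro!: lim simp: mult.commute)
    show "((\<lambda>r. P (df r) (dg r)) \<longlongrightarrow> 0) F"
    proof (rule lim)
      have "\<forall>\<^sub>F r in F. sq_norm M (dg r) \<le> ennreal 1"
        using g'' by (simp add: ennreal_tendsto_0_iff del: ennreal_1)
      then have "\<forall>\<^sub>F r in F. sq_norm M (df r) * sq_norm M (dg r) \<le> sq_norm M (df r)"
        by eventually_elim (use mult_left_mono in fastforce)
      from tendsto_sandwich[OF _ this tendsto_const f'']
      show "((\<lambda>r. sq_norm M (df r) * sq_norm M (dg r)) \<longlongrightarrow> 0) F"
        by auto
    qed measurable
  qed
  have "((\<lambda>r. P (df r) (dg r) + (P (df r) g + P f (dg r))) \<longlongrightarrow> 0 + (0 + 0)) F"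
    by (intro tendsto_add P)
  then have "((\<lambda>r. ennreal K * (P (df r) (dg r) + (P (df r) g + P f (dg r)))) \<longlongrightarrow> 0) F"
    using ennreal_tendsto_cmult[of "ennreal K" _ 0] by simp
  then have tot: "((\<lambda>r. ennreal K * (P (df r) (dg r) + (P (df r) g + P f (dg r)))) \<longlongrightarrow> ennreal 0) F"
    by simp
  have intB: "integrable M (\<lambda>x. B x * (f x \<bullet> g x))"
    by (rule integrable_weighted_inner[OF meas(1,2,3) fin K])
  have dbound: "\<forall>\<^sub>F r in F. ennreal (norm ((LINT x|M. B x * (f' r x \<bullet> g' r x)) - (LINT x|M. B x * (f x \<bullet> g x))))
      \<le> ennreal K * (P (df r) (dg r) + (P (df r) g + P f (dg r)))"
  proof -
    have "\<forall>\<^sub>F r in F. sq_norm M (df r) \<le> ennreal 1" "\<forall>\<^sub>F r in F. sq_norm M (dg r) \<le> ennreal 1"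
      using f' g' by (simp_all add: ennreal_tendsto_0_iff df_def dg_def del: ennreal_1)
    then show ?thesis
    proof eventually_elim
      case (elim r)
      have "sq_norm M (f' r) \<le> 2 * sq_norm M (df r) + 2 * sq_norm M f" "sq_norm M (g' r) \<le> 2 * sq_norm M (dg r) + 2 * sq_norm M g"
        using sq_norm_add[of "df r" M f] sq_norm_add[of "dg r" M g] by (simp_all add: df_def dg_def)
      moreover have "2 * sq_norm M (df r) + 2 * sq_norm M f < \<infinity>" "2 * sq_norm M (dg r) + 2 * sq_norm M g < \<infinity>"
        using fin elim by (auto simp: ennreal_mult_less_top order_le_less_trans)
      ultimately have fin': "sq_norm M (f' r) < \<infinity>" "sq_norm M (g' r) < \<infinity>"
        by (meson order_le_less_trans)+
      have int': "integrable M (\<lambda>x. B x * (f' r x \<bullet> g' r x))"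
        by (rule integrable_weighted_inner[OF meas(4,5,3) fin' K])
      have "(LINT x|M. B x * (f' r x \<bullet> g' r x)) - (LINT x|M. B x * (f x \<bullet> g x))
          = (LINT x|M. B x * (f' r x \<bullet> g' r x) - B x * (f x \<bullet> g x))"
        using int' intB by simp
      also have "ennreal (norm \<dots>) \<le> (\<integral>\<^sup>+x. ennreal (norm (B x * (f' r x \<bullet> g' r x) - B x * (f x \<bullet> g x))) \<partial>M)"
        using int' intB by (intro integral_norm_bound_ennreal) auto
      also have "\<dots> \<le> (\<integral>\<^sup>+x. ennreal K * (ennreal (norm (df r x) * norm (dg r x)) +
          (ennreal (norm (df r x) * norm (g x)) + ennreal (norm (f x) * norm (dg r x)))) \<partial>M)"
      proof (intro nn_integral_mono)
        fix x
        have "B x * (f' r x \<bullet> g' r x) - B x * (f x \<bullet> g x) = B x * (df r x \<bullet> dg r x + (df r x \<bullet> g x + f x \<bullet> dg r x))"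
          by (simp add: df_def dg_def inner_diff_left inner_diff_right algebra_simps)
        also have "norm \<dots> \<le> K * (norm (df r x) * norm (dg r x) + (norm (df r x) * norm (g x) + norm (f x) * norm (dg r x)))"
          unfolding real_norm_def abs_mult
          by (intro mult_mono K order_trans[OF abs_triangle_ineq] add_mono Cauchy_Schwarz_ineq2) (use K0 in auto)
        finally have "norm (B x * (f' r x \<bullet> g' r x) - B x * (f x \<bullet> g x))
          \<le> K * (norm (df r x) * norm (dg r x) + (norm (df r x) * norm (g x) + norm (f x) * norm (dg r x)))" .
        then show "ennreal (norm (B x * (f' r x \<bullet> g' r x) - B x * (f x \<bullet> g x))) \<le> ennreal K * (ennreal (norm (df r x) * norm (dg r x)) +
          (ennreal (norm (df r x) * norm (g x)) + ennreal (norm (f x) * norm (dg r x))))"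
          using K0 by (simp add: ennreal_leI flip: ennreal_plus ennreal_mult)
      qed
      also have "\<dots> = ennreal K * (P (df r) (dg r) + (P (df r) g + P f (dg r)))"
        unfolding P_def by (simp add: nn_integral_cmult nn_integral_add)
      finally show ?case .
    qed
  qed
  have "((\<lambda>r. ennreal (norm ((LINT x|M. B x * (f' r x \<bullet> g' r x)) - (LINT x|M. B x * (f x \<bullet> g x))))) \<longlongrightarrow> ennreal 0) F"
    by (rule tendsto_sandwich[OF _ dbound _ tot]) auto
  then have "((\<lambda>r. norm ((LINT x|M. B x * (f' r x \<bullet> g' r x)) - (LINT x|M. B x * (f x \<bullet> g x)))) \<longlongrightarrow> 0) F"
    by (subst (asm) tendsto_ennreal_iff) auto
  then show ?thesis
    by (simp add: tendsto_rabs_zero_iff LIM_zero_iff)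
qed

text \<open>For the mollified functions the identity says that the integral of the derivative of
  \<open>A * (v \<bullet> v)\<close> vanishes; it survives the passage to the limit in \<open>L\<^sup>2\<close>.\<close>

lemma weak_energy_identity:
  fixes v w :: "'a::euclidean_space \<Rightarrow> 'b::euclidean_space" and A A' :: "'a \<Rightarrow> real"
  assumes v: "integrable lborel v" "sq_norm lborel v < \<infinity>" and w: "integrable lborel w" "sq_norm lborel w < \<infinity>"
    and supp: "\<And>x. norm x \<ge> R \<Longrightarrow> v x = 0" "\<And>x. norm x \<ge> R \<Longrightarrow> w x = 0"
    and weak: "weak_dderiv b v w"
    and A: "continuous_on UNIV A" "continuous_on UNIV A'"
      "\<And>x s. ((\<lambda>s. A (x + s *\<^sub>R b)) has_real_derivative A' (x + s *\<^sub>R b)) (at s)"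
  shows "(LINT x|lborel. A' x * (v x \<bullet> v x)) = - 2 * (LINT x|lborel. A x * (v x \<bullet> w x))"
proof -
  have [measurable]: "v \<in> borel_measurable borel" "w \<in> borel_measurable borel"
    using v(1) w(1) by (auto dest: borel_measurable_integrable)
  have [measurable]: "A \<in> borel_measurable borel" "A' \<in> borel_measurable borel"
    using A(1,2) by (auto intro: borel_measurable_continuous_onI)
  define S where "S = cball (0::'a) (R + 1)"
  have [measurable]: "S \<in> sets borel"
    by (simp add: S_def)
  \<comment> \<open>bounded coefficients that agree with \<open>A\<close> and \<open>A'\<close> on all supports of mollifications with \<open>r < 1\<close>\<close>
  define B B' where "B x = indicator S x * A x" and "B' x = indicator S x * A' x" for x
  have "\<exists>K. \<forall>x. \<bar>indicator S x * C x\<bar> \<le> K" if C: "continuous_on UNIV C" for C :: "'a \<Rightarrow> real"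
  proof -
    obtain K where "K > 0" "\<And>x. norm x \<le> R + 1 \<Longrightarrow> \<bar>C x\<bar> \<le> K"
      using continuous_bounded_on_cball[OF C] by blast
    then show ?thesis
      by (intro exI[of _ K]) (auto simp: indicator_def S_def)
  qed
  then obtain K K' where K: "\<And>x. \<bar>B x\<bar> \<le> K" "\<And>x. \<bar>B' x\<bar> \<le> K'"
    unfolding B_def B'_def using A(1,2) by metis
  have [measurable]: "B \<in> borel_measurable borel" "B' \<in> borel_measurable borel"
    unfolding B_def[abs_def] B'_def[abs_def] by measurable
  have smooth: "(LINT x|lborel. B' x * (moll r v x \<bullet> moll r v x)) + 2 * (LINT x|lborel. B x * (moll r v x \<bullet> moll r w x)) = 0"
    if r: "0 < r" "r < 1" for r
  proof -
    note cont = continuous_moll[OF r(1) v(1)] continuous_moll[OF r(1) w(1)]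
    have out: "moll r v x = 0" "moll r w x = 0" if "norm x \<ge> R + 1" for x
      using that r by (auto intro!: moll_zero_outside[where R=R] supp)
    have eq1: "B' x * (moll r v x \<bullet> moll r v x) = A' x * (moll r v x \<bullet> moll r v x)"
      "B x * (moll r v x \<bullet> moll r w x) = A x * (moll r v x \<bullet> moll r w x)" for x
      using out[of x] by (auto simp: B_def B'_def S_def indicator_def)
    have int: "integrable lborel (\<lambda>x. A' x * (moll r v x \<bullet> moll r v x))" "integrable lborel (\<lambda>x. A x * (moll r v x \<bullet> moll r w x))"
      by (rule integrable_compact_support[of _ "R + 1"], intro continuous_intros cont A, simp add: out)+
    have "(LINT x|lborel. A' x * (moll r v x \<bullet> moll r v x) + 2 * (A x * (moll r v x \<bullet> moll r w x))) = 0"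
    proof (rule integral_directional_derivative_eq_0[where h="\<lambda>x. A x * (moll r v x \<bullet> moll r v x)" and b=b and \<rho>="R + 1"])
      fix x s
      have d: "((\<lambda>s. moll r v (x + s *\<^sub>R b)) has_vector_derivative moll r w (x + s *\<^sub>R b)) (at s)"
        using moll_has_vector_derivative[OF r(1) v(1) _ weak] by simp
      show "((\<lambda>s. A (x + s *\<^sub>R b) * (moll r v (x + s *\<^sub>R b) \<bullet> moll r v (x + s *\<^sub>R b))) has_real_derivative
          A' (x + s *\<^sub>R b) * (moll r v (x + s *\<^sub>R b) \<bullet> moll r v (x + s *\<^sub>R b)) + 2 * (A (x + s *\<^sub>R b) * (moll r v (x + s *\<^sub>R b) \<bullet> moll r w (x + s *\<^sub>R b)))) (at s)"
        using DERIV_mult[OF A(3)[of x s] bounded_bilinear.has_vector_derivative[OF bounded_bilinear_inner d d,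
            folded has_real_derivative_iff_has_vector_derivative]]
        by (rule DERIV_cong) (simp add: inner_commute algebra_simps)
    qed (auto intro!: continuous_intros cont A simp: out)
    then show ?thesis
      using int by (simp add: eq1)
  qed
  have "((\<lambda>r. (LINT x|lborel. B' x * (moll r v x \<bullet> moll r v x)) + 2 * (LINT x|lborel. B x * (moll r v x \<bullet> moll r w x))) \<longlongrightarrow>
      (LINT x|lborel. B' x * (v x \<bullet> v x)) + 2 * (LINT x|lborel. B x * (v x \<bullet> w x))) (at_right 0)"
    by (intro tendsto_add tendsto_mult tendsto_const tendsto_integral_weighted_inner[where K=K] tendsto_integral_weighted_inner[where K=K'])
       (use K v w in \<open>auto intro!: moll_tendsto\<close>)
  moreover have "\<forall>\<^sub>F r in at_right 0. (LINT x|lborel. B' x * (moll r v x \<bullet> moll r v x)) + 2 * (LINT x|lborel. B x * (moll r v x \<bullet> moll r w x)) = 0"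
    unfolding eventually_at_right_field using smooth by (intro exI[of _ 1]) auto
  then have "((\<lambda>r. (LINT x|lborel. B' x * (moll r v x \<bullet> moll r v x)) + 2 * (LINT x|lborel. B x * (moll r v x \<bullet> moll r w x))) \<longlongrightarrow> 0) (at_right 0)"
    by (rule tendsto_eventually)
  ultimately have "(LINT x|lborel. B' x * (v x \<bullet> v x)) + 2 * (LINT x|lborel. B x * (v x \<bullet> w x)) = 0"
    using tendsto_unique[of "at_right (0::real)"] by auto
  moreover have "B' x * (v x \<bullet> v x) = A' x * (v x \<bullet> v x)" "B x * (v x \<bullet> w x) = A x * (v x \<bullet> w x)" for x
    using supp[of x] by (auto simp: B_def B'_def S_def indicator_def)
  ultimately show ?thesis
    by simp
qed

section \<open>Completeness and total boundedness in the weighted space\<close>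

text \<open>Riesz--Fischer: along a rapidly converging subsequence the increments are absolutely summable
  almost everywhere, and the lemma of Fatou shows that the pointwise limit is the limit in
  \<open>L\<^sup>2\<close>.\<close>

lemma sq_norm_complete:
  fixes f :: "nat \<Rightarrow> 'a \<Rightarrow> 'b::euclidean_space"
  assumes [measurable]: "\<And>n. f n \<in> borel_measurable M"
    and cauchy: "\<And>e. e > 0 \<Longrightarrow> \<exists>N. \<forall>m\<ge>N. \<forall>n\<ge>N. sq_norm M (\<lambda>x. f m x - f n x) \<le> ennreal e"
  shows "\<exists>g\<in>borel_measurable M. \<forall>e>0. \<exists>N. \<forall>n\<ge>N. sq_norm M (\<lambda>x. f n x - g x) \<le> ennreal e"
proof -
  have "\<exists>N. \<forall>m\<ge>N. \<forall>n\<ge>N. sq_norm M (\<lambda>x. f m x - f n x) \<le> ennreal ((1/4) ^ i)" for i :: nat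
    by (rule cauchy) simp
  then obtain N where N: "sq_norm M (\<lambda>x. f m x - f n x) \<le> ennreal ((1/4) ^ i)" if "m \<ge> N i" "n \<ge> N i" for i m n
    by metis
  \<comment> \<open>monotone, beyond \<open>N i\<close>, and unbounded\<close>
  define k where "k i = (\<Sum>j\<le>i. N j) + i" for i
  have kN: "N i \<le> k i" for i
    using member_le_sum[of i "{..i}" N] by (simp add: k_def)
  have k_mono: "k i \<le> k (Suc i)" and k_ge: "i \<le> k i" for i
    by (simp_all add: k_def)
  define h where "h i x = f (k (Suc i)) x - f (k i) x" for i x
  have [measurable]: "h i \<in> borel_measurable M" for i
    unfolding h_def[abs_def] by measurable
  have h: "sq_norm M (h i) \<le> ennreal ((1/4) ^ i)" for i
    unfolding h_def using kN k_mono order_trans by (intro N) blast+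
  have "(\<integral>\<^sup>+x. (\<Sum>i. ennreal (2 ^ i * (norm (h i x))\<^sup>2)) \<partial>M) = (\<Sum>i. \<integral>\<^sup>+x. ennreal (2 ^ i * (norm (h i x))\<^sup>2) \<partial>M)"
    by (rule nn_integral_suminf) measurable
  also have "\<dots> = (\<Sum>i. ennreal (2 ^ i) * sq_norm M (h i))"
    unfolding sq_norm_def by (simp add: ennreal_mult nn_integral_cmult)
  also have "\<dots> \<le> (\<Sum>i. ennreal (2 ^ i) * ennreal ((1/4) ^ i))"
    by (intro suminf_le mult_left_mono h) auto
  also have "\<dots> = (\<Sum>i. ennreal ((1/2) ^ i))"
    by (simp add: ennreal_mult[symmetric] power_mult_distrib[symmetric])
  finally have le: "(\<integral>\<^sup>+x. (\<Sum>i. ennreal (2 ^ i * (norm (h i x))\<^sup>2)) \<partial>M) \<le> (\<Sum>i. ennreal ((1/2) ^ i))" .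
  have "(\<Sum>i. ennreal ((1/2) ^ i)) \<noteq> top"
    by (rule ennreal_suminf_neq_top) (auto intro: summable_geometric)
  with le have "(\<integral>\<^sup>+x. (\<Sum>i. ennreal (2 ^ i * (norm (h i x))\<^sup>2)) \<partial>M) \<noteq> \<infinity>"
    by (metis infinity_ennreal_def top_unique)
  then have "AE x in M. (\<Sum>i. ennreal (2 ^ i * (norm (h i x))\<^sup>2)) \<noteq> \<infinity>"
    by (intro nn_integral_noteq_infinite) auto
  then have conv: "AE x in M. convergent (\<lambda>i. f (k i) x)"
  proof eventually_elim
    case (elim x)
    then have s: "summable (\<lambda>i. 2 ^ i * (norm (h i x))\<^sup>2)"
      by (intro summable_suminf_not_top) auto
    have "summable (\<lambda>i. norm (h i x))"
    proof (rule summable_comparison_test'[where N=0])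
      show "summable (\<lambda>i. 2 ^ i * (norm (h i x))\<^sup>2 + (1/2) ^ i)"
        using s by (intro summable_add summable_geometric) auto
      fix i :: nat
      \<comment> \<open>\<open>y \<le> y\<^sup>2 + 1\<close> for \<open>y = 2 ^ i * norm (h i x)\<close>\<close>
      have "0 \<le> (2 ^ i * norm (h i x) - 1)\<^sup>2 + (2 ^ i * norm (h i x))\<^sup>2 + 1"
        by simp
      then have "2 ^ i * norm (h i x) \<le> (2 ^ i * norm (h i x))\<^sup>2 + 1"
        by (simp add: power2_diff)
      then have "norm (h i x) \<le> ((2 ^ i * norm (h i x))\<^sup>2 + 1) / 2 ^ i"
        by (simp add: field_simps)
      also have "\<dots> = 2 ^ i * (norm (h i x))\<^sup>2 + (1/2) ^ i"
        by (simp add: field_simps power2_eq_square)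
      finally show "norm (norm (h i x)) \<le> 2 ^ i * (norm (h i x))\<^sup>2 + (1/2) ^ i"
        by simp
    qed
    then have "summable (\<lambda>i. f (k (Suc i)) x - f (k i) x)"
      unfolding h_def by (rule summable_norm_cancel)
    then have "convergent (\<lambda>n. \<Sum>i<n. f (k (Suc i)) x - f (k i) x)"
      by (simp add: summable_iff_convergent)
    then have "convergent (\<lambda>n. (f (k n) x - f (k 0) x) + f (k 0) x)"
      unfolding sum_lessThan_telescope[of "\<lambda>i. f (k i) x"] by (intro convergent_add convergent_const)
    then show ?case
      by simp
  qed
  define g where "g x = lim (\<lambda>i. f (k i) x)" for x
  have [measurable]: "g \<in> borel_measurable M"
    unfolding g_def[abs_def] by measurable
  show ?thesis
  proof (intro bexI[of _ g] allI impI)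
    fix e :: real assume "e > 0"
    then obtain N where N: "sq_norm M (\<lambda>x. f m x - f n x) \<le> ennreal e" if "m \<ge> N" "n \<ge> N" for m n
      using cauchy by blast
    have "sq_norm M (\<lambda>x. f n x - g x) \<le> ennreal e" if n: "n \<ge> N" for n
    proof -
      have "sq_norm M (\<lambda>x. f n x - g x) = (\<integral>\<^sup>+x. liminf (\<lambda>i. ennreal ((norm (f n x - f (k i) x))\<^sup>2)) \<partial>M)"
        unfolding sq_norm_def
      proof (rule nn_integral_cong_AE, use conv in eventually_elim)
        case (elim x)
        then have "(\<lambda>i. f (k i) x) \<longlonglongrightarrow> g x"
          by (simp add: convergent_LIMSEQ_iff g_def)
        then have "(\<lambda>i. ennreal ((norm (f n x - f (k i) x))\<^sup>2)) \<longlonglongrightarrow> ennreal ((norm (f n x - g x))\<^sup>2)"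
          by (intro tendsto_intros)
        then show ?case
          by (intro lim_imp_Liminf[symmetric]) auto
      qed
      also have "\<dots> \<le> liminf (\<lambda>i. sq_norm M (\<lambda>x. f n x - f (k i) x))"
        unfolding sq_norm_def by (intro nn_integral_liminf) measurable
      also have "\<dots> \<le> ennreal e"
      proof (rule Liminf_le)
        show "\<forall>\<^sub>F i in sequentially. sq_norm M (\<lambda>x. f n x - f (k i) x) \<le> ennreal e"
          using eventually_ge_at_top[of N]
        proof eventually_elim
          case (elim i)
          then show ?case
            using n k_ge[of i] by (intro N) auto
        qed
      qed simp
      finally show ?thesis .
    qed
    then show "\<exists>N. \<forall>n\<ge>N. sq_norm M (\<lambda>x. f n x - g x) \<le> ennreal e"
      by blast
  qed measurable
qed

text \<open>Otherwise there is an infinite sequence whose members keep a positive distance from each other.\<close>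

lemma (in Metric_space) mtotally_boundedI_close_pairs:
  assumes "S \<subseteq> M"
    and close: "\<And>\<sigma> e. range \<sigma> \<subseteq> S \<Longrightarrow> e > 0 \<Longrightarrow> \<exists>i j. i < j \<and> d (\<sigma> i) (\<sigma> (j::nat)) < e"
  shows "mtotally_bounded S"
proof (rule ccontr)
  assume "\<not> mtotally_bounded S"
  then obtain e where "e > 0" and e: "\<And>K. finite K \<Longrightarrow> K \<subseteq> S \<Longrightarrow> \<not> S \<subseteq> (\<Union>x\<in>K. mball x e)"
    unfolding mtotally_bounded_def by meson
  have "\<exists>\<sigma>. \<forall>n::nat. \<sigma> n \<in> S \<and> (\<forall>i<n. \<not> d (\<sigma> i) (\<sigma> n) < e)"
  proof (rule dependent_wellorder_choice)
    fix n :: nat and \<sigma> :: "nat \<Rightarrow> 'a"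
    assume IH: "\<And>y. y < n \<Longrightarrow> \<sigma> y \<in> S \<and> (\<forall>i<y. \<not> d (\<sigma> i) (\<sigma> y) < e)"
    then have "\<not> S \<subseteq> (\<Union>x\<in>\<sigma> ` {..<n}. mball x e)"
      by (intro e) auto
    then obtain s where "s \<in> S" "s \<notin> (\<Union>x\<in>\<sigma> ` {..<n}. mball x e)"
      by blast
    then have s: "s \<in> S" "\<And>i. i < n \<Longrightarrow> s \<notin> mball (\<sigma> i) e"
      by blast+
    have "\<not> d (\<sigma> i) s < e" if "i < n" for i
      using s(2)[OF that] s(1) IH[OF that] assms(1) by (auto simp: in_mball)
    then show "\<exists>r. r \<in> S \<and> (\<forall>i<n. \<not> d (\<sigma> i) r < e)"
      using s(1) by blast
  qed auto
  then obtain \<sigma> where \<sigma>: "\<And>n::nat. \<sigma> n \<in> S" "\<And>i n. i < n \<Longrightarrow> \<not> d (\<sigma> i) (\<sigma> n) < e"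
    by blast
  then have "range \<sigma> \<subseteq> S"
    by blast
  from close[OF this \<open>e > 0\<close>] \<sigma>(2) show False
    by blast
qed

text \<open>Multiplication by \<open>exp (- \<phi> / 2)\<close> maps the weighted space isometrically onto the unweighted
  one, so that \<open>sq_norm\<close> of the result is the weighted square norm.\<close>

definition half_weight :: "('a \<Rightarrow> real) \<Rightarrow> ('a \<Rightarrow> complex) \<Rightarrow> 'a \<Rightarrow> complex" where
  "half_weight \<phi> h z = exp (- \<phi> z / 2) *\<^sub>R h z"

lemma norm_half_weight_sq: "(cmod (half_weight \<phi> h z))\<^sup>2 = (cmod (h z))\<^sup>2 * exp (- \<phi> z)"
  by (simp add: half_weight_def power_mult_distrib flip: exp_of_nat_mult)

lemma half_weight_diff: "half_weight \<phi> (\<lambda>z. f z - g z) = (\<lambda>z. half_weight \<phi> f z - half_weight \<phi> g z)"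
  by (simp add: half_weight_def fun_eq_iff scaleR_diff_right)

context
  fixes \<phi> :: "complex^'n \<Rightarrow> real"
  assumes \<phi>: "continuous_on UNIV \<phi>"
begin

lemma weight_measurable [measurable]: "\<phi> \<in> borel_measurable borel" "\<phi> \<in> borel_measurable lebesgue"
proof -
  show "\<phi> \<in> borel_measurable borel"
    using \<phi> by (rule borel_measurable_continuous_onI)
  then show "\<phi> \<in> borel_measurable lebesgue"
    by (intro measurable_completion) simp
qed

lemma half_weight_measurable:
  "h \<in> borel_measurable lebesgue \<Longrightarrow> half_weight \<phi> h \<in> borel_measurable lebesgue"
  unfolding half_weight_def[abs_def] by measurable

lemma L2_fun_iff: "h \<in> L2_fun \<phi> \<longleftrightarrow> h \<in> borel_measurable lebesgue \<and> sq_norm lebesgue (half_weight \<phi> h) < \<infinity>"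
proof -
  have "integrable lebesgue (\<lambda>z. (cmod (h z))\<^sup>2 * exp (- \<phi> z)) \<longleftrightarrow> sq_norm lebesgue (half_weight \<phi> h) < \<infinity>"
    if [measurable]: "h \<in> borel_measurable lebesgue"
    unfolding integrable_iff_bounded sq_norm_def norm_half_weight_sq by (auto simp: abs_mult)
  then show ?thesis
    by (auto simp: L2_fun_def)
qed

lemma L2_norm_sq:
  assumes "h \<in> L2_fun \<phi>"
  shows "ennreal ((L2_norm \<phi> h)\<^sup>2) = sq_norm lebesgue (half_weight \<phi> h)"
proof -
  have "0 \<le> (LINT z|lebesgue. (cmod (h z))\<^sup>2 * exp (- \<phi> z))"
    by (intro Bochner_Integration.integral_nonneg) auto
  then show ?thesis
    using assms unfolding sq_norm_def norm_half_weight_sq L2_norm_def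
    by (subst nn_integral_eq_integral) (auto simp: L2_fun_def)
qed

lemma L2_space_representative: "F \<in> L2_space \<phi> \<Longrightarrow> \<exists>f\<in>L2_fun \<phi>. F = ae_rel \<phi> `` {f}"
  by (auto simp: L2_space_def elim: quotientE)

lemma mcomplete_L2: "Metric_space.mcomplete (L2_space \<phi>) (L2_dist \<phi>)"
proof -
  interpret Metric_space "L2_space \<phi>" "L2_dist \<phi>"
    by (rule Metric_space_L2[OF \<phi>])
  show ?thesis
    unfolding mcomplete_def
  proof (intro allI impI)
    fix \<sigma> assume \<sigma>: "MCauchy \<sigma>"
    then have "\<sigma> n \<in> L2_space \<phi>" for n
      by (auto simp: MCauchy_def)
    then have "\<forall>n. \<exists>f\<in>L2_fun \<phi>. \<sigma> n = ae_rel \<phi> `` {f}"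
      using L2_space_representative by simp
    then obtain f where f: "\<And>n. f n \<in> L2_fun \<phi>" "\<And>n. \<sigma> n = ae_rel \<phi> `` {f n}"
      by metis
    have dist: "ennreal ((L2_dist \<phi> (\<sigma> m) (\<sigma> n))\<^sup>2) = sq_norm lebesgue (\<lambda>z. half_weight \<phi> (f m) z - half_weight \<phi> (f n) z)" for m n
      unfolding f(2) L2_dist_class[OF f(1) f(1)] half_weight_diff[symmetric]
      by (rule L2_norm_sq[OF L2_fun_diff[OF \<phi> f(1) f(1)]])
    have meas: "f n \<in> borel_measurable lebesgue" for n
      using f(1) by (auto simp: L2_fun_def)
    have "\<exists>g\<in>borel_measurable lebesgue. \<forall>e>0. \<exists>N. \<forall>n\<ge>N. sq_norm lebesgue (\<lambda>z. half_weight \<phi> (f n) z - g z) \<le> ennreal e"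
    proof (rule sq_norm_complete[OF half_weight_measurable[OF meas]])
      fix e :: real assume "e > 0"
      then obtain N where N: "\<And>m n. m \<ge> N \<Longrightarrow> n \<ge> N \<Longrightarrow> L2_dist \<phi> (\<sigma> m) (\<sigma> n) < sqrt e"
        using \<sigma> unfolding MCauchy_def by (meson real_sqrt_gt_zero)
      have "sq_norm lebesgue (\<lambda>z. half_weight \<phi> (f m) z - half_weight \<phi> (f n) z) \<le> ennreal e" if "m \<ge> N" "n \<ge> N" for m n
      proof -
        have "(L2_dist \<phi> (\<sigma> m) (\<sigma> n))\<^sup>2 \<le> (sqrt e)\<^sup>2"
          using N[OF that] by (intro power_mono) auto
        then show ?thesis
          using \<open>e > 0\<close> by (simp add: dist[symmetric] ennreal_leI)
      qed
      then show "\<exists>N. \<forall>m\<ge>N. \<forall>n\<ge>N. sq_norm lebesgue (\<lambda>z. half_weight \<phi> (f m) z - half_weight \<phi> (f n) z) \<le> ennreal e"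
        by blast
    qed
    then obtain u where [measurable]: "u \<in> borel_measurable lebesgue"
      and u: "\<And>e. e > 0 \<Longrightarrow> \<exists>N. \<forall>n\<ge>N. sq_norm lebesgue (\<lambda>z. half_weight \<phi> (f n) z - u z) \<le> ennreal e"
      by blast
    define g where "g z = exp (\<phi> z / 2) *\<^sub>R u z" for z
    have gu: "half_weight \<phi> g = u"
      by (simp add: half_weight_def g_def fun_eq_iff flip: exp_add)
    have [measurable]: "g \<in> borel_measurable lebesgue"
      unfolding g_def[abs_def] by measurable
    have "g \<in> L2_fun \<phi>"
    proof -
      obtain n where "sq_norm lebesgue (\<lambda>z. half_weight \<phi> (f n) z - u z) \<le> ennreal 1"
        using u[of 1] by auto
      then have "sq_norm lebesgue (\<lambda>z. u z - half_weight \<phi> (f n) z) < \<infinity>"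
        by (simp add: sq_norm_diff_commute[of _ u] order_le_less_trans)
      moreover have "sq_norm lebesgue (half_weight \<phi> (f n)) < \<infinity>"
        using f(1) by (simp add: L2_fun_iff)
      ultimately have "2 * sq_norm lebesgue (\<lambda>z. u z - half_weight \<phi> (f n) z) + 2 * sq_norm lebesgue (half_weight \<phi> (f n)) < \<infinity>"
        by (simp add: ennreal_mult_less_top)
      moreover have "sq_norm lebesgue u \<le> 2 * sq_norm lebesgue (\<lambda>z. u z - half_weight \<phi> (f n) z) + 2 * sq_norm lebesgue (half_weight \<phi> (f n))"
        using sq_norm_add[of "\<lambda>z. u z - half_weight \<phi> (f n) z" lebesgue "half_weight \<phi> (f n)"]
          half_weight_measurable[OF meas[of n]] by simp
      ultimately show ?thesis
        by (simp add: L2_fun_iff gu order_le_less_trans)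
    qed
    have "limitin mtopology \<sigma> (ae_rel \<phi> `` {g}) sequentially"
      unfolding limit_metric_sequentially
    proof (intro conjI allI impI)
      show "ae_rel \<phi> `` {g} \<in> L2_space \<phi>"
        using \<open>g \<in> L2_fun \<phi>\<close> by (auto simp: L2_space_def intro: quotientI)
      fix e :: real assume "e > 0"
      then obtain N where N: "\<And>n. n \<ge> N \<Longrightarrow> sq_norm lebesgue (\<lambda>z. half_weight \<phi> (f n) z - u z) \<le> ennreal ((e / 2)\<^sup>2)"
        using u[of "(e / 2)\<^sup>2"] by auto
      have "\<sigma> n \<in> L2_space \<phi> \<and> L2_dist \<phi> (\<sigma> n) (ae_rel \<phi> `` {g}) < e" if "n \<ge> N" for n
      proof
        show "\<sigma> n \<in> L2_space \<phi>"
          using \<sigma> by (auto simp: MCauchy_def)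
        have "ennreal ((L2_dist \<phi> (\<sigma> n) (ae_rel \<phi> `` {g}))\<^sup>2) = sq_norm lebesgue (\<lambda>z. half_weight \<phi> (f n) z - u z)"
          unfolding f(2) L2_dist_class[OF f(1) \<open>g \<in> L2_fun \<phi>\<close>] gu[symmetric] half_weight_diff[symmetric]
          by (rule L2_norm_sq[OF L2_fun_diff[OF \<phi> f(1) \<open>g \<in> L2_fun \<phi>\<close>]])
        also have "\<dots> \<le> ennreal ((e / 2)\<^sup>2)"
          by (rule N[OF that])
        finally have "(L2_dist \<phi> (\<sigma> n) (ae_rel \<phi> `` {g}))\<^sup>2 \<le> (e / 2)\<^sup>2"
          by simp
        then have "L2_dist \<phi> (\<sigma> n) (ae_rel \<phi> `` {g}) \<le> e / 2"
          by (rule power2_le_imp_le) (use \<open>e > 0\<close> in simp)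
        then show "L2_dist \<phi> (\<sigma> n) (ae_rel \<phi> `` {g}) < e"
          using \<open>e > 0\<close> by linarith
      qed
      then show "\<exists>N. \<forall>n\<ge>N. \<sigma> n \<in> L2_space \<phi> \<and> L2_dist \<phi> (\<sigma> n) (ae_rel \<phi> `` {g}) < e"
        by blast
    qed
    then show "\<exists>x. limitin mtopology \<sigma> x sequentially"
      by blast
  qed
qed

end

section \<open>From the weighted operators to weak derivatives\<close>

lemma sum_Basis_complex_vec:
  fixes h :: "complex^'n \<Rightarrow> 'b::comm_monoid_add"
  shows "(\<Sum>b\<in>Basis. h b) = (\<Sum>j\<in>UNIV. h (xdir j) + h (ydir j))"
proof -
  have B: "(Basis :: (complex^'n) set) = (\<lambda>(j, u). axis j u) ` (UNIV \<times> {1, \<i>})"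
    by (auto simp: Basis_vec_def Basis_complex_def)
  have inj: "inj_on (\<lambda>(j, u). axis j u :: complex^'n) (UNIV \<times> {1, \<i>})"
    by (auto simp: inj_on_def axis_eq_axis)
  have "(\<Sum>b\<in>Basis. h b) = (\<Sum>p\<in>UNIV \<times> {1, \<i>}. h (axis (fst p) (snd p)))"
    unfolding B by (subst sum.reindex[OF inj]) (auto simp: split_beta)
  also have "\<dots> = (\<Sum>j\<in>UNIV. \<Sum>u\<in>{1, \<i>}. h (axis j u))"
    unfolding sum.cartesian_product by (intro sum.cong) auto
  also have "\<dots> = (\<Sum>j\<in>UNIV. h (xdir j) + h (ydir j))"
    by (intro sum.cong) auto
  finally show ?thesis .
qed

lemma Basis_complex_vecE:
  assumes "(b :: complex^'n) \<in> Basis"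
  obtains j where "b = xdir j \<or> b = ydir j"
  using assms by (auto simp: Basis_vec_def Basis_complex_def)

lemma line_derivative:
  fixes f :: "'a::euclidean_space \<Rightarrow> real"
  assumes "\<And>z. f differentiable (at z)"
  shows "((\<lambda>s. f (x + s *\<^sub>R b)) has_real_derivative dir_deriv b f (x + s *\<^sub>R b)) (at s)"
proof -
  have f: "(f has_derivative (\<lambda>v. dir_deriv v f (x + s *\<^sub>R b))) (at (x + s *\<^sub>R b))"
    using assms by (rule has_derivative_dir_deriv)
  have "((\<lambda>s. x + s *\<^sub>R b) has_derivative (\<lambda>h. h *\<^sub>R b)) (at s)"
    by (auto intro!: derivative_eq_intros)
  from has_derivative_compose[OF this f]
  have "((\<lambda>s. f (x + s *\<^sub>R b)) has_derivative (\<lambda>h. dir_deriv (h *\<^sub>R b) f (x + s *\<^sub>R b))) (at s)" .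
  moreover have "dir_deriv (h *\<^sub>R b) f (x + s *\<^sub>R b) = dir_deriv b f (x + s *\<^sub>R b) * h" for h
    using linear_cmul[OF has_derivative_linear[OF f], of h b] by simp
  ultimately show ?thesis
    by (simp add: has_field_derivative_def)
qed

lemma sq_norm_lebesgue_eq_lborel:
  "h \<in> borel_measurable borel \<Longrightarrow> sq_norm lebesgue h = sq_norm lborel h"
  unfolding sq_norm_def by (rule nn_integral_completion)

text \<open>Translations and iterated integrals are handled for Borel functions, while the elements of the
  weighted space are merely Lebesgue measurable.\<close>

lemma borel_representative:
  fixes f :: "'a::euclidean_space \<Rightarrow> complex"
  assumes "f \<in> borel_measurable lebesgue"
  shows "\<exists>f'\<in>borel_measurable borel. AE z in lebesgue. f z = f' z"
proof -
  have "(\<lambda>z. Re (f z)) \<in> borel_measurable lebesgue" "(\<lambda>z. Im (f z)) \<in> borel_measurable lebesgue"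
    using assms by measurable
  then obtain p q where p: "p \<in> borel_measurable lborel" "AE z in lborel. Re (f z) = p z"
    and q: "q \<in> borel_measurable lborel" "AE z in lborel. Im (f z) = q z"
    using completion_ex_borel_measurable_real by metis
  have "(\<lambda>z. Complex (p z) (q z)) = (\<lambda>z. complex_of_real (p z) + \<i> * complex_of_real (q z))"
    by (simp add: complex_eq_iff fun_eq_iff)
  then have "(\<lambda>z. Complex (p z) (q z)) \<in> borel_measurable borel"
    using p(1) q(1) by simp
  moreover have "AE z in lborel. f z = Complex (p z) (q z)"
    using p(2) q(2) by eventually_elim (simp add: complex_eq_iff)
  ultimately show ?thesis
    by (intro bexI[of _ "\<lambda>z. Complex (p z) (q z)"] AE_completion)
qed

text \<open>Testing \<open>f\<close> with the product of a cutoff and a kernel amounts to testing the cut off function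
  with the kernel.\<close>

lemma bump_product_test_fun:
  assumes "r > 0"
  shows "(\<lambda>z. complex_of_real (bump r a z * bump r' a' z)) \<in> test_fun" (is "?\<psi> \<in> _")
proof -
  have "Ck k ?\<psi>" for k
    by (intro Ck_bounded_linear[OF bounded_linear_of_real] Ck_mult Ck_bump)
  moreover have "support_on UNIV ?\<psi> \<subseteq> cball a r"
  proof
    fix z assume "z \<in> support_on UNIV ?\<psi>"
    then have "bump r a z \<noteq> 0"
      by (auto simp: support_on_def)
    then have "\<not> norm (z - a) \<ge> r"
      using bump_outside(1)[OF assms] by blast
    then show "z \<in> cball a r"
      by (simp add: dist_norm norm_minus_commute)
  qed
  then have "bounded (support_on UNIV ?\<psi>)"
    using bounded_cball bounded_subset by blast
  then have "compact (closure (support_on UNIV ?\<psi>))"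
    by simp
  ultimately show ?thesis
    by (simp add: test_fun_def)
qed

lemma dir_deriv_bump_product:
  "dir_deriv v (\<lambda>z. complex_of_real (bump r a z * bump r' a' z)) z =
    complex_of_real (bump r a z * bump' r' a' v z + bump' r a v z * bump r' a' z)"
  by (rule dir_deriv_eq)
     (intro bounded_linear.has_derivative[OF bounded_linear_of_real] has_derivative_mult bump_has_derivative)

context
  fixes \<phi> :: "complex^'n \<Rightarrow> real"
  assumes \<phi>: "continuous_on UNIV \<phi>"
begin

lemma half_weight_borel [measurable]:
  "h \<in> borel_measurable borel \<Longrightarrow> half_weight \<phi> h \<in> borel_measurable borel"
  using weight_measurable(1)[OF \<phi>] unfolding half_weight_def[abs_def] by measurable

text \<open>On bounded sets the weight is bounded away from \<open>0\<close>.\<close>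

lemma sq_norm_cutoff:
  fixes C :: "complex^'n \<Rightarrow> real"
  assumes C: "continuous_on UNIV C" "\<And>z. norm z \<ge> R \<Longrightarrow> C z = 0"
  shows "\<exists>K\<ge>0. \<forall>h\<in>borel_measurable borel. sq_norm lborel (\<lambda>z. C z *\<^sub>R h z) \<le> ennreal K * sq_norm lborel (half_weight \<phi> h)"
proof -
  have "continuous_on UNIV (\<lambda>z. (C z)\<^sup>2 * exp (\<phi> z))"
    by (intro continuous_intros C(1) \<phi>)
  then obtain K where K0: "K > 0" "\<And>z. norm z \<le> R \<Longrightarrow> \<bar>(C z)\<^sup>2 * exp (\<phi> z)\<bar> \<le> K"
    by (rule continuous_bounded_on_cball[where r=R]) blast
  have K: "(C z)\<^sup>2 * exp (\<phi> z) \<le> K" for z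
    using K0(1) K0(2)[of z] C(2)[of z] by (cases "norm z \<le> R") auto
  have "sq_norm lborel (\<lambda>z. C z *\<^sub>R h z) \<le> ennreal K * sq_norm lborel (half_weight \<phi> h)"
    if [measurable]: "h \<in> borel_measurable borel" for h :: "complex^'n \<Rightarrow> complex"
  proof -
    have "sq_norm lborel (\<lambda>z. C z *\<^sub>R h z) \<le> (\<integral>\<^sup>+z. ennreal K * ennreal ((cmod (half_weight \<phi> h z))\<^sup>2) \<partial>lborel)"
      unfolding sq_norm_def
    proof (intro nn_integral_mono)
      fix z
      have "(cmod (C z *\<^sub>R h z))\<^sup>2 = ((C z)\<^sup>2 * exp (\<phi> z)) * (cmod (half_weight \<phi> h z))\<^sup>2"
        by (simp add: norm_half_weight_sq power_mult_distrib exp_minus)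
      also have "\<dots> \<le> K * (cmod (half_weight \<phi> h z))\<^sup>2"
        by (intro mult_right_mono K) auto
      finally have "ennreal ((cmod (C z *\<^sub>R h z))\<^sup>2) \<le> ennreal (K * (cmod (half_weight \<phi> h z))\<^sup>2)"
        by (rule ennreal_leI)
      then show "ennreal ((cmod (C z *\<^sub>R h z))\<^sup>2) \<le> ennreal K * ennreal ((cmod (half_weight \<phi> h z))\<^sup>2)"
        using K0(1) by (simp add: ennreal_mult)
    qed
    also have "\<dots> = ennreal K * sq_norm lborel (half_weight \<phi> h)"
      unfolding sq_norm_def by (rule nn_integral_cmult) measurable
    finally show ?thesis .
  qed
  then show ?thesis
    using K0(1) by (intro exI[of _ K]) auto
qed

lemma cutoff_L2:
  fixes C :: "complex^'n \<Rightarrow> real" and h :: "complex^'n \<Rightarrow> complex"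
  assumes C: "continuous_on UNIV C" "\<And>z. norm z \<ge> R \<Longrightarrow> C z = 0"
    and [measurable]: "h \<in> borel_measurable borel" and fin: "sq_norm lborel (half_weight \<phi> h) < \<infinity>"
  shows "sq_norm lborel (\<lambda>z. C z *\<^sub>R h z) < \<infinity>" "integrable lborel (\<lambda>z. C z *\<^sub>R h z)"
proof -
  have [measurable]: "C \<in> borel_measurable borel"
    using C(1) by (rule borel_measurable_continuous_onI)
  obtain K where "sq_norm lborel (\<lambda>z. C z *\<^sub>R h z) \<le> ennreal K * sq_norm lborel (half_weight \<phi> h)"
    using sq_norm_cutoff[OF C] assms(3) by blast
  also have "\<dots> < \<infinity>"
    using fin by (simp add: ennreal_mult_less_top)
  finally show fin': "sq_norm lborel (\<lambda>z. C z *\<^sub>R h z) < \<infinity>" .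
  then obtain c where c: "sq_norm lborel (\<lambda>z. C z *\<^sub>R h z) = ennreal c" "c \<ge> 0"
    by (cases "sq_norm lborel (\<lambda>z. C z *\<^sub>R h z)") auto
  show "integrable lborel (\<lambda>z. C z *\<^sub>R h z)"
    by (rule integrable_of_sq_norm(1)[of _ R c]) (use C c in auto)
qed

text \<open>The product rule for a cutoff \<open>\<theta>\<close>, obtained by testing the defining identity of \<open>is_X\<close> with
  the product of \<open>\<theta>\<close> and a bump.\<close>

lemma is_X_cutoff_weak_dderiv:
  fixes f g :: "complex^'n \<Rightarrow> complex" and R :: real and b :: "complex^'n"
  defines "\<theta> \<equiv> bump R 0" and "\<theta>' \<equiv> bump' R 0 b"
  assumes R: "R > 0"
    and [measurable]: "f \<in> borel_measurable borel" "g \<in> borel_measurable borel"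
    and f: "sq_norm lborel (half_weight \<phi> f) < \<infinity>" and g: "sq_norm lborel (half_weight \<phi> g) < \<infinity>"
    and X: "is_X \<phi> \<eta> b f g" and d: "continuous_on UNIV (dir_deriv b \<phi>)"
  shows "weak_dderiv b (\<lambda>z. \<theta> z *\<^sub>R f z)
    (\<lambda>z. (\<theta> z *\<^sub>R g z + \<theta>' z *\<^sub>R f z) + ((1 + \<eta>) / 2 * dir_deriv b \<phi> z) *\<^sub>R (\<theta> z *\<^sub>R f z))"
  unfolding weak_dderiv_def
proof (intro allI impI)
  fix r :: real and x :: "complex^'n" assume r: "r > 0"
  define \<rho> \<rho>' where "\<rho> = bump r x" and "\<rho>' = bump' r x b"
  define c where "c z = (1 + \<eta>) / 2 * dir_deriv b \<phi> z" for z
  have [measurable]: "dir_deriv b \<phi> \<in> borel_measurable borel"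
    using d by (rule borel_measurable_continuous_onI)
  have cont: "continuous_on UNIV \<theta>" "continuous_on UNIV \<theta>'" "continuous_on UNIV \<rho>" "continuous_on UNIV \<rho>'" "continuous_on UNIV c"
    unfolding \<theta>_def \<theta>'_def \<rho>_def \<rho>'_def c_def[abs_def] by (intro continuous_bump continuous_bump' continuous_intros d)+
  note [measurable] = cont[THEN borel_measurable_continuous_onI]
  have out: "\<theta> z = 0" "\<theta>' z = 0" if "norm z \<ge> R" for z
    using bump_outside[OF R, of z 0] that by (simp_all add: \<theta>_def \<theta>'_def)
  have int: "integrable lborel (\<lambda>z. (\<theta> z * \<rho> z) *\<^sub>R g z)" "integrable lborel (\<lambda>z. (\<theta>' z * \<rho> z) *\<^sub>R f z)"
    "integrable lborel (\<lambda>z. (\<theta> z * \<rho>' z) *\<^sub>R f z)" "integrable lborel (\<lambda>z. (c z * \<theta> z * \<rho> z) *\<^sub>R f z)"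
    by (rule cutoff_L2(2)[of _ R], intro continuous_intros cont, simp add: out, simp, rule f g)+
  define \<psi> where "\<psi> z = complex_of_real (\<theta> z * \<rho> z)" for z
  have "\<psi> \<in> test_fun"
    unfolding \<psi>_def[abs_def] \<theta>_def \<rho>_def by (rule bump_product_test_fun[OF R])
  then have "(LINT z|lebesgue. g z * \<psi> z) = X_distr \<phi> \<eta> b f \<psi>"
    using X by (auto simp: is_X_def)
  moreover have "dir_deriv b \<psi> = (\<lambda>z. complex_of_real (\<theta> z * \<rho>' z + \<theta>' z * \<rho> z))"
    unfolding \<psi>_def[abs_def] \<theta>_def \<rho>_def \<theta>'_def \<rho>'_def using dir_deriv_bump_product by blast
  ultimately have "(LINT z|lebesgue. g z * \<psi> z) = - (LINT z|lebesgue. f z * complex_of_real (\<theta> z * \<rho>' z + \<theta>' z * \<rho> z))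
      - (LINT z|lebesgue. complex_of_real (c z) * f z * \<psi> z)"
    by (simp add: X_distr_def c_def)
  also have "(LINT z|lebesgue. g z * \<psi> z) = (LINT z|lborel. (\<theta> z * \<rho> z) *\<^sub>R g z)"
    by (subst integral_completion) (auto simp: \<psi>_def[abs_def] scaleR_conv_of_real mult.commute)
  also have "(LINT z|lebesgue. f z * complex_of_real (\<theta> z * \<rho>' z + \<theta>' z * \<rho> z))
      = (LINT z|lborel. (\<theta> z * \<rho>' z) *\<^sub>R f z + (\<theta>' z * \<rho> z) *\<^sub>R f z)"
    by (subst integral_completion) (auto simp: scaleR_conv_of_real algebra_simps)
  also have "\<dots> = (LINT z|lborel. (\<theta> z * \<rho>' z) *\<^sub>R f z) + (LINT z|lborel. (\<theta>' z * \<rho> z) *\<^sub>R f z)"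
    using int by simp
  also have "(LINT z|lebesgue. complex_of_real (c z) * f z * \<psi> z) = (LINT z|lborel. (c z * \<theta> z * \<rho> z) *\<^sub>R f z)"
    by (subst integral_completion) (auto simp: \<psi>_def[abs_def] scaleR_conv_of_real algebra_simps)
  finally have key: "(LINT z|lborel. (\<theta> z * \<rho> z) *\<^sub>R g z) = - ((LINT z|lborel. (\<theta> z * \<rho>' z) *\<^sub>R f z) + (LINT z|lborel. (\<theta>' z * \<rho> z) *\<^sub>R f z))
      - (LINT z|lborel. (c z * \<theta> z * \<rho> z) *\<^sub>R f z)" .
  have "(LINT z|lborel. \<rho> z *\<^sub>R ((\<theta> z *\<^sub>R g z + \<theta>' z *\<^sub>R f z) + c z *\<^sub>R (\<theta> z *\<^sub>R f z)))
      = (LINT z|lborel. ((\<theta> z * \<rho> z) *\<^sub>R g z + (\<theta>' z * \<rho> z) *\<^sub>R f z) + (c z * \<theta> z * \<rho> z) *\<^sub>R f z)"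
    by (simp add: scaleR_add_right ac_simps)
  also have "\<dots> = (LINT z|lborel. (\<theta> z * \<rho> z) *\<^sub>R g z) + (LINT z|lborel. (\<theta>' z * \<rho> z) *\<^sub>R f z)
      + (LINT z|lborel. (c z * \<theta> z * \<rho> z) *\<^sub>R f z)"
    using int by simp
  also have "\<dots> = - (LINT z|lborel. (\<theta> z * \<rho>' z) *\<^sub>R f z)"
    unfolding key by simp
  finally show "(LINT z|lborel. bump r x z *\<^sub>R ((\<theta> z *\<^sub>R g z + \<theta>' z *\<^sub>R f z) + ((1 + \<eta>) / 2 * dir_deriv b \<phi> z) *\<^sub>R (\<theta> z *\<^sub>R f z)))
      = - (LINT z|lborel. bump' r x b z *\<^sub>R (\<theta> z *\<^sub>R f z))"
    by (simp add: \<rho>_def \<rho>'_def c_def mult.commute)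
qed

end

section \<open>The tail estimate\<close>

lemma Ck2_facts:
  assumes "Ck 2 \<phi>"
  shows "\<phi> differentiable (at z)" "continuous_on UNIV \<phi>"
    "b \<in> Basis \<Longrightarrow> dir_deriv b \<phi> differentiable (at z)" "b \<in> Basis \<Longrightarrow> continuous_on UNIV (dir_deriv b \<phi>)"
    "b \<in> Basis \<Longrightarrow> continuous_on UNIV (dir_deriv b (dir_deriv b \<phi>))"
  using assms Ck_Suc_imp_Ck[of 0]
  by (auto simp: numeral_2_eq_2 continuous_on_eq_continuous_at differentiable_imp_continuous_within)

lemma integrable_continuous_inner:
  fixes u w :: "'a::euclidean_space \<Rightarrow> 'b::euclidean_space"
  assumes A: "continuous_on UNIV A" and [measurable]: "u \<in> borel_measurable borel" "w \<in> borel_measurable borel"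
    and fin: "sq_norm lborel u < \<infinity>" "sq_norm lborel w < \<infinity>" and supp: "\<And>x. norm x \<ge> R \<Longrightarrow> u x = 0"
  shows "integrable lborel (\<lambda>x. A x * (u x \<bullet> w x))"
proof -
  have [measurable]: "A \<in> borel_measurable borel"
    using A by (rule borel_measurable_continuous_onI)
  obtain K where K: "K > 0" "\<And>x. norm x \<le> R \<Longrightarrow> \<bar>A x\<bar> \<le> K"
    using continuous_bounded_on_cball[OF A] by blast
  have "integrable lborel (\<lambda>x. (indicator (cball 0 R) x * A x) * (u x \<bullet> w x))"
  proof (rule integrable_weighted_inner[where K=K])
    show "\<bar>indicator (cball 0 R) x * A x\<bar> \<le> K" for x
      using K(1) K(2)[of x] by (cases "x \<in> cball 0 R") auto
  qed (use fin in \<open>auto intro!: borel_measurable_times borel_measurable_indicator\<close>)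
  moreover have "(indicator (cball 0 R) x * A x) * (u x \<bullet> w x) = A x * (u x \<bullet> w x)" for x
    using supp[of x] by (cases "x \<in> cball 0 R") auto
  ultimately show ?thesis
    by simp
qed

lemma sq_norm_scale_le:
  fixes h :: "'a \<Rightarrow> 'b::euclidean_space"
  assumes [measurable]: "h \<in> borel_measurable M" and k: "\<And>x. \<bar>c x\<bar> \<le> k"
  shows "sq_norm M (\<lambda>x. c x *\<^sub>R h x) \<le> ennreal (k\<^sup>2) * sq_norm M h"
proof -
  have "sq_norm M (\<lambda>x. c x *\<^sub>R h x) \<le> (\<integral>\<^sup>+x. ennreal (k\<^sup>2) * ennreal ((norm (h x))\<^sup>2) \<partial>M)"
    unfolding sq_norm_def
  proof (intro nn_integral_mono)
    fix x
    have "\<bar>c x\<bar>\<^sup>2 * (norm (h x))\<^sup>2 \<le> k\<^sup>2 * (norm (h x))\<^sup>2"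
      by (intro mult_right_mono power_mono k) auto
    then have "ennreal ((norm (c x *\<^sub>R h x))\<^sup>2) \<le> ennreal (k\<^sup>2 * (norm (h x))\<^sup>2)"
      by (intro ennreal_leI) (simp add: power_mult_distrib)
    then show "ennreal ((norm (c x *\<^sub>R h x))\<^sup>2) \<le> ennreal (k\<^sup>2) * ennreal ((norm (h x))\<^sup>2)"
      by (simp add: ennreal_mult)
  qed
  also have "\<dots> = ennreal (k\<^sup>2) * sq_norm M h"
    unfolding sq_norm_def by (rule nn_integral_cmult) measurable
  finally show ?thesis .
qed

lemma half_weight_scale: "half_weight \<phi> (\<lambda>z. c z *\<^sub>R h z) = (\<lambda>z. c z *\<^sub>R half_weight \<phi> h z)"
  by (simp add: half_weight_def fun_eq_iff mult.commute)

lemma half_weight_add: "half_weight \<phi> (\<lambda>z. f z + g z) = (\<lambda>z. half_weight \<phi> f z + half_weight \<phi> g z)"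
  by (simp add: half_weight_def fun_eq_iff scaleR_add_right)

lemma norm_half_weight_sq_inner: "(cmod (half_weight \<phi> h z))\<^sup>2 = exp (- \<phi> z) * (h z \<bullet> h z)"
  unfolding norm_half_weight_sq by (simp add: power2_norm_eq_inner)

text \<open>The energy identity for \<open>A = exp (- \<phi>) * d\<close>. In \<open>A'\<close> the derivative of the weight contributes
  \<open>- d\<^sup>2\<close>, and the zeroth order term \<open>(1 + \<eta>) / 2 * d * v\<close> of the weak derivative contributes
  \<open>(1 + \<eta>) * d\<^sup>2\<close>, so that \<open>\<eta> * d\<^sup>2\<close> remains; multiplication by \<open>\<eta>\<close> makes this a square. The
  mixed term is then absorbed by completing a square, at the cost of the fraction \<open>t\<close>.\<close>

lemma energy_bound_direction:
  fixes \<phi> :: "complex^'n \<Rightarrow> real" and f g :: "complex^'n \<Rightarrow> complex" and b :: "complex^'n"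
  defines "d \<equiv> dir_deriv b \<phi>"
  assumes \<phi>: "Ck 2 \<phi>" and b: "b \<in> Basis" and R: "R > 0" and t: "t > 0"
    and [measurable]: "f \<in> borel_measurable borel" "g \<in> borel_measurable borel"
    and f: "sq_norm lborel (half_weight \<phi> f) < \<infinity>" and g: "sq_norm lborel (half_weight \<phi> g) < \<infinity>"
    and X: "is_X \<phi> \<eta> b f g"
    and v: "v = (\<lambda>z. bump R 0 z *\<^sub>R f z)"
    and q: "q = (\<lambda>z. bump R 0 z *\<^sub>R g z + bump' R 0 b z *\<^sub>R f z)"
  shows "(LINT z|lborel. (exp (- \<phi> z) * (\<eta> * dir_deriv b d z + (1 - t) * (\<eta> * d z)\<^sup>2)) * (v z \<bullet> v z))
    \<le> (1 / t) * (LINT z|lborel. exp (- \<phi> z) * (q z \<bullet> q z))"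
    and "integrable lborel (\<lambda>z. exp (- \<phi> z) * (q z \<bullet> q z))"
proof -
  note \<phi>_cont = Ck2_facts(2)[OF \<phi>] and d_cont = Ck2_facts(4)[OF \<phi> b, folded d_def]
    and d2_cont = Ck2_facts(5)[OF \<phi> b, folded d_def]
  define c where "c z = (1 + \<eta>) / 2 * d z" for z
  define w where "w z = q z + c z *\<^sub>R v z" for z
  have c_cont: "continuous_on UNIV c"
    unfolding c_def[abs_def] by (intro continuous_intros d_cont)
  have out: "bump R 0 z = 0" "bump' R 0 b z = 0" if "norm z \<ge> R" for z :: "complex^'n"
    using bump_outside[OF R, of z 0] that by simp_all
  have supp: "v z = 0" "q z = 0" "w z = 0" if "norm z \<ge> R" for z
    using out[OF that] by (auto simp: v q w_def)
  have v_L2: "sq_norm lborel v < \<infinity>" "integrable lborel v"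
    unfolding v by (rule cutoff_L2[OF \<phi>_cont continuous_bump _ _ f], use out in auto)+
  have q1: "sq_norm lborel (\<lambda>z. bump R 0 z *\<^sub>R g z) < \<infinity>" "integrable lborel (\<lambda>z. bump R 0 z *\<^sub>R g z)"
    by (rule cutoff_L2[OF \<phi>_cont continuous_bump _ _ g], use out in auto)+
  have q2: "sq_norm lborel (\<lambda>z. bump' R 0 b z *\<^sub>R f z) < \<infinity>" "integrable lborel (\<lambda>z. bump' R 0 b z *\<^sub>R f z)"
    by (rule cutoff_L2[OF \<phi>_cont continuous_bump' _ _ f], use out in auto)+
  have cv: "sq_norm lborel (\<lambda>z. (c z * bump R 0 z) *\<^sub>R f z) < \<infinity>" "integrable lborel (\<lambda>z. (c z * bump R 0 z) *\<^sub>R f z)"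
    by (rule cutoff_L2[OF \<phi>_cont _ _ _ f], intro continuous_intros c_cont continuous_bump, use out in auto)+
  have cv_eq: "(\<lambda>z. (c z * bump R 0 z) *\<^sub>R f z) = (\<lambda>z. c z *\<^sub>R v z)"
    by (simp add: v)
  have sum_fin: "sq_norm lborel (\<lambda>z. h1 z + h2 z) < \<infinity>"
    if "sq_norm lborel h1 < \<infinity>" "sq_norm lborel h2 < \<infinity>" "integrable lborel h1" "integrable lborel h2" for h1 h2 :: "complex^'n \<Rightarrow> complex"
  proof -
    have "sq_norm lborel (\<lambda>z. h1 z + h2 z) \<le> 2 * sq_norm lborel h1 + 2 * sq_norm lborel h2"
      using that by (intro sq_norm_add borel_measurable_integrable)
    also have "\<dots> < \<infinity>"
      using that by (simp add: ennreal_mult_less_top)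
    finally show ?thesis .
  qed
  have q_L2: "sq_norm lborel q < \<infinity>" "integrable lborel q"
    unfolding q by (rule sum_fin[OF q1(1) q2(1) q1(2) q2(2)], rule Bochner_Integration.integrable_add[OF q1(2) q2(2)])
  have w_L2: "sq_norm lborel w < \<infinity>" "integrable lborel w"
    using sum_fin[OF q_L2(1) cv(1)[unfolded cv_eq] q_L2(2) cv(2)[unfolded cv_eq]]
      Bochner_Integration.integrable_add[OF q_L2(2) cv(2)[unfolded cv_eq]]
    unfolding w_def[abs_def] by simp_all
  have [measurable]: "v \<in> borel_measurable borel" "q \<in> borel_measurable borel" "w \<in> borel_measurable borel"
    using v_L2(2) q_L2(2) w_L2(2) by (auto dest: borel_measurable_integrable)
  have weak: "weak_dderiv b v w"
    using is_X_cutoff_weak_dderiv[OF \<phi>_cont R _ _ f g X] d_cont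
    unfolding w_def[abs_def] v q c_def d_def by simp
  define A where "A z = exp (- \<phi> z) * d z" for z
  define A' where "A' z = exp (- \<phi> z) * (dir_deriv b d z - (d z)\<^sup>2)" for z
  have ident: "(LINT z|lborel. A' z * (v z \<bullet> v z)) = - 2 * (LINT z|lborel. A z * (v z \<bullet> w z))"
  proof (rule weak_energy_identity[OF v_L2(2,1) w_L2(2,1) supp(1,3) weak])
    show "continuous_on UNIV A" "continuous_on UNIV A'"
      unfolding A_def[abs_def] A'_def[abs_def] by (intro continuous_intros \<phi>_cont d_cont d2_cont)+
    fix x s
    have 1: "((\<lambda>s. \<phi> (x + s *\<^sub>R b)) has_real_derivative d (x + s *\<^sub>R b)) (at s)"
      unfolding d_def by (rule line_derivative) (rule Ck2_facts(1)[OF \<phi>])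
    have 2: "((\<lambda>s. d (x + s *\<^sub>R b)) has_real_derivative dir_deriv b d (x + s *\<^sub>R b)) (at s)"
      unfolding d_def by (rule line_derivative) (rule Ck2_facts(3)[OF \<phi> b])
    show "((\<lambda>s. A (x + s *\<^sub>R b)) has_real_derivative A' (x + s *\<^sub>R b)) (at s)"
      unfolding A_def A'_def
      by (rule DERIV_cong[OF DERIV_mult[OF DERIV_fun_exp[OF DERIV_minus[OF 1]] 2]])
         (simp add: algebra_simps power2_eq_square)
  qed simp_all
  have int: "integrable lborel (\<lambda>z. E z * (v z \<bullet> h z))"
    if "continuous_on UNIV E" "sq_norm lborel h < \<infinity>" "h \<in> borel_measurable borel" for E and h :: "complex^'n \<Rightarrow> complex"
    by (rule integrable_continuous_inner[OF that(1) _ that(3) v_L2(1) that(2) supp(1)]) auto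
  have cont_e: "continuous_on UNIV (\<lambda>z. exp (- \<phi> z))"
    by (intro continuous_intros \<phi>_cont)
  show int_q: "integrable lborel (\<lambda>z. exp (- \<phi> z) * (q z \<bullet> q z))"
    by (rule integrable_continuous_inner[OF cont_e _ _ q_L2(1) q_L2(1) supp(2)]) auto
  have int_vq: "integrable lborel (\<lambda>z. A z * (v z \<bullet> q z))" and int_A': "integrable lborel (\<lambda>z. A' z * (v z \<bullet> v z))"
    and int_Ac: "integrable lborel (\<lambda>z. (A z * c z) * (v z \<bullet> v z))"
    and int_t: "integrable lborel (\<lambda>z. (exp (- \<phi> z) * (t * (\<eta> * d z)\<^sup>2)) * (v z \<bullet> v z))"
    and int_B: "integrable lborel (\<lambda>z. (exp (- \<phi> z) * (\<eta> * dir_deriv b d z + (1 - t) * (\<eta> * d z)\<^sup>2)) * (v z \<bullet> v z))"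
    unfolding A_def A'_def
    by (rule int, intro continuous_intros \<phi>_cont d_cont d2_cont c_cont, rule q_L2(1) v_L2(1), measurable)+
  have "(LINT z|lborel. A z * (v z \<bullet> w z)) = (LINT z|lborel. A z * (v z \<bullet> q z) + (A z * c z) * (v z \<bullet> v z))"
    by (simp add: w_def inner_add_right algebra_simps)
  also have "\<dots> = (LINT z|lborel. A z * (v z \<bullet> q z)) + (LINT z|lborel. (A z * c z) * (v z \<bullet> v z))"
    using int_vq int_Ac by simp
  finally have ident': "(LINT z|lborel. A' z * (v z \<bullet> v z)) + 2 * (LINT z|lborel. (A z * c z) * (v z \<bullet> v z)) = - 2 * (LINT z|lborel. A z * (v z \<bullet> q z))"
    using ident by simp
  have "(LINT z|lborel. (exp (- \<phi> z) * (\<eta> * dir_deriv b d z + (1 - t) * (\<eta> * d z)\<^sup>2)) * (v z \<bullet> v z))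
      = (LINT z|lborel. \<eta> * (A' z * (v z \<bullet> v z) + 2 * ((A z * c z) * (v z \<bullet> v z))) - (exp (- \<phi> z) * (t * (\<eta> * d z)\<^sup>2)) * (v z \<bullet> v z))"
    by (intro Bochner_Integration.integral_cong) (auto simp: A_def A'_def c_def algebra_simps power2_eq_square add_divide_distrib)
  also have "\<dots> = \<eta> * ((LINT z|lborel. A' z * (v z \<bullet> v z)) + 2 * (LINT z|lborel. (A z * c z) * (v z \<bullet> v z)))
      - (LINT z|lborel. (exp (- \<phi> z) * (t * (\<eta> * d z)\<^sup>2)) * (v z \<bullet> v z))"
    using int_A' int_Ac int_t by simp
  also have "\<dots> = (LINT z|lborel. (- 2 * \<eta>) * (A z * (v z \<bullet> q z)) - (exp (- \<phi> z) * (t * (\<eta> * d z)\<^sup>2)) * (v z \<bullet> v z))"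
    unfolding ident' using int_vq int_t by simp
  also have "\<dots> \<le> (LINT z|lborel. (1 / t) * (exp (- \<phi> z) * (q z \<bullet> q z)))"
  proof (rule integral_mono)
    show "(- 2 * \<eta>) * (A z * (v z \<bullet> q z)) - (exp (- \<phi> z) * (t * (\<eta> * d z)\<^sup>2)) * (v z \<bullet> v z) \<le> (1 / t) * (exp (- \<phi> z) * (q z \<bullet> q z))" for z
    proof -
      have "0 \<le> exp (- \<phi> z) / t * (((t * \<eta> * d z) *\<^sub>R v z + q z) \<bullet> ((t * \<eta> * d z) *\<^sub>R v z + q z))"
        using t by simp
      also have "\<dots> = exp (- \<phi> z) / t * ((t * \<eta> * d z)\<^sup>2 * (v z \<bullet> v z) + 2 * (t * \<eta> * d z) * (v z \<bullet> q z) + q z \<bullet> q z)"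
        by (simp add: inner_add_left inner_add_right inner_commute power2_eq_square algebra_simps)
      also have "\<dots> = (exp (- \<phi> z) * (t * (\<eta> * d z)\<^sup>2)) * (v z \<bullet> v z) + 2 * \<eta> * (A z * (v z \<bullet> q z)) + (1 / t) * (exp (- \<phi> z) * (q z \<bullet> q z))"
        using t by (simp add: A_def field_simps power2_eq_square)
      finally show ?thesis
        by simp
    qed
  qed (use int_vq int_t int_q in auto)
  also have "\<dots> = (1 / t) * (LINT z|lborel. exp (- \<phi> z) * (q z \<bullet> q z))"
    by (rule integral_mult_right_zero)
  finally show "(LINT z|lborel. (exp (- \<phi> z) * (\<eta> * dir_deriv b d z + (1 - t) * (\<eta> * d z)\<^sup>2)) * (v z \<bullet> v z))
    \<le> (1 / t) * (LINT z|lborel. exp (- \<phi> z) * (q z \<bullet> q z))" .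
qed

text \<open>Borel representatives of a function and of its images under the operators, with square norms
  bounded by \<open>C\<close>.\<close>

definition W1_data ::
  "(complex^'n \<Rightarrow> real) \<Rightarrow> real \<Rightarrow> real \<Rightarrow> (complex^'n \<Rightarrow> complex) \<Rightarrow> (complex^'n \<Rightarrow> complex^'n \<Rightarrow> complex) \<Rightarrow> bool" where
  "W1_data \<phi> \<eta> C f g \<longleftrightarrow>
     f \<in> borel_measurable borel \<and> sq_norm lborel (half_weight \<phi> f) \<le> ennreal C \<and>
     (\<forall>b\<in>Basis. g b \<in> borel_measurable borel \<and> sq_norm lborel (half_weight \<phi> (g b)) \<le> ennreal C \<and> is_X \<phi> \<eta> b f (g b))"

definition potential :: "(complex^'n \<Rightarrow> real) \<Rightarrow> real \<Rightarrow> real \<Rightarrow> complex^'n \<Rightarrow> real" where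
  "potential \<phi> \<eta> \<epsilon> z = \<eta>\<^sup>2 * grad_sq \<phi> z + (1 + \<epsilon>) * \<eta> * laplacian \<phi> z"

lemma potential_Basis:
  "potential \<phi> \<eta> \<epsilon> z = (\<Sum>b\<in>Basis. (\<eta> * dir_deriv b \<phi> z)\<^sup>2 + (1 + \<epsilon>) * \<eta> * dir_deriv b (dir_deriv b \<phi>) z)"
  by (simp add: potential_def grad_sq_def laplacian_def sum_Basis_complex_vec sum_distrib_left sum.distrib[symmetric]
      power_mult_distrib algebra_simps)

lemma continuous_potential: "Ck 2 \<phi> \<Longrightarrow> continuous_on UNIV (potential \<phi> \<eta> \<epsilon>)"
  unfolding potential_Basis[abs_def] by (intro continuous_intros Ck2_facts(4,5))

text \<open>The constant is uniform in the function and in the radius of the cutoff, because gradients of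
  cutoffs of radius at least \<open>1\<close> are uniformly bounded.\<close>

lemma energy_bound:
  fixes \<phi> :: "complex^'n \<Rightarrow> real"
  assumes \<phi>: "Ck 2 \<phi>" and \<epsilon>: "\<epsilon> > 0" and C: "C \<ge> 0"
  shows "\<exists>C1\<ge>0. \<forall>f g R. W1_data \<phi> \<eta> C f g \<longrightarrow> R \<ge> 1 \<longrightarrow>
    integrable lborel (\<lambda>z. potential \<phi> \<eta> \<epsilon> z * (cmod (half_weight \<phi> (\<lambda>z. bump R 0 z *\<^sub>R f z) z))\<^sup>2) \<and>
    (LINT z|lborel. potential \<phi> \<eta> \<epsilon> z * (cmod (half_weight \<phi> (\<lambda>z. bump R 0 z *\<^sub>R f z) z))\<^sup>2) \<le> C1"
proof -
  obtain L where L: "L \<ge> 0" "\<And>R a z v. R > 0 \<Longrightarrow> \<bar>bump' R (a::complex^'n) v z\<bar> \<le> L / R * norm v"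
    using bump'_bounded[where 'a="complex^'n"] by blast
  define Q where "Q = 2 * C + 2 * (L\<^sup>2 * C)"
  have Q: "Q \<ge> 0"
    using C by (simp add: Q_def)
  \<comment> \<open>then \<open>1 + \<epsilon>\<close> times the remaining part \<open>(1 - t) * (\<eta> * d)\<^sup>2\<close> is the full square\<close>
  define t where "t = \<epsilon> / (1 + \<epsilon>)"
  have t: "t > 0" "(1 + \<epsilon>) * (1 - t) = 1"
    using \<epsilon> by (auto simp: t_def field_simps)
  define C1 where "C1 = (\<Sum>b\<in>(Basis :: (complex^'n) set). (1 + \<epsilon>) * (1 / t * Q))"
  have "C1 \<ge> 0"
    unfolding C1_def using \<epsilon> t Q by (intro sum_nonneg) auto
  moreover have "integrable lborel (\<lambda>z. potential \<phi> \<eta> \<epsilon> z * (cmod (half_weight \<phi> (\<lambda>z. bump R 0 z *\<^sub>R f z) z))\<^sup>2) \<and>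
    (LINT z|lborel. potential \<phi> \<eta> \<epsilon> z * (cmod (half_weight \<phi> (\<lambda>z. bump R 0 z *\<^sub>R f z) z))\<^sup>2) \<le> C1"
    if data: "W1_data \<phi> \<eta> C f g" and R: "R \<ge> 1" for f g R
  proof -
    note \<phi>_cont = Ck2_facts(2)[OF \<phi>]
    note [measurable] = half_weight_borel[OF \<phi>_cont]
    have [measurable]: "f \<in> borel_measurable borel"
      using data by (simp add: W1_data_def)
    have R0: "R > 0"
      using R by simp
    define v where "v = (\<lambda>z. bump R 0 z *\<^sub>R f z)"
    have f: "sq_norm lborel (half_weight \<phi> f) \<le> ennreal C"
      using data by (simp add: W1_data_def)
    then have f_fin: "sq_norm lborel (half_weight \<phi> f) < \<infinity>"
      by (simp add: order_le_less_trans)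
    have v_supp: "v z = 0" if "norm z \<ge> R" for z
      using bump_outside(1)[OF R0, of z 0] that by (simp add: v_def)
    have v_L2: "sq_norm lborel v < \<infinity>" "integrable lborel v"
      unfolding v_def by (rule cutoff_L2[OF \<phi>_cont continuous_bump _ _ f_fin], use bump_outside(1)[OF R0, of _ 0] in auto)+
    have [measurable]: "v \<in> borel_measurable borel"
      unfolding v_def by measurable
    define T where "T b z = (exp (- \<phi> z) * (\<eta> * dir_deriv b (dir_deriv b \<phi>) z + (1 - t) * (\<eta> * dir_deriv b \<phi> z)\<^sup>2)) * (v z \<bullet> v z)" for b z
    have T_int: "integrable lborel (T b)" if b: "b \<in> Basis" for b
      unfolding T_def
      by (rule integrable_continuous_inner[OF _ _ _ v_L2(1) v_L2(1) v_supp])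
         (intro continuous_intros \<phi>_cont Ck2_facts(4,5)[OF \<phi> b], measurable)
    have T_le: "(LINT z|lborel. T b z) \<le> 1 / t * Q" if b: "b \<in> Basis" for b
    proof -
      define q where "q = (\<lambda>z. bump R 0 z *\<^sub>R g b z + bump' R 0 b z *\<^sub>R f z)"
      have [measurable]: "g b \<in> borel_measurable borel"
        using data b by (simp add: W1_data_def)
      have g: "sq_norm lborel (half_weight \<phi> (g b)) \<le> ennreal C" and X: "is_X \<phi> \<eta> b f (g b)"
        using data b by (simp_all add: W1_data_def)
      then have g_fin: "sq_norm lborel (half_weight \<phi> (g b)) < \<infinity>"
        by (simp add: order_le_less_trans)
      note E = energy_bound_direction[OF \<phi> b R0 t(1) _ _ f_fin g_fin X v_def q_def]
      have "ennreal (LINT z|lborel. exp (- \<phi> z) * (q z \<bullet> q z)) = sq_norm lborel (half_weight \<phi> q)"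
        unfolding sq_norm_def norm_half_weight_sq_inner
        by (rule nn_integral_eq_integral[symmetric]) (auto intro!: E(2))
      also have "\<dots> \<le> 2 * sq_norm lborel (\<lambda>z. bump R 0 z *\<^sub>R half_weight \<phi> (g b) z)
          + 2 * sq_norm lborel (\<lambda>z. bump' R 0 b z *\<^sub>R half_weight \<phi> f z)"
        unfolding q_def half_weight_add half_weight_scale by (rule sq_norm_add) measurable
      also have "\<dots> \<le> 2 * (ennreal (1\<^sup>2) * ennreal C) + 2 * (ennreal (L\<^sup>2) * ennreal C)"
      proof (intro add_mono mult_left_mono)
        have "sq_norm lborel (\<lambda>z. bump R 0 z *\<^sub>R half_weight \<phi> (g b) z) \<le> ennreal (1\<^sup>2) * sq_norm lborel (half_weight \<phi> (g b))"
          by (rule sq_norm_scale_le) (auto simp: bump_nonneg bump_le_1)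
        also have "\<dots> \<le> ennreal (1\<^sup>2) * ennreal C"
          by (intro mult_left_mono g) auto
        finally show "sq_norm lborel (\<lambda>z. bump R 0 z *\<^sub>R half_weight \<phi> (g b) z) \<le> ennreal (1\<^sup>2) * ennreal C" .
        have "\<bar>bump' R 0 b z\<bar> \<le> L" for z
        proof -
          have "\<bar>bump' R 0 b z\<bar> \<le> L / R * norm b"
            by (rule L(2)[OF R0])
          also have "\<dots> \<le> L"
            using b R mult_left_mono[OF R L(1)] by (simp add: divide_le_eq)
          finally show ?thesis .
        qed
        then have "sq_norm lborel (\<lambda>z. bump' R 0 b z *\<^sub>R half_weight \<phi> f z) \<le> ennreal (L\<^sup>2) * sq_norm lborel (half_weight \<phi> f)"
          by (intro sq_norm_scale_le) auto
        also have "\<dots> \<le> ennreal (L\<^sup>2) * ennreal C"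
          by (intro mult_left_mono f) auto
        finally show "sq_norm lborel (\<lambda>z. bump' R 0 b z *\<^sub>R half_weight \<phi> f z) \<le> ennreal (L\<^sup>2) * ennreal C" .
      qed auto
      also have "\<dots> = ennreal Q"
        using C by (simp add: Q_def ennreal_mult)
      finally have "(LINT z|lborel. exp (- \<phi> z) * (q z \<bullet> q z)) \<le> Q"
        using Q by simp
      then have "1 / t * (LINT z|lborel. exp (- \<phi> z) * (q z \<bullet> q z)) \<le> 1 / t * Q"
        using t by (intro mult_left_mono) auto
      with E(1) show ?thesis
        unfolding T_def by (auto intro: order_trans)
    qed
    have eq: "potential \<phi> \<eta> \<epsilon> z * (cmod (half_weight \<phi> v z))\<^sup>2 = (\<Sum>b\<in>Basis. (1 + \<epsilon>) * T b z)" for z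
    proof -
      have "(1 + \<epsilon>) * (\<eta> * dir_deriv b (dir_deriv b \<phi>) z + (1 - t) * (\<eta> * dir_deriv b \<phi> z)\<^sup>2)
        = (\<eta> * dir_deriv b \<phi> z)\<^sup>2 + (1 + \<epsilon>) * \<eta> * dir_deriv b (dir_deriv b \<phi>) z" for b
        using t(2) by (simp add: distrib_left mult.assoc[symmetric])
      then have "(1 + \<epsilon>) * T b z = ((\<eta> * dir_deriv b \<phi> z)\<^sup>2 + (1 + \<epsilon>) * \<eta> * dir_deriv b (dir_deriv b \<phi>) z) * (exp (- \<phi> z) * (v z \<bullet> v z))" for b
        unfolding T_def by (simp add: ac_simps)
      then show ?thesis
        by (simp add: potential_Basis norm_half_weight_sq_inner sum_distrib_right)
    qed
    have "integrable lborel (\<lambda>z. \<Sum>b\<in>Basis. (1 + \<epsilon>) * T b z)"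
      using T_int by auto
    moreover have "(LINT z|lborel. (\<Sum>b\<in>Basis. (1 + \<epsilon>) * T b z)) \<le> C1"
    proof -
      have "(LINT z|lborel. (\<Sum>b\<in>Basis. (1 + \<epsilon>) * T b z)) = (\<Sum>b\<in>Basis. (1 + \<epsilon>) * (LINT z|lborel. T b z))"
        using T_int by (subst Bochner_Integration.integral_sum) auto
      also have "\<dots> \<le> C1"
        unfolding C1_def using \<epsilon> by (intro sum_mono mult_left_mono T_le) auto
      finally show ?thesis .
    qed
    ultimately show ?thesis
      unfolding v_def[symmetric] eq by blast
  qed
  ultimately show ?thesis
    by blast
qed

text \<open>The energy bound together with a lower bound \<open>K\<close> of the potential outside a ball, and \<open>- m\<close>
  everywhere, limits the mass of the cut off functions outside that ball to
  \<open>(C1 + m * C) / K\<close>. Cutoffs of growing radius exhaust the function by the lemma of Fatou.\<close>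

lemma tail_estimate:
  fixes \<phi> :: "complex^'n \<Rightarrow> real"
  assumes \<phi>: "Ck 2 \<phi>" and \<epsilon>: "\<epsilon> > 0" and lim: "filterlim (potential \<phi> \<eta> \<epsilon>) at_top at_infinity"
    and C: "C \<ge> 0" and e: "e > 0"
  shows "\<exists>R>0. \<forall>f g. W1_data \<phi> \<eta> C f g \<longrightarrow>
    (\<integral>\<^sup>+z. indicator {z. R \<le> norm z} z * ennreal ((cmod (half_weight \<phi> f z))\<^sup>2) \<partial>lborel) \<le> ennreal e"
proof -
  let ?V = "potential \<phi> \<eta> \<epsilon>"
  note \<phi>_cont = Ck2_facts(2)[OF \<phi>]
  note [measurable] = half_weight_borel[OF \<phi>_cont]
  have V_cont: "continuous_on UNIV ?V"
    by (rule continuous_potential[OF \<phi>])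
  have V_large: "\<exists>r. \<forall>z. norm z \<ge> r \<longrightarrow> ?V z \<ge> K" for K
    using lim unfolding filterlim_at_top eventually_at_infinity by blast
  obtain m where m: "m \<ge> 0" "\<And>z. ?V z \<ge> - m"
  proof -
    obtain r where r: "\<And>z. norm z \<ge> r \<Longrightarrow> ?V z \<ge> 0"
      using V_large[of 0] by blast
    obtain K where K: "K > 0" "\<And>z. norm z \<le> r \<Longrightarrow> \<bar>?V z\<bar> \<le> K"
      using continuous_bounded_on_cball[OF V_cont] by blast
    have "?V z \<ge> - K" for z
      using r[of z] K(1) K(2)[of z] by (cases "norm z \<le> r") auto
    then show thesis
      using that[of K] K(1) by simp
  qed
  obtain C1 where C1: "C1 \<ge> 0" and energy: "\<And>f g R. W1_data \<phi> \<eta> C f g \<Longrightarrow> R \<ge> 1 \<Longrightarrow>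
    integrable lborel (\<lambda>z. ?V z * (cmod (half_weight \<phi> (\<lambda>z. bump R 0 z *\<^sub>R f z) z))\<^sup>2) \<and>
    (LINT z|lborel. ?V z * (cmod (half_weight \<phi> (\<lambda>z. bump R 0 z *\<^sub>R f z) z))\<^sup>2) \<le> C1"
    using energy_bound[OF \<phi> \<epsilon> C, of \<eta>] by blast
  \<comment> \<open>a lower bound of every cutoff on the ball of half its radius\<close>
  define c where "c = exp (- (4 / 3) :: real)"
  have c: "c > 0"
    by (simp add: c_def)
  \<comment> \<open>chosen such that \<open>(C1 + m * C) / K \<le> e * c\<^sup>2\<close>\<close>
  define K where "K = (C1 + m * C) / (e * c\<^sup>2) + 1"
  have Cm: "C1 + m * C \<ge> 0"
    using C1 m C by simp
  then have K: "K > 0"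
    using e c by (auto simp: K_def intro!: add_nonneg_pos divide_nonneg_pos)
  have "(C1 + m * C) / (e * c\<^sup>2) \<le> K"
    by (simp add: K_def)
  then have K2: "C1 + m * C \<le> K * (e * c\<^sup>2)"
    using e c by (subst (asm) pos_divide_le_eq) auto
  obtain r where r: "\<And>z. norm z \<ge> r \<Longrightarrow> ?V z \<ge> K"
    using V_large[of K] by blast
  define R where "R = max r 1"
  have "(\<integral>\<^sup>+z. indicator {z. R \<le> norm z} z * ennreal ((cmod (half_weight \<phi> f z))\<^sup>2) \<partial>lborel) \<le> ennreal e"
    if data: "W1_data \<phi> \<eta> C f g" for f g
  proof -
    have [measurable]: "f \<in> borel_measurable borel" and f: "sq_norm lborel (half_weight \<phi> f) \<le> ennreal C"
      using data by (simp_all add: W1_data_def)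
    define v where "v n z = bump (real (Suc n)) 0 z *\<^sub>R f z" for n z
    have [measurable]: "v n \<in> borel_measurable borel" for n
      unfolding v_def[abs_def] by measurable
    define u where "u n z = (cmod (half_weight \<phi> (v n) z))\<^sup>2" for n z
    have [measurable]: "u n \<in> borel_measurable borel" for n
      unfolding u_def[abs_def] by measurable
    let ?I = "\<lambda>z. indicator {z. R \<le> norm z} z :: real"
    have bound: "(\<integral>\<^sup>+z. ennreal (?I z * u n z) \<partial>lborel) \<le> ennreal (e * c\<^sup>2)" for n
    proof -
      have V_int: "integrable lborel (\<lambda>z. ?V z * u n z)" and V_le: "(LINT z|lborel. ?V z * u n z) \<le> C1"
        using energy[OF data, of "real (Suc n)"] unfolding u_def v_def[abs_def] by auto
      have "sq_norm lborel (half_weight \<phi> (v n)) \<le> ennreal (1\<^sup>2) * sq_norm lborel (half_weight \<phi> f)"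
        unfolding v_def[abs_def] half_weight_scale by (rule sq_norm_scale_le) (auto simp: bump_nonneg bump_le_1)
      also have "\<dots> \<le> ennreal C"
        using f by simp
      finally have u_le: "(\<integral>\<^sup>+z. ennreal (u n z) \<partial>lborel) \<le> ennreal C"
        by (simp add: sq_norm_def u_def)
      have u_nn: "u n z \<ge> 0" for z
        by (simp add: u_def)
      have u_int: "integrable lborel (u n)"
        unfolding integrable_iff_bounded using u_le u_nn by (auto simp: order_le_less_trans)
      have u_LINT: "(LINT z|lborel. u n z) \<le> C"
        using u_le C u_nn by (subst (asm) nn_integral_eq_integral[OF u_int]) auto
      have I_int: "integrable lborel (\<lambda>z. ?I z * u n z)"
        using u_nn by (intro Bochner_Integration.integrable_bound[OF u_int]) (auto simp: indicator_def)
      have "K * (LINT z|lborel. ?I z * u n z) = (LINT z|lborel. K * (?I z * u n z))"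
        by simp
      also have "\<dots> \<le> (LINT z|lborel. ?V z * u n z + m * u n z)"
      proof (rule integral_mono)
        fix z
        have "K * ?I z \<le> ?V z + m"
          using r[of z] m(1) m(2)[of z] K by (auto simp: indicator_def R_def)
        from mult_right_mono[OF this u_nn[of z]]
        show "K * (?I z * u n z) \<le> ?V z * u n z + m * u n z"
          by (simp add: algebra_simps)
      qed (use I_int V_int u_int in auto)
      also have "\<dots> = (LINT z|lborel. ?V z * u n z) + m * (LINT z|lborel. u n z)"
        using V_int u_int by simp
      also have "\<dots> \<le> C1 + m * C"
        using V_le u_LINT m(1) by (intro add_mono mult_left_mono)
      also have "\<dots> \<le> K * (e * c\<^sup>2)"
        by (rule K2)
      finally have "(LINT z|lborel. ?I z * u n z) \<le> e * c\<^sup>2"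
        using K by simp
      then show ?thesis
        using u_nn by (subst nn_integral_eq_integral[OF I_int]) (auto intro!: ennreal_leI)
    qed
    have "ennreal (c\<^sup>2) * (\<integral>\<^sup>+z. indicator {z. R \<le> norm z} z * ennreal ((cmod (half_weight \<phi> f z))\<^sup>2) \<partial>lborel)
      = (\<integral>\<^sup>+z. ennreal (c\<^sup>2) * (indicator {z. R \<le> norm z} z * ennreal ((cmod (half_weight \<phi> f z))\<^sup>2)) \<partial>lborel)"
      by (rule nn_integral_cmult[symmetric]) measurable
    also have "\<dots> \<le> (\<integral>\<^sup>+z. liminf (\<lambda>n. ennreal (?I z * u n z)) \<partial>lborel)"
    proof (intro nn_integral_mono Liminf_bounded)
      fix z :: "complex^'n"
      obtain N :: nat where N: "2 * norm z \<le> real N"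
        using real_arch_simple by blast
      show "\<forall>\<^sub>F n in sequentially. ennreal (c\<^sup>2) * (indicator {z. R \<le> norm z} z * ennreal ((cmod (half_weight \<phi> f z))\<^sup>2)) \<le> ennreal (?I z * u n z)"
        using eventually_ge_at_top[of N]
      proof eventually_elim
        case (elim n)
        then have "norm z \<le> real (Suc n) / 2"
          using N by simp
        then have "c \<le> bump (real (Suc n)) 0 z"
          unfolding c_def by (intro bump_ge_on_half_ball) auto
        then have "c\<^sup>2 * (cmod (half_weight \<phi> f z))\<^sup>2 \<le> (bump (real (Suc n)) 0 z)\<^sup>2 * (cmod (half_weight \<phi> f z))\<^sup>2"
          using c by (intro mult_right_mono power_mono) auto
        also have "\<dots> = u n z"
          unfolding u_def v_def[abs_def] half_weight_scale by (simp add: power_mult_distrib)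
        finally have "ennreal (c\<^sup>2 * (cmod (half_weight \<phi> f z))\<^sup>2) \<le> ennreal (u n z)"
          by (rule ennreal_leI)
        then show ?case
          by (auto simp: indicator_def ennreal_mult)
      qed
    qed
    also have "\<dots> \<le> liminf (\<lambda>n. \<integral>\<^sup>+z. ennreal (?I z * u n z) \<partial>lborel)"
      by (rule nn_integral_liminf) measurable
    also have "\<dots> \<le> ennreal (e * c\<^sup>2)"
      by (intro Liminf_le always_eventually allI bound) simp
    also have "\<dots> = ennreal (c\<^sup>2) * ennreal e"
      using e by (simp add: ennreal_mult mult.commute)
    finally show ?thesis
      using c by (subst (asm) ennreal_mult_le_mult_iff) auto
  qed
  moreover have "R > 0"
    by (simp add: R_def)
  ultimately show ?thesis
    by blast
qed

section \<open>Compactness of the embedding\<close>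

lemma L2_fun_cong_AE:
  assumes "continuous_on UNIV \<phi>" "f \<in> L2_fun \<phi>" "AE z in lebesgue. f z = f' z"
  shows "f' \<in> L2_fun \<phi>" "sq_norm lebesgue (half_weight \<phi> f') = sq_norm lebesgue (half_weight \<phi> f)"
proof -
  have m: "f' \<in> borel_measurable lebesgue"
    using assms lebesgue_measurable_cong_AE[of f f'] by (auto simp: L2_fun_def)
  show eq: "sq_norm lebesgue (half_weight \<phi> f') = sq_norm lebesgue (half_weight \<phi> f)"
    unfolding sq_norm_def using assms(3)
    by (intro nn_integral_cong_AE) (auto simp: half_weight_def elim: eventually_mono)
  show "f' \<in> L2_fun \<phi>"
    using m assms(2) by (simp add: L2_fun_iff[OF assms(1)] eq)
qed

lemma is_X_cong_AE_value:
  assumes "continuous_on UNIV \<phi>" "is_X \<phi> \<eta> v f g" "AE z in lebesgue. g z = g' z"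
  shows "is_X \<phi> \<eta> v f g'"
proof -
  have "(LINT z|lebesgue. g z * \<psi> z) = (LINT z|lebesgue. g' z * \<psi> z)" for \<psi>
    using assms(3) by (intro lebesgue_integral_cong_AE) (auto elim: eventually_mono)
  then show ?thesis
    using assms L2_fun_cong_AE(1)[OF assms(1) _ assms(3)] by (auto simp: is_X_def)
qed

lemma W1_data_exists:
  fixes \<phi> :: "complex^'n \<Rightarrow> real"
  assumes \<phi>: "continuous_on UNIV \<phi>" and f: "f \<in> W1_fun \<phi> \<eta>" and N: "W1_norm \<phi> \<eta> f \<le> N"
  shows "\<exists>f' g. (f, f') \<in> ae_rel \<phi> \<and> W1_data \<phi> \<eta> (N\<^sup>2) f' g"
proof -
  have f_L2: "f \<in> L2_fun \<phi>"
    using f W1_fun_subset by blast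
  have S: "0 \<le> (\<Sum>b\<in>Basis. (L2_norm \<phi> (X_op \<phi> \<eta> b f))\<^sup>2)"
    by (intro sum_nonneg) auto
  have W: "(W1_norm \<phi> \<eta> f)\<^sup>2 = (L2_norm \<phi> f)\<^sup>2 + (\<Sum>b\<in>Basis. (L2_norm \<phi> (X_op \<phi> \<eta> b f))\<^sup>2)"
    using S by (simp add: W1_norm_def sum_Basis_complex_vec)
  have "0 \<le> W1_norm \<phi> \<eta> f"
    unfolding W1_norm_def by (intro real_sqrt_ge_zero add_nonneg_nonneg sum_nonneg) auto
  then have WN: "(W1_norm \<phi> \<eta> f)\<^sup>2 \<le> N\<^sup>2"
    using N by (intro power_mono)
  have f_le: "(L2_norm \<phi> f)\<^sup>2 \<le> N\<^sup>2"
    using W WN S by linarith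
  have X_le: "(L2_norm \<phi> (X_op \<phi> \<eta> b f))\<^sup>2 \<le> N\<^sup>2" if "b \<in> Basis" for b
  proof -
    have "(L2_norm \<phi> (X_op \<phi> \<eta> b f))\<^sup>2 \<le> (\<Sum>b\<in>Basis. (L2_norm \<phi> (X_op \<phi> \<eta> b f))\<^sup>2)"
      using that by (intro member_le_sum) auto
    then show ?thesis
      using W WN zero_le_power2[of "L2_norm \<phi> f"] by linarith
  qed
  have X: "is_X \<phi> \<eta> b f (X_op \<phi> \<eta> b f)" if b: "b \<in> Basis" for b
  proof -
    obtain j where "b = xdir j \<or> b = ydir j"
      using b by (rule Basis_complex_vecE)
    then have "\<exists>g. is_X \<phi> \<eta> b f g"
      using f by (auto simp: W1_fun_def)
    then show ?thesis
      unfolding X_op_def by (rule someI_ex)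
  qed
  obtain f' where f': "f' \<in> borel_measurable borel" "AE z in lebesgue. f z = f' z"
    using borel_representative f_L2 by (auto simp: L2_fun_def)
  have f'_L2: "f' \<in> L2_fun \<phi>"
    by (rule L2_fun_cong_AE(1)[OF \<phi> f_L2 f'(2)])
  have rel: "(f, f') \<in> ae_rel \<phi>"
    using f_L2 f'_L2 f'(2) by (simp add: ae_rel_def)
  have "\<forall>b\<in>Basis. \<exists>h. h \<in> borel_measurable borel \<and> (AE z in lebesgue. X_op \<phi> \<eta> b f z = h z)"
  proof
    fix b :: "complex^'n" assume "b \<in> Basis"
    then have "X_op \<phi> \<eta> b f \<in> borel_measurable lebesgue"
      using X by (auto simp: is_X_def L2_fun_def)
    from borel_representative[OF this]
    show "\<exists>h. h \<in> borel_measurable borel \<and> (AE z in lebesgue. X_op \<phi> \<eta> b f z = h z)"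
      by blast
  qed
  then obtain g where g: "\<And>b. b \<in> Basis \<Longrightarrow> g b \<in> borel_measurable borel"
    "\<And>b. b \<in> Basis \<Longrightarrow> AE z in lebesgue. X_op \<phi> \<eta> b f z = g b z"
    by metis
  have meas: "half_weight \<phi> h \<in> borel_measurable borel" if "h \<in> borel_measurable borel" for h
    using half_weight_borel[OF \<phi>] that by blast
  have bound: "sq_norm lborel (half_weight \<phi> h') \<le> ennreal (N\<^sup>2)"
    if "h \<in> L2_fun \<phi>" "AE z in lebesgue. h z = h' z" "h' \<in> borel_measurable borel" "(L2_norm \<phi> h)\<^sup>2 \<le> N\<^sup>2" for h h'
  proof -
    have "sq_norm lborel (half_weight \<phi> h') = sq_norm lebesgue (half_weight \<phi> h)"
      unfolding sq_norm_lebesgue_eq_lborel[OF meas[OF that(3)], symmetric]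
      by (rule L2_fun_cong_AE(2)[OF \<phi> that(1,2)])
    also have "\<dots> = ennreal ((L2_norm \<phi> h)\<^sup>2)"
      by (rule L2_norm_sq[OF \<phi> that(1), symmetric])
    also have "\<dots> \<le> ennreal (N\<^sup>2)"
      by (rule ennreal_leI[OF that(4)])
    finally show ?thesis .
  qed
  have "W1_data \<phi> \<eta> (N\<^sup>2) f' g"
    unfolding W1_data_def
  proof (intro conjI ballI)
    show "sq_norm lborel (half_weight \<phi> f') \<le> ennreal (N\<^sup>2)"
      by (rule bound[OF f_L2 f'(2,1) f_le])
    fix b :: "complex^'n" assume b: "b \<in> Basis"
    have "X_op \<phi> \<eta> b f \<in> L2_fun \<phi>"
      using X[OF b] by (simp add: is_X_def)
    then show "sq_norm lborel (half_weight \<phi> (g b)) \<le> ennreal (N\<^sup>2)"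
      by (rule bound[OF _ g(2)[OF b] g(1)[OF b] X_le[OF b]])
    have "is_X \<phi> \<eta> b f (g b)"
      by (rule is_X_cong_AE_value[OF \<phi> X[OF b] g(2)[OF b]])
    then show "is_X \<phi> \<eta> b f' (g b)"
      by (simp add: is_X_cong_AE[OF rel])
  qed (use f' g in auto)
  with rel show ?thesis
    by blast
qed

text \<open>On the support of a fixed cutoff the gradient of \<open>\<phi>\<close> and the reciprocal of the weight are
  bounded, so that the weak derivatives of the cut off functions are uniformly bounded in the unweighted \<open>L\<^sup>2\<close>.\<close>

lemma cutoff_close_pair:
  fixes \<phi> :: "complex^'n \<Rightarrow> real" and f :: "nat \<Rightarrow> complex^'n \<Rightarrow> complex"
  assumes \<phi>: "Ck 2 \<phi>" and C: "C \<ge> 0" and data: "\<And>n. W1_data \<phi> \<eta> C (f n) (g n)" and R: "R > 0" and e: "e > 0"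
  shows "\<exists>i j. i < j \<and> sq_norm lborel (\<lambda>z. bump R 0 z *\<^sub>R f i z - bump R 0 z *\<^sub>R f j z) \<le> ennreal e"
proof -
  note \<phi>_cont = Ck2_facts(2)[OF \<phi>]
  let ?\<theta> = "bump R (0 :: complex^'n)" and ?\<theta>' = "\<lambda>b. bump' R (0 :: complex^'n) b"
  define c where "c b z = ((1 + \<eta>) / 2 * dir_deriv b \<phi> z)" for b z
  define w where "w n b z = (?\<theta> z *\<^sub>R g n b z + ?\<theta>' b z *\<^sub>R f n z) + c b z *\<^sub>R (?\<theta> z *\<^sub>R f n z)" for n b z
  have out: "?\<theta> z = 0" "?\<theta>' b z = 0" if "norm z \<ge> R" for z b
    using bump_outside[OF R, of z 0] that by simp_all
  have fm: "f n \<in> borel_measurable borel" and f: "sq_norm lborel (half_weight \<phi> (f n)) \<le> ennreal C" for n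
    using data[of n] by (simp_all add: W1_data_def)
  have gm: "g n b \<in> borel_measurable borel" and g: "sq_norm lborel (half_weight \<phi> (g n b)) \<le> ennreal C"
    and X: "is_X \<phi> \<eta> b (f n) (g n b)" if "b \<in> Basis" for n b
    using data[of n] that by (simp_all add: W1_data_def)
  have fin: "sq_norm lborel (half_weight \<phi> (f n)) < \<infinity>" "b \<in> Basis \<Longrightarrow> sq_norm lborel (half_weight \<phi> (g n b)) < \<infinity>" for n b
    using f[of n] g[of b n] by (auto simp: order_le_less_trans)
  have c_cont: "continuous_on UNIV (c b)" if "b \<in> Basis" for b
    unfolding c_def[abs_def] by (intro continuous_intros Ck2_facts(4)[OF \<phi> that])
  have K_ex: "\<exists>K\<ge>0. \<forall>h\<in>borel_measurable borel. sq_norm lborel (half_weight \<phi> h) \<le> ennreal C \<longrightarrow>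
      sq_norm lborel (\<lambda>z. E z *\<^sub>R h z) \<le> ennreal K"
    if E: "continuous_on UNIV E" "\<And>z. norm z \<ge> R \<Longrightarrow> E z = 0" for E :: "complex^'n \<Rightarrow> real"
  proof -
    obtain K where K: "K \<ge> 0" "\<And>h. h \<in> borel_measurable borel \<Longrightarrow>
        sq_norm lborel (\<lambda>z. E z *\<^sub>R h z) \<le> ennreal K * sq_norm lborel (half_weight \<phi> h)"
      using sq_norm_cutoff[OF \<phi>_cont E] by blast
    show ?thesis
    proof (intro exI[of _ "K * C"] conjI ballI impI)
      fix h :: "complex^'n \<Rightarrow> complex"
      assume h: "h \<in> borel_measurable borel" "sq_norm lborel (half_weight \<phi> h) \<le> ennreal C"
      have "sq_norm lborel (\<lambda>z. E z *\<^sub>R h z) \<le> ennreal K * ennreal C"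
        using K(2)[OF h(1)] h(2) by (meson mult_left_mono order_trans zero_le)
      then show "sq_norm lborel (\<lambda>z. E z *\<^sub>R h z) \<le> ennreal (K * C)"
        using K(1) C by (simp add: ennreal_mult)
    qed (use K C in simp)
  qed
  obtain K0 where K0: "K0 \<ge> 0" "\<And>h. h \<in> borel_measurable borel \<Longrightarrow> sq_norm lborel (half_weight \<phi> h) \<le> ennreal C \<Longrightarrow>
      sq_norm lborel (\<lambda>z. ?\<theta> z *\<^sub>R h z) \<le> ennreal K0"
    using K_ex[OF continuous_bump out(1)] by blast
  have "\<forall>b\<in>Basis. \<exists>K\<ge>0. \<forall>h\<in>borel_measurable borel. sq_norm lborel (half_weight \<phi> h) \<le> ennreal C \<longrightarrow>
      sq_norm lborel (\<lambda>z. (?\<theta>' b z + c b z * ?\<theta> z) *\<^sub>R h z) \<le> ennreal K"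
    by (intro ballI K_ex continuous_intros continuous_bump continuous_bump' c_cont) (auto simp: out)
  then obtain K where K: "\<And>b. b \<in> Basis \<Longrightarrow> K b \<ge> 0" "\<And>b h. b \<in> Basis \<Longrightarrow> h \<in> borel_measurable borel \<Longrightarrow> sq_norm lborel (half_weight \<phi> h) \<le> ennreal C \<Longrightarrow>
      sq_norm lborel (\<lambda>z. (?\<theta>' b z + c b z * ?\<theta> z) *\<^sub>R h z) \<le> ennreal (K b)"
    by (elim bchoice[THEN exE]) blast
  define D where "D = 2 * K0 + 2 * (\<Sum>b\<in>Basis. K b)"
  have SK: "K b \<le> (\<Sum>b\<in>Basis. K b)" if "b \<in> Basis" for b
    using K(1) that by (intro member_le_sum) auto
  have S0: "(\<Sum>b\<in>Basis. K b) \<ge> 0"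
    using K(1) by (intro sum_nonneg)
  have w_eq: "w n b = (\<lambda>z. ?\<theta> z *\<^sub>R g n b z + (?\<theta>' b z + c b z * ?\<theta> z) *\<^sub>R f n z)" for n b
    by (auto simp: w_def fun_eq_iff scaleR_add_left)
  show ?thesis
  proof (rule rellich_close_pair[where w=w and R=R and C=D])
    show "(\<lambda>z. ?\<theta> z *\<^sub>R f n z) \<in> borel_measurable borel" for n
      using fm[of n] by measurable
    show "?\<theta> z *\<^sub>R f n z = 0" if "norm z \<ge> R" for n z
      using out(1)[OF that] by simp
    have i1: "integrable lborel (\<lambda>z. ?\<theta> z *\<^sub>R g n b z)" if "b \<in> Basis" for n b
      by (rule cutoff_L2(2)[OF \<phi>_cont continuous_bump out(1) gm[OF that] fin(2)[OF that]])
    have i2: "integrable lborel (\<lambda>z. (?\<theta>' b z + c b z * ?\<theta> z) *\<^sub>R f n z)" if "b \<in> Basis" for n b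
      by (rule cutoff_L2(2)[OF \<phi>_cont _ _ fm fin(1), where R=R], intro continuous_intros continuous_bump continuous_bump' c_cont that)
         (simp add: out)
    show "integrable lborel (w n b)" if "b \<in> Basis" for n b
      unfolding w_eq by (rule Bochner_Integration.integrable_add[OF i1[OF that] i2[OF that]])
    show "weak_dderiv b (\<lambda>z. ?\<theta> z *\<^sub>R f n z) (w n b)" if b: "b \<in> Basis" for n b
      using is_X_cutoff_weak_dderiv[OF \<phi>_cont R fm gm[OF b] fin(1) fin(2)[OF b] X[OF b] Ck2_facts(4)[OF \<phi> b]]
      unfolding w_def[abs_def] c_def .
    show "sq_norm lborel (\<lambda>z. ?\<theta> z *\<^sub>R f n z) \<le> ennreal D" for n
      by (rule order_trans[OF K0(2)[OF fm f] ennreal_leI]) (use K0(1) S0 in \<open>simp add: D_def\<close>)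
    show "sq_norm lborel (w n b) \<le> ennreal D" if b: "b \<in> Basis" for n b
    proof -
      have "sq_norm lborel (w n b) \<le> 2 * sq_norm lborel (\<lambda>z. ?\<theta> z *\<^sub>R g n b z)
          + 2 * sq_norm lborel (\<lambda>z. (?\<theta>' b z + c b z * ?\<theta> z) *\<^sub>R f n z)"
        unfolding w_eq by (intro sq_norm_add borel_measurable_integrable i1 i2 b)
      also have "\<dots> \<le> 2 * ennreal K0 + 2 * ennreal (\<Sum>b\<in>Basis. K b)"
        by (intro add_mono mult_left_mono K0(2) gm g b order_trans[OF K(2)[OF b fm f]] ennreal_leI SK) auto
      also have "\<dots> = ennreal D"
        using K0(1) S0 by (simp add: D_def ennreal_mult)
      finally show ?thesis .
    qed
    show "D \<ge> 0"
      using K0(1) S0 by (simp add: D_def)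
  qed (rule e)
qed

text \<open>Outside a large ball both functions are small; inside it the cutoff of twice the radius is
  bounded away from \<open>0\<close>, so that closeness of the cut off functions transfers.\<close>

lemma W1_close_pair:
  fixes \<phi> :: "complex^'n \<Rightarrow> real" and f :: "nat \<Rightarrow> complex^'n \<Rightarrow> complex"
  assumes \<phi>: "Ck 2 \<phi>" and \<epsilon>: "\<epsilon> > 0" and lim: "filterlim (potential \<phi> \<eta> \<epsilon>) at_top at_infinity"
    and C: "C \<ge> 0" and data: "\<And>n. W1_data \<phi> \<eta> C (f n) (g n)" and e: "e > 0"
  shows "\<exists>i j. i < j \<and> sq_norm lborel (\<lambda>z. half_weight \<phi> (f i) z - half_weight \<phi> (f j) z) \<le> ennreal e"
proof -
  note \<phi>_cont = Ck2_facts(2)[OF \<phi>]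
  note [measurable] = half_weight_borel[OF \<phi>_cont]
  have fm [measurable]: "f n \<in> borel_measurable borel" for n
    using data[of n] by (simp add: W1_data_def)
  obtain R where R: "R > 0" and tail: "\<And>n. (\<integral>\<^sup>+z. indicator {z. R \<le> norm z} z * ennreal ((cmod (half_weight \<phi> (f n) z))\<^sup>2) \<partial>lborel) \<le> ennreal (e / 8)"
    using tail_estimate[OF \<phi> \<epsilon> lim C, of "e / 8"] data e by auto
  let ?\<theta> = "bump (2 * R) (0 :: complex^'n)"
  define c where "c = exp (- (4 / 3) :: real)"
  have c: "c > 0" "\<And>z. norm z \<le> R \<Longrightarrow> c \<le> ?\<theta> z"
    unfolding c_def by (simp, rule bump_ge_on_half_ball) (use R in auto)
  have "continuous_on UNIV (\<lambda>z. exp (- \<phi> z))"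
    by (intro continuous_intros \<phi>_cont)
  then obtain M where M0: "M > 0" and M: "\<And>z. norm z \<le> R \<Longrightarrow> exp (- \<phi> z) \<le> M"
    by (rule continuous_bounded_on_cball[where r=R]) auto
  define e' where "e' = e / 2 / (M / c\<^sup>2)"
  have e': "e' > 0" "M / c\<^sup>2 * e' = e / 2"
    using e M0 c(1) by (auto simp: e'_def)
  obtain i j where ij: "i < j" and close: "sq_norm lborel (\<lambda>z. ?\<theta> z *\<^sub>R f i z - ?\<theta> z *\<^sub>R f j z) \<le> ennreal e'"
    using cutoff_close_pair[where f=f and g=g, OF \<phi> C data _ e'(1), of "2 * R"] R by auto
  let ?h = "\<lambda>n z. ennreal ((cmod (half_weight \<phi> (f n) z))\<^sup>2)" and ?I = "\<lambda>z. indicator {z. R \<le> norm z} z :: ennreal"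
  have "sq_norm lborel (\<lambda>z. half_weight \<phi> (f i) z - half_weight \<phi> (f j) z)
    \<le> (\<integral>\<^sup>+z. ennreal (M / c\<^sup>2) * ennreal ((cmod (?\<theta> z *\<^sub>R f i z - ?\<theta> z *\<^sub>R f j z))\<^sup>2) + (2 * (?I z * ?h i z) + 2 * (?I z * ?h j z)) \<partial>lborel)"
    unfolding sq_norm_def
  proof (intro nn_integral_mono)
    fix z
    show "ennreal ((cmod (half_weight \<phi> (f i) z - half_weight \<phi> (f j) z))\<^sup>2)
      \<le> ennreal (M / c\<^sup>2) * ennreal ((cmod (?\<theta> z *\<^sub>R f i z - ?\<theta> z *\<^sub>R f j z))\<^sup>2) + (2 * (?I z * ?h i z) + 2 * (?I z * ?h j z))"
    proof (cases "R \<le> norm z")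
      case True
      have "(cmod (half_weight \<phi> (f i) z - half_weight \<phi> (f j) z))\<^sup>2
        \<le> 2 * (cmod (half_weight \<phi> (f i) z))\<^sup>2 + 2 * (cmod (half_weight \<phi> (f j) z))\<^sup>2"
        using norm_add_sq_le[of "half_weight \<phi> (f i) z" "- half_weight \<phi> (f j) z"] by simp
      then have "ennreal ((cmod (half_weight \<phi> (f i) z - half_weight \<phi> (f j) z))\<^sup>2) \<le> 2 * ?h i z + 2 * ?h j z"
        by (simp add: ennreal_leI ennreal_mult[symmetric] flip: ennreal_plus ennreal_numeral)
      also have "\<dots> \<le> ennreal (M / c\<^sup>2) * ennreal ((cmod (?\<theta> z *\<^sub>R f i z - ?\<theta> z *\<^sub>R f j z))\<^sup>2) + (2 * (?I z * ?h i z) + 2 * (?I z * ?h j z))"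
        using True by (simp add: add_increasing)
      finally show ?thesis .
    next
      case False
      have "(cmod (half_weight \<phi> (f i) z - half_weight \<phi> (f j) z))\<^sup>2 = (cmod (f i z - f j z))\<^sup>2 * exp (- \<phi> z)"
        using norm_half_weight_sq[of \<phi> "\<lambda>z. f i z - f j z" z] by (simp add: half_weight_diff)
      also have "\<dots> \<le> (cmod (f i z - f j z))\<^sup>2 * M"
        using False by (intro mult_left_mono M) auto
      also have "\<dots> = M / c\<^sup>2 * (c\<^sup>2 * (cmod (f i z - f j z))\<^sup>2)"
        using c(1) by simp
      also have "\<dots> \<le> M / c\<^sup>2 * ((?\<theta> z)\<^sup>2 * (cmod (f i z - f j z))\<^sup>2)"
        using False c M0 by (intro mult_left_mono mult_right_mono power_mono) auto
      also have "\<dots> = M / c\<^sup>2 * (cmod (?\<theta> z *\<^sub>R f i z - ?\<theta> z *\<^sub>R f j z))\<^sup>2"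
        by (simp add: scaleR_diff_right[symmetric] power_mult_distrib del: scaleR_right_diff_distrib)
      finally have "ennreal ((cmod (half_weight \<phi> (f i) z - half_weight \<phi> (f j) z))\<^sup>2)
          \<le> ennreal (M / c\<^sup>2 * (cmod (?\<theta> z *\<^sub>R f i z - ?\<theta> z *\<^sub>R f j z))\<^sup>2)"
        by (rule ennreal_leI)
      also have "\<dots> = ennreal (M / c\<^sup>2) * ennreal ((cmod (?\<theta> z *\<^sub>R f i z - ?\<theta> z *\<^sub>R f j z))\<^sup>2)"
        using M0 by (intro ennreal_mult) auto
      finally show ?thesis
        using False by simp
    qed
  qed
  also have "\<dots> = ennreal (M / c\<^sup>2) * sq_norm lborel (\<lambda>z. ?\<theta> z *\<^sub>R f i z - ?\<theta> z *\<^sub>R f j z)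
      + (2 * (\<integral>\<^sup>+z. ?I z * ?h i z \<partial>lborel) + 2 * (\<integral>\<^sup>+z. ?I z * ?h j z \<partial>lborel))"
    unfolding sq_norm_def by (simp add: nn_integral_add nn_integral_cmult)
  also have "\<dots> \<le> ennreal (M / c\<^sup>2) * ennreal e' + (2 * ennreal (e / 8) + 2 * ennreal (e / 8))"
    by (intro add_mono mult_left_mono close tail) auto
  also have "\<dots> = ennreal (M / c\<^sup>2 * e' + (2 * (e / 8) + 2 * (e / 8)))"
    using M0 e e'(1) by (simp add: ennreal_mult ennreal_plus del: times_divide_eq_left times_divide_eq_right flip: distrib_right)
  also have "\<dots> = ennreal e"
    unfolding e'(2) by simp
  finally show ?thesis
    using ij by blast
qed

theorem theorem2p3:
  fixes \<phi> :: "complex^'n \<Rightarrow> real" and \<eta> :: real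
  assumes "Ck 2 \<phi>"
    and "\<exists>\<epsilon>>0. filterlim (\<lambda>z. \<eta>\<^sup>2 * grad_sq \<phi> z + (1 + \<epsilon>) * \<eta> * laplacian \<phi> z) at_top at_infinity"
  shows "compact_operator (W1_space \<phi> \<eta>) (class_norm (W1_norm \<phi> \<eta>))
           (L2_space \<phi>) (L2_dist \<phi>) (\<lambda>F. F)"
proof -
  note \<phi>_cont = Ck2_facts(2)[OF assms(1)]
  obtain \<epsilon> where \<epsilon>: "\<epsilon> > 0" "filterlim (potential \<phi> \<eta> \<epsilon>) at_top at_infinity"
    using assms(2) unfolding potential_def[abs_def] by blast
  interpret Metric_space "L2_space \<phi>" "L2_dist \<phi>"
    by (rule Metric_space_L2[OF \<phi>_cont])
  have compact: "compactin mtopology (mtopology closure_of B)"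
    if B: "B \<subseteq> W1_space \<phi> \<eta>" and N: "\<And>F. F \<in> B \<Longrightarrow> class_norm (W1_norm \<phi> \<eta>) F \<le> N" for B N
  proof -
    have BM: "B \<subseteq> L2_space \<phi>"
      using B W1_space_subset by blast
    have "mtotally_bounded B"
    proof (rule mtotally_boundedI_close_pairs[OF BM])
      fix \<sigma> :: "nat \<Rightarrow> (complex^'n \<Rightarrow> complex) set" and e :: real
      assume \<sigma>: "range \<sigma> \<subseteq> B" and e: "e > 0"
      have "\<exists>f g. f \<in> L2_fun \<phi> \<and> \<sigma> n = ae_rel \<phi> `` {f} \<and> W1_data \<phi> \<eta> (N\<^sup>2) f g" for n
      proof -
        have "\<sigma> n \<in> W1_space \<phi> \<eta>"
          using \<sigma> B by blast
        then obtain f where f: "f \<in> W1_fun \<phi> \<eta>" "\<sigma> n = ae_rel \<phi> `` {f}"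
          by (auto simp: W1_space_def elim: quotientE)
        have "W1_norm \<phi> \<eta> f \<le> N"
          using N[of "\<sigma> n"] \<sigma> W1_norm_class[OF f(1)] f(2) by auto
        then obtain f' g where f': "(f, f') \<in> ae_rel \<phi>" "W1_data \<phi> \<eta> (N\<^sup>2) f' g"
          using W1_data_exists[OF \<phi>_cont f(1)] by blast
        moreover have "\<sigma> n = ae_rel \<phi> `` {f'}"
          unfolding f(2) by (rule equiv_class_eq[OF equiv_ae_rel f'(1)])
        moreover have "f' \<in> L2_fun \<phi>"
          using f'(1) by (simp add: ae_rel_def)
        ultimately show ?thesis
          by blast
      qed
      then obtain f g where f: "\<And>n. f n \<in> L2_fun \<phi>" "\<And>n. \<sigma> n = ae_rel \<phi> `` {f n}"
        and data: "\<And>n. W1_data \<phi> \<eta> (N\<^sup>2) (f n) (g n)"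
        by metis
      obtain i j where ij: "i < j"
        and close: "sq_norm lborel (\<lambda>z. half_weight \<phi> (f i) z - half_weight \<phi> (f j) z) \<le> ennreal ((e / 2)\<^sup>2)"
        using W1_close_pair[where f=f and g=g, OF assms(1) \<epsilon> zero_le_power2 data, of "(e / 2)\<^sup>2"] e by auto
      have "(\<lambda>z. f i z - f j z) \<in> borel_measurable borel"
        using data[of i] data[of j] by (auto simp: W1_data_def intro: borel_measurable_diff)
      then have "half_weight \<phi> (\<lambda>z. f i z - f j z) \<in> borel_measurable borel"
        by (rule half_weight_borel[OF \<phi>_cont])
      then have "ennreal ((L2_norm \<phi> (\<lambda>z. f i z - f j z))\<^sup>2) = sq_norm lborel (half_weight \<phi> (\<lambda>z. f i z - f j z))"
        using L2_norm_sq[OF \<phi>_cont L2_fun_diff[OF \<phi>_cont f(1) f(1)]] by (simp add: sq_norm_lebesgue_eq_lborel)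
      also have "\<dots> \<le> ennreal ((e / 2)\<^sup>2)"
        using close by (simp add: half_weight_diff)
      finally have "(L2_norm \<phi> (\<lambda>z. f i z - f j z))\<^sup>2 \<le> (e / 2)\<^sup>2"
        by simp
      then have "L2_norm \<phi> (\<lambda>z. f i z - f j z) \<le> e / 2"
        by (rule power2_le_imp_le) (use e in simp)
      then have "L2_dist \<phi> (\<sigma> i) (\<sigma> j) < e"
        unfolding f(2) L2_dist_class[OF f(1) f(1)] using e by linarith
      with ij show "\<exists>i j. i < j \<and> L2_dist \<phi> (\<sigma> i) (\<sigma> j) < e"
        by blast
    qed
    then show ?thesis
      using mtotally_bounded_eq_compact_closure_of[OF mcomplete_L2[OF \<phi>_cont]] by blast
  qed
  show ?thesis
    unfolding compact_operator_def image_ident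
  proof (intro conjI allI impI)
    show "(\<lambda>F. F) \<in> W1_space \<phi> \<eta> \<rightarrow> L2_space \<phi>"
      using W1_space_subset by (intro Pi_I) (rule subsetD)
    fix B assume B: "B \<subseteq> W1_space \<phi> \<eta>" "\<exists>N. \<forall>F\<in>B. class_norm (W1_norm \<phi> \<eta>) F \<le> N"
    then obtain N where "\<forall>F\<in>B. class_norm (W1_norm \<phi> \<eta>) F \<le> N"
      by (elim exE)
    then show "compactin mtopology (mtopology closure_of B)"
      by (intro compact[OF B(1), of N]) (rule bspec)
  qed
qed

end
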